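(* Suppose that for all integers $d\ge 1$ and $r\ge 0$ the set $U^*_{d,r}(\mathcal{G}^*_d)$ of $r$-neighborhood statistics of finite $\mathbb{F}_d$ Schreier graphs is dense in the set $U^*_{d,r}(\mathrm{IRS}_d)$ of $r$-neighborhood statistics of invariant random subgroups of $\mathbb{F}_d$ (i.e. suppose that the Aldous--Lyons conjecture holds). Then for every $d\ge 1$ there is a computable $\mathbb{F}_d$ Schreier regularity bound $N_d^*(\varepsilon,r)$.
   Context: $\mathbb{F}_d$ is the free group on generators $a_1,\dots,a_d$, and $L_d=\{a_1,\dots,a_d,a_1^{-1},\dots,a_d^{-1}\}$. An $\mathbb{F}_d$ Schreier graph $G$ consists of a nonempty vertex set $V(G)$, a symmetric edge set $E(G)\subseteq V(G)^2$ (loops allowed) and a labeling $c_G$ assigning to each edge a nonempty subset of $L_d$ such that: $a_i\in c_G(x,y)\iff a_i^{-1}\in c_G(y,x)$; and for every $x\in V(G)$ and $\ell\in L_d$ there is a unique $y$ with $(x,y)\in E(G)$ and $\ell\in c_G(x,y)$. This is the same data as an action of $\mathbb{F}_d$ on $V(G)$, where $\ell\cdot x=y$ iff $\ell\in c_G(x,y)$. $B_r(v)$ is the edge-labeled subgraph induced on the vertices at graph distance $\le r$ from $v$, rooted at $v$. Rooted edge-labeled graphs are considered up to root- and label-preserving isomorphism $\cong^*_\bullet$. $\mathcal{F}^*_d(r)$ is the finite set of isomorphism classes of rooted graphs of radius $\le r$ around the root (loops allowed) with edges labeled by nonempty subsets of $L_d$, with $a_i$ in the label of $(x,y)$ iff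 $a_i^{-1}$ in that of $(y,x)$, and for each vertex $x$ and $\ell\in L_d$ at most one edge out of $x$ whose label contains $\ell$. For a finite $\mathbb{F}_d$ Schreier graph $G$ and $F_\bullet\in\mathcal{F}^*_d(r)$, $u^*_r(F_\bullet,G)=|\{v\in V(G):B_r(v)\cong^*_\bullet F_\bullet\}|/|V(G)|$. $\mathcal{G}^*_d$ is the set of finite $\mathbb{F}_d$ Schreier graphs up to isomorphism, and $U^*_{d,r}(G)=(u^*_r(F_\bullet,G))_{F_\bullet}\in[0,1]^{\mathcal{F}^*_d(r)}$. An invariant random subgroup of $\mathbb{F}_d$ is a Borel probability measure $\theta$ on the power set $\mathcal{P}(\mathbb{F}_d)=2^{\mathbb{F}_d}$ (product topology) that is supported on subgroups and invariant under conjugation by elements of $\mathbb{F}_d$; $\mathrm{IRS}_d$ is the set of these. For $\theta\in\mathrm{IRS}_d$, $U^*_{d,r}(\theta)\in[0,1]^{\mathcal{F}^*_d(r)}$ has $F_\bullet$-coordinate equal to the probability that, for $H$ sampled from $\theta$, the radius-$r$ ball around a vertex with stabilizer $H$ (the root coset $H$ in the Schreier graph of the action of $\mathbb{F}_d$ on $\mathbb{F}_d/H$) is isomorphic to $F_\bullet$. Density is with respect to the metric $d_\infty$ (sup metric) on $[0,1]^{\mathcal{F}^*_d(r)}$. An $\mathbb{F}_d$ Schreier regularity bound is a function $N^*_d:\mathbb{Q}_{>0}\times\mathbb{N}\to\mathbb{N}$ such that for all $(\varepsilon,r)$ and every finite $\mathbb{F}_d$ Schreier graph $G$ there is a finite $\mathbb{F}_d$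 Schreier graph $G'$ with $|V(G')|\le N^*_d(\varepsilon,r)$ and $|u^*_r(F_\bullet,G)-u^*_r(F_\bullet,G')|<\varepsilon$ for all rooted edge-labeled graphs $F_\bullet$ of radius $\le r$. Computable means Turing computable. *)

theory Defs
  imports "HOL-Probability.Probability" "HOL-Algebra.Left_Coset"
begin

section \<open>The free group on \<open>d\<close> generators\<close>

text \<open>Generators are indexed by \<open>0, \<dots>, d - 1\<close>; \<open>Gen i\<close> and \<open>Inv i\<close> stand for the
  \<open>i\<close>-th generator and its inverse.\<close>

datatype letter = Gen nat | Inv nat

fun linv :: "letter \<Rightarrow> letter" where
  "linv (Gen i) = Inv i"
| "linv (Inv i) = Gen i"

definition letters :: "nat \<Rightarrow> letter set" where
  "letters d = Gen ` {..<d} \<union> Inv ` {..<d}"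

type_synonym word = "letter list"

definition reduced :: "word \<Rightarrow> bool" where
  "reduced w \<longleftrightarrow> successively (\<lambda>x y. y \<noteq> linv x) w"

fun cons_red :: "letter \<Rightarrow> word \<Rightarrow> word" where
  "cons_red l [] = [l]"
| "cons_red l (m # w) = (if m = linv l then w else l # m # w)"

definition free_group :: "nat \<Rightarrow> word monoid" where
  "free_group d =
     \<lparr>carrier = {w. set w \<subseteq> letters d \<and> reduced w}, mult = foldr cons_red, one = []\<rparr>"

lemma linv_linv [simp]: "linv (linv l) = l"
  by (cases l) auto

lemma linv_neq [simp]: "linv l \<noteq> l"
  by (cases l) auto

lemma linv_eq_iff: "linv a = b \<longleftrightarrow> a = linv b"
  by (metis linv_linv)

lemma linv_letters [simp]: "linv l \<in> letters d \<longleftrightarrow> l \<in> letters d"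
  by (cases l) (auto simp: letters_def)

lemma reduced_Nil [simp]: "reduced []"
  by (simp add: reduced_def)

lemma reduced_Cons: "reduced (l # w) \<longleftrightarrow> reduced w \<and> (w = [] \<or> hd w \<noteq> linv l)"
  by (cases w) (auto simp: reduced_def)

lemma reduced_cons_red: "reduced w \<Longrightarrow> reduced (cons_red l w)"
  by (cases w) (auto simp: reduced_Cons)

lemma set_cons_red: "set (cons_red l w) \<subseteq> insert l (set w)"
  by (cases w) auto

lemma cons_red_cancel: "reduced w \<Longrightarrow> cons_red l (cons_red (linv l) w) = w"
  by (cases w; cases "tl w") (auto simp: reduced_Cons)

lemma reduced_foldr: "reduced v \<Longrightarrow> reduced (foldr cons_red u v)"
  by (induction u) (auto intro: reduced_cons_red)

lemma set_foldr: "set (foldr cons_red u v) \<subseteq> set u \<union> set v"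
proof (induction u)
  case (Cons l u)
  then show ?case using set_cons_red[of l "foldr cons_red u v"] by auto
qed simp

lemma foldr_cons_red:
  assumes "reduced w"
  shows "foldr cons_red (cons_red l x) w = cons_red l (foldr cons_red x w)"
proof (cases x)
  case (Cons m y)
  then show ?thesis
    using cons_red_cancel[OF reduced_foldr[OF assms], of l y] by auto
qed simp

lemma foldr_assoc:
  assumes "reduced w"
  shows "foldr cons_red (foldr cons_red u v) w = foldr cons_red u (foldr cons_red v w)"
  by (induction u) (simp_all add: foldr_cons_red[OF assms])

lemma foldr_reduced: "reduced u \<Longrightarrow> foldr cons_red u [] = u"
proof (induction u)
  case (Cons l u)
  then show ?case by (cases u) (auto simp: reduced_Cons)
qed simp

lemma foldr_inverse: "reduced u \<Longrightarrow> foldr cons_red (rev (map linv u)) u = []"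
proof (induction u)
  case (Cons l u)
  then show ?case by (simp add: reduced_Cons)
qed simp

lemma reduced_inverse: "reduced u \<Longrightarrow> reduced (rev (map linv u))"
  unfolding reduced_def successively_rev successively_map
  by (erule successively_mono) (auto simp: linv_eq_iff)

lemma group_free_group: "group (free_group d)"
proof (rule groupI)
  fix x assume "x \<in> carrier (free_group d)"
  then have x: "set x \<subseteq> letters d" "reduced x" by (auto simp: free_group_def)
  have "rev (map linv x) \<in> carrier (free_group d)"
    using x by (auto simp: free_group_def reduced_inverse)
  moreover have "rev (map linv x) \<otimes>\<^bsub>free_group d\<^esub> x = \<one>\<^bsub>free_group d\<^esub>"
    using x by (simp add: free_group_def foldr_inverse)
  ultimately show "\<exists>y\<in>carrier (free_group d). y \<otimes>\<^bsub>free_group d\<^esub> x = \<one>\<^bsub>free_group d\<^esub>" by blast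
next
  fix x y assume "x \<in> carrier (free_group d)" "y \<in> carrier (free_group d)"
  then show "x \<otimes>\<^bsub>free_group d\<^esub> y \<in> carrier (free_group d)"
    using set_foldr[of x y] by (auto simp: free_group_def intro: reduced_foldr)
qed (auto simp: free_group_def foldr_assoc)


section \<open>Edge-labeled graphs and Schreier graphs\<close>

text \<open>Values of the labeling \<open>lab\<close> outside \<open>edges\<close> are irrelevant.\<close>

record 'v lgraph =
  verts :: "'v set"
  edges :: "('v \<times> 'v) set"
  lab :: "'v \<Rightarrow> 'v \<Rightarrow> letter set"

definition labeled_graph :: "nat \<Rightarrow> 'v lgraph \<Rightarrow> bool" where
  "labeled_graph d G \<longleftrightarrow>
     verts G \<noteq> {} \<and> edges G \<subseteq> verts G \<times> verts G \<and> sym (edges G) \<and>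
     (\<forall>(x, y) \<in> edges G. lab G x y \<noteq> {} \<and> lab G x y \<subseteq> letters d \<and>
        (\<forall>i<d. Gen i \<in> lab G x y \<longleftrightarrow> Inv i \<in> lab G y x))"

definition schreier_graph :: "nat \<Rightarrow> 'v lgraph \<Rightarrow> bool" where
  "schreier_graph d G \<longleftrightarrow> labeled_graph d G \<and>
     (\<forall>x\<in>verts G. \<forall>l\<in>letters d. \<exists>!y. (x, y) \<in> edges G \<and> l \<in> lab G x y)"

text \<open>Every finite graph is isomorphic to one with vertices in \<open>nat\<close>.\<close>

definition finite_schreier_graphs :: "nat \<Rightarrow> nat lgraph set" where
  "finite_schreier_graphs d = {G. schreier_graph d G \<and> finite (verts G)}"

type_synonym 'v rooted = "'v lgraph \<times> 'v"

definition ball_verts :: "'v lgraph \<Rightarrow> nat \<Rightarrow> 'v \<Rightarrow> 'v set" where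
  "ball_verts G r v = {w \<in> verts G. \<exists>k\<le>r. (v, w) \<in> edges G ^^ k}"

definition rball :: "'v lgraph \<Rightarrow> nat \<Rightarrow> 'v \<Rightarrow> 'v rooted" where
  "rball G r v =
     (\<lparr>verts = ball_verts G r v,
       edges = edges G \<inter> (ball_verts G r v \<times> ball_verts G r v),
       lab = lab G\<rparr>, v)"

definition rooted_iso :: "'v rooted \<Rightarrow> 'w rooted \<Rightarrow> bool" where
  "rooted_iso P Q \<longleftrightarrow> (case (P, Q) of ((G, v), (H, w)) \<Rightarrow>
     \<exists>f. bij_betw f (verts G) (verts H) \<and> f v = w \<and>
       (\<forall>x\<in>verts G. \<forall>y\<in>verts G.
          ((x, y) \<in> edges G \<longleftrightarrow> (f x, f y) \<in> edges H) \<and>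
          ((x, y) \<in> edges G \<longrightarrow> lab G x y = lab H (f x) (f y))))"

text \<open>Vertices are within distance \<open>r\<close> of the root and have at most \<open>2 * d\<close> neighbours,
  so these graphs are finite and \<open>nat\<close> is large enough as vertex type.\<close>

definition rooted_graphs :: "nat \<Rightarrow> nat \<Rightarrow> nat rooted set" where
  "rooted_graphs d r = {(F, v). labeled_graph d F \<and> v \<in> verts F \<and> ball_verts F r v = verts F \<and>
     (\<forall>x\<in>verts F. \<forall>l\<in>letters d. \<forall>y z.
        (x, y) \<in> edges F \<and> l \<in> lab F x y \<and> (x, z) \<in> edges F \<and> l \<in> lab F x z \<longrightarrow> y = z)}"

definition ball_classes :: "nat \<Rightarrow> nat \<Rightarrow> nat rooted set set" where
  "ball_classes d r = rooted_graphs d r //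
     {(P, Q). P \<in> rooted_graphs d r \<and> Q \<in> rooted_graphs d r \<and> rooted_iso P Q}"

definition has_type :: "'v rooted \<Rightarrow> nat rooted set \<Rightarrow> bool" where
  "has_type P C \<longleftrightarrow> (\<exists>F\<in>C. rooted_iso P F)"

definition u_stat :: "nat \<Rightarrow> nat rooted set \<Rightarrow> 'v lgraph \<Rightarrow> real" where
  "u_stat r C G = real (card {v \<in> verts G. has_type (rball G r v) C}) / real (card (verts G))"

definition U_graph :: "nat \<Rightarrow> nat \<Rightarrow> 'v lgraph \<Rightarrow> nat rooted set \<Rightarrow> real" where
  "U_graph d r G = (\<lambda>C\<in>ball_classes d r. u_stat r C G)"


section \<open>Invariant random subgroups\<close>

text \<open>The product topology on the power set of \<open>A\<close>, subsets being identified with their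
  indicator functions.\<close>

definition powerset_topology :: "'a set \<Rightarrow> 'a set topology" where
  "powerset_topology A = pullback_topology (Pow A) (\<lambda>S. \<lambda>x\<in>A. x \<in> S)
     (product_topology (\<lambda>_. discrete_topology (UNIV :: bool set)) A)"

definition conj_set :: "nat \<Rightarrow> word \<Rightarrow> word set \<Rightarrow> word set" where
  "conj_set d g S =
     (\<lambda>x. g \<otimes>\<^bsub>free_group d\<^esub> x \<otimes>\<^bsub>free_group d\<^esub> inv\<^bsub>free_group d\<^esub> g) ` S"

definition IRS :: "nat \<Rightarrow> word set measure set" where
  "IRS d = {\<theta>. prob_space \<theta> \<and> space \<theta> = Pow (carrier (free_group d)) \<and>
     sets \<theta> = sigma_sets (Pow (carrier (free_group d)))
       {U. openin (powerset_topology (carrier (free_group d))) U} \<and>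
     (AE H in \<theta>. subgroup H (free_group d)) \<and>
     (\<forall>g\<in>carrier (free_group d). distr \<theta> \<theta> (conj_set d g) = \<theta>)}"

definition coset_graph :: "nat \<Rightarrow> word set \<Rightarrow> word set lgraph" where
  "coset_graph d H =
     \<lparr>verts = lcosets\<^bsub>free_group d\<^esub> H,
      edges = {(X, Y). X \<in> lcosets\<^bsub>free_group d\<^esub> H \<and> (\<exists>l\<in>letters d. Y = [l] <#\<^bsub>free_group d\<^esub> X)},
      lab = (\<lambda>X Y. {l \<in> letters d. Y = [l] <#\<^bsub>free_group d\<^esub> X})\<rparr>"

definition U_irs :: "nat \<Rightarrow> nat \<Rightarrow> word set measure \<Rightarrow> nat rooted set \<Rightarrow> real" where
  "U_irs d r \<theta> = (\<lambda>C\<in>ball_classes d r.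
     measure \<theta> {H. subgroup H (free_group d) \<and> has_type (rball (coset_graph d H) r H) C})"

definition d_inf :: "nat \<Rightarrow> nat \<Rightarrow> (nat rooted set \<Rightarrow> real) \<Rightarrow> (nat rooted set \<Rightarrow> real) \<Rightarrow> real" where
  "d_inf d r x y = (SUP C\<in>ball_classes d r. \<bar>x C - y C\<bar>)"

definition dense_wrt :: "('a \<Rightarrow> 'a \<Rightarrow> real) \<Rightarrow> 'a set \<Rightarrow> 'a set \<Rightarrow> bool" where
  "dense_wrt dst A B \<longleftrightarrow> (\<forall>b\<in>B. \<forall>\<epsilon>>0. \<exists>a\<in>A. dst a b < \<epsilon>)"


section \<open>Turing machines\<close>

text \<open>Deterministic multi-tape machines with two-way infinite tapes. States are
  \<open>0, \<dots>, nstates - 1\<close> with initial state \<open>0\<close>; symbols are \<open>0, \<dots>, nsymbols - 1\<close> where \<open>0\<close> is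
  the blank and \<open>1\<close> the stroke used for unary input and output. Only finitely many values of
  \<open>delta\<close> matter: those at a state and a list of \<open>ntapes\<close> symbols. The value \<open>None\<close> means that
  the machine halts.\<close>

datatype move = MoveLeft | Stay | MoveRight

record tm =
  ntapes :: nat
  nstates :: nat
  nsymbols :: nat
  delta :: "nat \<Rightarrow> nat list \<Rightarrow> (nat \<times> (nat \<times> move) list) option"

definition wf_tm :: "tm \<Rightarrow> bool" where
  "wf_tm M \<longleftrightarrow> 1 \<le> ntapes M \<and> 1 \<le> nstates M \<and> 2 \<le> nsymbols M \<and>
     (\<forall>q<nstates M. \<forall>ss. length ss = ntapes M \<and> set ss \<subseteq> {..<nsymbols M} \<longrightarrow>
        (\<forall>q' acts. delta M q ss = Some (q', acts) \<longrightarrow>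
           q' < nstates M \<and> length acts = ntapes M \<and> fst ` set acts \<subseteq> {..<nsymbols M}))"

type_synonym tape = "(int \<Rightarrow> nat) \<times> int"

type_synonym config = "nat \<times> tape list"

fun shift :: "move \<Rightarrow> int" where
  "shift MoveLeft = -1"
| "shift Stay = 0"
| "shift MoveRight = 1"

fun act :: "nat \<times> move \<Rightarrow> tape \<Rightarrow> tape" where
  "act (s, m) (t, h) = (t(h := s), h + shift m)"

fun tm_step :: "tm \<Rightarrow> config \<Rightarrow> config option" where
  "tm_step M (q, ts) = (case delta M q (map (\<lambda>(t, h). t h) ts) of
     None \<Rightarrow> None
   | Some (q', acts) \<Rightarrow> Some (q', map2 act acts ts))"

definition unary :: "nat \<Rightarrow> int \<Rightarrow> nat" where
  "unary n = (\<lambda>p. if 0 \<le> p \<and> p < int n then 1 else 0)"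

text \<open>The \<open>i\<close>-th argument is written in unary on tape \<open>i\<close>; the remaining tapes are blank,
  which is also the unary representation of \<open>0\<close>.\<close>

definition tm_init :: "tm \<Rightarrow> nat list \<Rightarrow> config" where
  "tm_init M xs =
     (0, map (\<lambda>i. (unary (if i < length xs then xs ! i else 0), 0)) [0..<ntapes M])"

text \<open>The machine halts with the unary representation of \<open>y\<close> on tape \<open>0\<close>.\<close>

definition tm_computes :: "tm \<Rightarrow> nat list \<Rightarrow> nat \<Rightarrow> bool" where
  "tm_computes M xs y \<longleftrightarrow> length xs \<le> ntapes M \<and>
     (\<exists>q ts. (\<lambda>c c'. tm_step M c = Some c')\<^sup>*\<^sup>* (tm_init M xs) (q, ts) \<and>
        tm_step M (q, ts) = None \<and> fst (ts ! 0) = unary y)"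

text \<open>A positive rational is presented to the machine as its numerator and denominator in
  lowest terms.\<close>

definition turing_computable :: "(rat \<Rightarrow> nat \<Rightarrow> nat) \<Rightarrow> bool" where
  "turing_computable N \<longleftrightarrow> (\<exists>M. wf_tm M \<and>
     (\<forall>\<epsilon>>0. \<forall>r. tm_computes M
        [nat (fst (quotient_of \<epsilon>)), nat (snd (quotient_of \<epsilon>)), r] (N \<epsilon> r)))"


section \<open>Regularity bounds\<close>

text \<open>Only the values of \<open>N\<close> at positive rationals are relevant.\<close>

definition schreier_regularity_bound :: "nat \<Rightarrow> (rat \<Rightarrow> nat \<Rightarrow> nat) \<Rightarrow> bool" where
  "schreier_regularity_bound d N \<longleftrightarrow>
     (\<forall>\<epsilon>>0. \<forall>r. \<forall>G\<in>finite_schreier_graphs d. \<exists>G'\<in>finite_schreier_graphs d.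
        card (verts G') \<le> N \<epsilon> r \<and>
        (\<forall>C\<in>ball_classes d r. \<bar>u_stat r C G - u_stat r C G'\<bar> < real_of_rat \<epsilon>))"

end

theory Submission
  imports Defs
begin

text \<open>
  The bound \<open>N \<epsilon> r\<close> is the least \<open>m\<close> that passes a finite test, \<open>certified d m num den r\<close> with
  \<open>\<epsilon> = num / den\<close>. The test is sound unconditionally. The density hypothesis only serves to show
  that for all \<open>\<epsilon>\<close> and \<open>r\<close> some \<open>m\<close> passes, in other words that the search for \<open>N \<epsilon> r\<close> terminates.

  The local picture at a vertex \<open>v\<close> of a Schreier graph is the set of words that fix \<open>v\<close>: two balls
  of radius \<open>r\<close> are isomorphic iff the same words of length at most \<open>2 * r + 1\<close> fix their roots
  (\<open>rball_iso_iff\<close>). For words up to a given length there are finitely many possible pictures, each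
  given by a function that sends a word to the vertex it leads to (\<open>local_action\<close>). A finite graph
  assigns frequencies to them. These frequencies are invariant under moving the root along a letter,
  and rounded to multiples of \<open>1 / K\<close> they are still almost invariant. The test at \<open>m\<close> asks whether
  all almost invariant weights on the pictures for words with codes up to about \<open>m\<close> are approximated,
  up to \<open>\<epsilon> / 2\<close>, by the frequencies of an actual graph with at most \<open>m\<close> vertices. Applied to the
  rounded frequencies of an arbitrary finite graph \<open>G\<close>, this yields a graph of at most \<open>m\<close> vertices
  with nearly the same statistics as \<open>G\<close> (\<open>certified_sound\<close>).

  Suppose that no \<open>m\<close> passes. Then for every large \<open>m\<close> there are almost invariant weights, that is, an
  almost invariant random set of words, that no graph of at most \<open>m\<close> vertices approximates. By
  compactness a subsequence converges in distribution to a random set of words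
  (\<open>random_set_limit\<close>). The limit is almost surely a subgroup, because the sets of words fixing a
  root satisfy more and more of the closure conditions, and its law is invariant under conjugation,
  because the invariance errors tend to zero. So the limit is an invariant random subgroup
  (\<open>irs_in_IRS\<close>). By density its statistics are close to those of a finite graph, which therefore
  approximates the weights for all large \<open>m\<close> of the subsequence, a contradiction
  (\<open>certified_exists\<close>).

  The test is a formula of bounded arithmetic. The functions computed by counter programs are closed
  under primitive recursion, so they can evaluate it (\<open>cpred_certified\<close>) and search for the least
  solution, and a Turing machine simulates a counter program with one unary tape per counter
  (\<open>turing_computable_Least\<close>).
\<close>

section \<open>Counter programs on Turing machines\<close>

text \<open>A counter in unary is inspected by looking at the cell before the end of its block, and
  finding a stroke there one may as well erase it. Hence the loop \<open>LOOP r c\<close> decrements \<open>r\<close> before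
  each run of its body.\<close>

datatype com = INC nat | DEC nat | SEQ com com | LOOP nat com

inductive exec :: "com \<Rightarrow> (nat \<Rightarrow> nat) \<Rightarrow> (nat \<Rightarrow> nat) \<Rightarrow> bool" where
  exec_INC: "exec (INC r) s (s(r := Suc (s r)))"
| exec_DEC: "exec (DEC r) s (s(r := s r - 1))"
| exec_SEQ: "exec c s t \<Longrightarrow> exec c' t u \<Longrightarrow> exec (SEQ c c') s u"
| exec_LOOP0: "s r = 0 \<Longrightarrow> exec (LOOP r c) s s"
| exec_LOOP: "s r \<noteq> 0 \<Longrightarrow> exec c (s(r := s r - 1)) t \<Longrightarrow> exec (LOOP r c) t u \<Longrightarrow> exec (LOOP r c) s u"

datatype instr = Inc nat nat | Dec nat nat nat | Jmp nat

fun compile :: "com \<Rightarrow> nat \<Rightarrow> instr list" where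
  "compile (INC r) b = [Inc r (b + 1)]"
| "compile (DEC r) b = [Dec r (b + 1) (b + 1)]"
| "compile (SEQ c c') b = compile c b @ compile c' (b + length (compile c b))"
| "compile (LOOP r c) b =
     Dec r (b + 1) (b + 2 + length (compile c (b + 1))) # compile c (b + 1) @ [Jmp b]"

fun targets :: "instr \<Rightarrow> nat set" where
  "targets (Inc r j) = {j}"
| "targets (Dec r j k) = {j, k}"
| "targets (Jmp j) = {j}"

fun regs :: "com \<Rightarrow> nat set" where
  "regs (INC r) = {r}"
| "regs (DEC r) = {r}"
| "regs (SEQ c c') = regs c \<union> regs c'"
| "regs (LOOP r c) = insert r (regs c)"

lemma finite_regs: "finite (regs c)"
  by (induction c) auto

lemma targets_compile: "i \<in> set (compile c b) \<Longrightarrow> targets i \<subseteq> {..b + length (compile c b)}"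
  by (induction c arbitrary: b i) fastforce+

definition only_on :: "nat \<Rightarrow> nat \<times> move \<Rightarrow> nat list \<Rightarrow> (nat \<times> move) list" where
  "only_on r a ss = (map (\<lambda>s. (s, Stay)) ss)[r := a]"

text \<open>Counter \<open>i\<close> lives in unary on tape \<open>i\<close>, with the head on the first blank after the
  block. State \<open>0\<close> brings the heads there from the initial configuration. The instruction at address
  \<open>pc\<close> owns the states \<open>2 * pc + 1\<close> and \<open>2 * pc + 2\<close>; the second one is reached by \<open>Dec\<close> after a step
  to the left, when the symbol under the head tells whether the counter is positive.\<close>

definition tm_of :: "nat \<Rightarrow> instr list \<Rightarrow> tm" where
  "tm_of k P = \<lparr>ntapes = k, nstates = 2 * length P + 2, nsymbols = 2,
     delta = (\<lambda>q ss.
       if q = 0 then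
         if 1 \<in> set ss then Some (0, map (\<lambda>s. (s, if s = 1 then MoveRight else Stay)) ss)
         else Some (1, map (\<lambda>s. (s, Stay)) ss)
       else if (q - 1) div 2 \<ge> length P then None
       else case P ! ((q - 1) div 2) of
         Inc r j \<Rightarrow> Some (2 * j + 1, only_on r (1, MoveRight) ss)
       | Jmp j \<Rightarrow> Some (2 * j + 1, map (\<lambda>s. (s, Stay)) ss)
       | Dec r j j' \<Rightarrow>
           if odd q then Some (q + 1, only_on r (ss ! r, MoveLeft) ss)
           else if ss ! r = 1 then Some (2 * j + 1, only_on r (0, Stay) ss)
           else Some (2 * j' + 1, only_on r (ss ! r, MoveRight) ss))\<rparr>"

lemma only_on_bounds:
  assumes "set ss \<subseteq> {..<2}" "fst a < 2"
  shows "length (only_on r a ss) = length ss" "fst ` set (only_on r a ss) \<subseteq> {..<2}"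
proof -
  show "fst ` set (only_on r a ss) \<subseteq> {..<2}"
    using set_update_subset_insert[of "map (\<lambda>s. (s, Stay)) ss" r a] assms
    unfolding only_on_def by force
qed (simp add: only_on_def)

lemma wf_tm_of:
  assumes "1 \<le> k" and P: "\<And>i. i \<in> set P \<Longrightarrow> targets i \<subseteq> {..length P} \<and> (case i of Dec r _ _ \<Rightarrow> r < k | _ \<Rightarrow> True)"
  shows "wf_tm (tm_of k P)"
  unfolding wf_tm_def
proof (intro conjI allI impI)
  fix q ss q' acts
  assume q: "q < nstates (tm_of k P)"
    and ss: "length ss = ntapes (tm_of k P) \<and> set ss \<subseteq> {..<nsymbols (tm_of k P)}"
    and step: "delta (tm_of k P) q ss = Some (q', acts)"
  have ss': "length ss = k" "set ss \<subseteq> {..<2}" using ss by (auto simp: tm_of_def)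
  have "q' < 2 * length P + 2 \<and> length acts = k \<and> fst ` set acts \<subseteq> {..<2}"
  proof (cases "q = 0")
    case True
    then show ?thesis using step ss' by (auto simp: tm_of_def split: if_splits)
  next
    case False
    define pc where "pc = (q - 1) div 2"
    have pc: "pc < length P" using step False by (auto simp: tm_of_def pc_def split: if_splits)
    note pc' = pc_def[symmetric, simplified]
    have i: "P ! pc \<in> set P" using pc by simp
    have q2: "q + 1 < 2 * length P + 2" if "odd q"
      using that pc unfolding pc_def by (elim oddE) auto
    show ?thesis
    proof (cases "P ! pc")
      case (Inc r j)
      then have "j \<le> length P" using P[OF i] by auto
      then show ?thesis using step False pc ss' only_on_bounds[OF ss'(2), of "(1, MoveRight)" r]
        by (auto simp: tm_of_def pc' Inc)
    next
      case (Jmp j)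
      then have "j \<le> length P" using P[OF i] by auto
      then show ?thesis using step False pc ss'
        by (auto simp: tm_of_def pc' Jmp)
    next
      case (Dec r j j')
      then have *: "j \<le> length P" "j' \<le> length P" "r < k" using P[OF i] by auto
      then have "ss ! r < 2" using ss' nth_mem[of r ss] by blast
      then show ?thesis using step False pc ss' * q2
          only_on_bounds[OF ss'(2), of "(ss ! r, MoveLeft)" r]
          only_on_bounds[OF ss'(2), of "(ss ! r, MoveRight)" r]
          only_on_bounds[OF ss'(2), of "(0, Stay)" r]
        by (auto simp: tm_of_def pc' Dec split: if_splits)
    qed
  qed
  then show "q' < nstates (tm_of k P)" "length acts = ntapes (tm_of k P)"
    "fst ` set acts \<subseteq> {..<nsymbols (tm_of k P)}"
    by (auto simp: tm_of_def)
qed (use assms in \<open>auto simp: tm_of_def\<close>)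

definition tapes :: "nat \<Rightarrow> (nat \<Rightarrow> nat) \<Rightarrow> (nat \<Rightarrow> int) \<Rightarrow> tape list" where
  "tapes k s h = map (\<lambda>i. (unary (s i), h i)) [0..<k]"

definition conf :: "nat \<Rightarrow> nat \<Rightarrow> (nat \<Rightarrow> nat) \<Rightarrow> config" where
  "conf k pc s = (2 * pc + 1, tapes k s (\<lambda>i. int (s i)))"

lemma unary_simps:
  "unary n (int n) = 0" "unary 0 p = 0" "unary (Suc n) (int n) = 1"
  "(unary n)(int n := Suc 0) = unary (Suc n)"
  "(unary (Suc n))(int n := 0) = unary n"
  by (auto simp: unary_def fun_eq_iff)

lemma read_tapes: "map (\<lambda>(t, h). t h) (tapes k s h) = map (\<lambda>i. unary (s i) (h i)) [0..<k]"
  by (simp add: tapes_def)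

lemma stay_tapes:
  "map2 act (map (\<lambda>s. (s, Stay)) (map (\<lambda>i. unary (s i) (h i)) [0..<k])) (tapes k s h) = tapes k s h"
  by (auto simp: tapes_def intro!: nth_equalityI)

lemma only_on_tapes:
  assumes "r < k" "act a (unary (s r), h r) = (unary y, p)"
  shows "map2 act (only_on r a (map (\<lambda>i. unary (s i) (h i)) [0..<k])) (tapes k s h) =
     tapes k (s(r := y)) (h(r := p))"
  using assms by (auto simp: tapes_def only_on_def nth_list_update intro!: nth_equalityI)

abbreviation steps :: "tm \<Rightarrow> config \<Rightarrow> config \<Rightarrow> bool" where
  "steps M \<equiv> (\<lambda>c c'. tm_step M c = Some c')\<^sup>*\<^sup>*"

lemma step_Inc:
  assumes "pc < length P" "P ! pc = Inc r j" "r < k"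
  shows "steps (tm_of k P) (conf k pc s) (conf k j (s(r := Suc (s r))))"
proof -
  have "map2 act (only_on r (1, MoveRight) (map (\<lambda>i. unary (s i) (int (s i))) [0..<k]))
      (tapes k s (\<lambda>i. int (s i))) = tapes k (s(r := Suc (s r))) ((\<lambda>i. int (s i))(r := int (Suc (s r))))"
    by (rule only_on_tapes) (auto simp: assms unary_simps)
  moreover have "((\<lambda>i. int (s i))(r := int (Suc (s r)))) = (\<lambda>i. int ((s(r := Suc (s r))) i))"
    by auto
  ultimately have "tm_step (tm_of k P) (conf k pc s) = Some (conf k j (s(r := Suc (s r))))"
    using assms by (simp add: conf_def read_tapes tm_of_def)
  then show ?thesis by (rule r_into_rtranclp)
qed

lemma step_Jmp:
  assumes "pc < length P" "P ! pc = Jmp j"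
  shows "steps (tm_of k P) (conf k pc s) (conf k j s)"
proof -
  have "tm_step (tm_of k P) (conf k pc s) = Some (conf k j s)"
    using assms stay_tapes[of s "\<lambda>i. int (s i)" k] by (simp add: conf_def read_tapes tm_of_def)
  then show ?thesis by (rule r_into_rtranclp)
qed

text \<open>The head of an empty counter moves to position \<open>-1\<close>, which stays blank throughout, so the
  blank read there is a correct zero test.\<close>

lemma step_Dec:
  assumes "pc < length P" "P ! pc = Dec r j j'" "r < k"
  shows "steps (tm_of k P) (conf k pc s) (conf k (if s r = 0 then j' else j) (s(r := s r - 1)))"
proof -
  let ?h = "\<lambda>i. int (s i)"
  let ?h' = "?h(r := int (s r) - 1)"
  let ?c = "(2 * pc + 2, tapes k s ?h')"
  have "map2 act (only_on r (map (\<lambda>i. unary (s i) (?h i)) [0..<k] ! r, MoveLeft)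
      (map (\<lambda>i. unary (s i) (?h i)) [0..<k])) (tapes k s ?h) = tapes k (s(r := s r)) ?h'"
    by (rule only_on_tapes) (use assms in \<open>auto simp: unary_def fun_eq_iff\<close>)
  then have 1: "tm_step (tm_of k P) (conf k pc s) = Some ?c"
    using assms by (simp add: conf_def read_tapes tm_of_def)
  have 2: "tm_step (tm_of k P) ?c = Some (conf k (if s r = 0 then j' else j) (s(r := s r - 1)))"
  proof (cases "s r")
    case 0
    have "map2 act (only_on r (map (\<lambda>i. unary (s i) (?h' i)) [0..<k] ! r, MoveRight)
       (map (\<lambda>i. unary (s i) (?h' i)) [0..<k])) (tapes k s ?h') = tapes k (s(r := 0)) (?h'(r := 0))"
      by (rule only_on_tapes) (use assms 0 in \<open>auto simp: unary_simps fun_eq_iff\<close>)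
    moreover have "?h'(r := 0) = (\<lambda>i. int ((s(r := 0)) i))" by auto
    moreover have "map (\<lambda>i. unary (s i) (?h' i)) [0..<k] ! r = 0"
      using assms 0 by (simp add: unary_simps)
    ultimately show ?thesis
      using assms 0 by (simp add: conf_def read_tapes tm_of_def)
  next
    case (Suc n)
    have "map2 act (only_on r (0, Stay)
       (map (\<lambda>i. unary (s i) (?h' i)) [0..<k])) (tapes k s ?h') = tapes k (s(r := n)) (?h'(r := int n))"
      by (rule only_on_tapes) (use assms Suc in \<open>auto simp: unary_simps fun_eq_iff\<close>)
    moreover have "?h'(r := int n) = (\<lambda>i. int ((s(r := n)) i))" by auto
    moreover have "map (\<lambda>i. unary (s i) (?h' i)) [0..<k] ! r = 1"
      using assms Suc by (simp add: unary_simps)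
    ultimately show ?thesis
      using assms Suc by (simp add: conf_def read_tapes tm_of_def if_distrib[of int])
  qed
  have "steps (tm_of k P) ?c (conf k (if s r = 0 then j' else j) (s(r := s r - 1)))"
    using 2 by (rule r_into_rtranclp)
  with 1 show ?thesis by (rule converse_rtranclp_into_rtranclp)
qed

text \<open>The program sits anywhere inside a larger one, since the body of a loop has to be run
  in place, between the test and the jump back to it.\<close>

lemma steps_compile:
  assumes "exec c s t"
    and "P = P1 @ compile c (length P1) @ P2" "regs c \<subseteq> {..<k}"
  shows "steps (tm_of k P) (conf k (length P1) s) (conf k (length P1 + length (compile c (length P1))) t)"
  using assms
proof (induction arbitrary: P P1 P2 rule: exec.induct)
  case (exec_INC r s)
  then show ?case using step_Inc[of "length P1" P r "length P1 + 1" k s] by (simp add: fun_upd_def)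
next
  case (exec_DEC r s)
  then show ?case using step_Dec[of "length P1" P r "length P1 + 1" "length P1 + 1" k s] by (simp add: fun_upd_def)
next
  case (exec_SEQ c s t c' u)
  let ?P1' = "P1 @ compile c (length P1)"
  have "steps (tm_of k P) (conf k (length P1) s) (conf k (length ?P1') t)"
    using exec_SEQ.IH(1)[of P P1 "compile c' (length ?P1') @ P2"] exec_SEQ.prems by simp
  also have "steps (tm_of k P) \<dots> (conf k (length ?P1' + length (compile c' (length ?P1'))) u)"
    using exec_SEQ.IH(2)[of P ?P1' P2] exec_SEQ.prems by simp
  finally show ?case by (simp add: add.assoc)
next
  case (exec_LOOP0 s r c)
  let ?l = "length P1 + 2 + length (compile c (length P1 + 1))"
  have "s(r := s r - 1) = s" using exec_LOOP0(1) by auto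
  then show ?case using step_Dec[of "length P1" P r "length P1 + 1" ?l k s] exec_LOOP0
    by (simp add: nth_append)
next
  case (exec_LOOP s r c t u)
  let ?b = "length P1"
  let ?l = "?b + 2 + length (compile c (?b + 1))"
  have "steps (tm_of k P) (conf k ?b s) (conf k (?b + 1) (s(r := s r - 1)))"
    using step_Dec[of ?b P r "?b + 1" ?l k s] exec_LOOP by (simp add: nth_append)
  also have "steps (tm_of k P) \<dots> (conf k (?b + 1 + length (compile c (?b + 1))) t)"
    using exec_LOOP.IH(1)[of P "P1 @ [Dec r (?b + 1) ?l]" "Jmp ?b # P2"] exec_LOOP.prems
    by (simp add: fun_upd_def)
  also have "steps (tm_of k P) \<dots> (conf k ?b t)"
    by (rule step_Jmp) (use exec_LOOP.prems in \<open>simp_all add: nth_append\<close>)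
  also have "steps (tm_of k P) \<dots> (conf k (?b + length (compile (LOOP r c) ?b)) u)"
    using exec_LOOP.IH(2)[of P P1 P2] exec_LOOP.prems by simp
  finally show ?case .
qed

text \<open>The tapes whose head still reads a stroke advance together, so after \<open>t\<close> steps head
  \<open>i\<close> is at \<open>min t (x i)\<close>.\<close>

lemma steps_init:
  assumes "\<And>i. i < k \<Longrightarrow> x i \<le> b"
  shows "steps (tm_of k P) (0, tapes k x (\<lambda>i. int (min t (x i)))) (conf k 0 x)"
proof (induction "b - t" arbitrary: t rule: less_induct)
  case less
  let ?h = "\<lambda>i. int (min t (x i))"
  show ?case
  proof (cases "\<exists>i<k. t < x i")
    case True
    then have "t < b" using assms by fastforce
    have r: "unary (x i) (?h i) = (if t < x i then 1 else 0)" for i by (auto simp: unary_def)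
    let ?ss = "map (\<lambda>i. unary (x i) (?h i)) [0..<k]"
    have "1 \<in> set ?ss" using True r by (auto simp del: of_nat_min intro!: image_eqI)
    moreover have "map2 act (map (\<lambda>s. (s, if s = 1 then MoveRight else Stay)) ?ss) (tapes k x ?h) =
        tapes k x (\<lambda>i. int (min (Suc t) (x i)))"
      by (auto simp: tapes_def unary_def fun_eq_iff intro!: nth_equalityI)
    ultimately have "tm_step (tm_of k P) (0, tapes k x ?h) =
        Some (0, tapes k x (\<lambda>i. int (min (Suc t) (x i))))"
      by (simp add: read_tapes tm_of_def del: of_nat_min)
    moreover have "steps (tm_of k P) (0, tapes k x (\<lambda>i. int (min (Suc t) (x i)))) (conf k 0 x)"
      by (rule less) (use \<open>t < b\<close> in auto)
    ultimately show ?thesis by (rule converse_rtranclp_into_rtranclp)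
  next
    case False
    then have h: "tapes k x ?h = tapes k x (\<lambda>i. int (x i))"
      by (auto simp: tapes_def)
    have "tm_step (tm_of k P) (0, tapes k x (\<lambda>i. int (x i))) = Some (conf k 0 x)"
      using stay_tapes[of x "\<lambda>i. int (x i)" k]
      by (simp add: read_tapes tm_of_def conf_def unary_simps image_iff)
    then show ?thesis unfolding h by (rule r_into_rtranclp)
  qed
qed

lemma tm_of_program:
  assumes "\<And>xs. xs \<in> R' \<Longrightarrow> length xs \<le> j"
    and "\<And>xs. xs \<in> R' \<Longrightarrow> \<exists>t. exec c (\<lambda>i. if i < length xs then xs ! i else 0) t \<and> t 0 = f xs"
  shows "\<exists>M. wf_tm M \<and> (\<forall>xs\<in>R'. tm_computes M xs (f xs))"
proof -
  obtain k0 where k0: "regs c \<subseteq> {..<k0}"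
    using finite_nat_iff_bounded finite_regs by blast
  define k where "k = Suc (max k0 j)"
  let ?P = "compile c 0"
  let ?M = "tm_of k ?P"
  have k: "regs c \<subseteq> {..<k}" using k0 by (auto simp: k_def)
  have D: "case i of Dec r _ _ \<Rightarrow> r < k | _ \<Rightarrow> True" if "i \<in> set (compile c b)" "regs c \<subseteq> {..<k}" for i b c
    using that by (induction c arbitrary: b) (auto split: instr.splits)
  have "wf_tm ?M"
    by (rule wf_tm_of) (use targets_compile[of _ c 0] D[OF _ k] in \<open>auto simp: k_def\<close>)
  moreover have "tm_computes ?M xs (f xs)" if xs: "xs \<in> R'" for xs
  proof -
    let ?x = "\<lambda>i. if i < length xs then xs ! i else 0"
    obtain t where t: "exec c ?x t" "t 0 = f xs" using assms(2)[OF xs] by blast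
    have "tm_init ?M xs = (0, tapes k ?x (\<lambda>i. int (min 0 (?x i))))"
      by (auto simp: tm_init_def tapes_def tm_of_def)
    moreover have "steps ?M (0, tapes k ?x (\<lambda>i. int (min 0 (?x i)))) (conf k 0 ?x)"
      by (rule steps_init[where b = "Max (?x ` {..<k})"]) (rule Max_ge, auto)
    moreover have "steps ?M (conf k 0 ?x) (conf k (length ?P) t)"
      using steps_compile[OF t(1), of ?P "[]" "[]" k] k by simp
    ultimately have "steps ?M (tm_init ?M xs) (conf k (length ?P) t)" by auto
    moreover have "tm_step ?M (conf k (length ?P) t) = None"
      by (simp add: conf_def tm_of_def)
    moreover have "fst (snd (conf k (length ?P) t) ! 0) = unary (f xs)"
      using t(2) nth_map_upt[of 0 k 0 "\<lambda>i. (unary (t i), int (t i))"]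
      by (simp add: conf_def tapes_def k_def del: upt_Suc)
    moreover have "length xs \<le> ntapes ?M"
      using assms(1)[OF xs] by (simp add: tm_of_def k_def)
    ultimately show ?thesis unfolding tm_computes_def by (metis prod.collapse)
  qed
  ultimately show ?thesis by blast
qed

section \<open>Functions computed by counter programs\<close>

text \<open>The states \<open>S i\<close> are those before the test for the \<open>i\<close>-th time; the counter is decremented
  before the body sees it.\<close>

lemma exec_loop:
  assumes "\<And>i. i \<le> N \<Longrightarrow> S i r = N - i"
    and "\<And>i. i < N \<Longrightarrow> exec c ((S i)(r := N - i - 1)) (S (Suc i))"
  shows "exec (LOOP r c) (S 0) (S N)"
proof -
  have "exec (LOOP r c) (S i) (S N)" if "i \<le> N" for i
    using that
  proof (induction "N - i" arbitrary: i)
    case 0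
    then show ?case using assms(1)[of N] by (auto intro: exec_LOOP0)
  next
    case (Suc m)
    then have i: "i < N" by simp
    show ?case
    proof (rule exec_LOOP)
      show "S i r \<noteq> 0" using assms(1)[of i] i by simp
      show "exec c ((S i)(r := S i r - 1)) (S (Suc i))"
        using assms(1)[of i] assms(2)[OF i] i by simp
      show "exec (LOOP r c) (S (Suc i)) (S N)" using Suc i by simp
    qed
  qed
  then show ?thesis by blast
qed

lemma exec_move:
  assumes "r \<noteq> t"
  shows "exec (LOOP r (INC t)) s (s(r := 0, t := s t + s r))"
proof -
  let ?S = "\<lambda>i. s(r := s r - i, t := s t + i)"
  have "exec (LOOP r (INC t)) (?S 0) (?S (s r))"
  proof (rule exec_loop)
    fix i assume "i < s r"
    have "exec (INC t) ((?S i)(r := s r - i - 1)) (((?S i)(r := s r - i - 1))(t := Suc (((?S i)(r := s r - i - 1)) t)))"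
      by (rule exec_INC)
    also have "((?S i)(r := s r - i - 1))(t := Suc (((?S i)(r := s r - i - 1)) t)) = ?S (Suc i)"
      using assms by (auto simp: fun_eq_iff)
    finally show "exec (INC t) ((?S i)(r := s r - i - 1)) (?S (Suc i))" .
  qed (use assms in auto)
  then show ?thesis by simp
qed

lemma exec_clear: "exec (LOOP r (DEC r)) s (s(r := 0))"
proof (induction "s r" arbitrary: s rule: less_induct)
  case less
  show ?case
  proof (cases "s r = 0")
    case True
    then have "s(r := 0) = s" by auto
    with True show ?thesis by (metis exec_LOOP0)
  next
    case False
    let ?s = "s(r := s r - 1)"
    let ?t = "?s(r := ?s r - 1)"
    have "exec (LOOP r (DEC r)) ?t (?t(r := 0))"
      by (rule less) (use False in auto)
    then show ?thesis using exec_LOOP[of s r "DEC r", OF False exec_DEC] by simp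
  qed
qed

text \<open>The renaming \<open>\<rho>\<close> says in which registers the arguments are found, so that substituting
  or shifting variables costs nothing. The registers from \<open>n\<close> on are scratch space, cleared at the
  end except for the result in register \<open>n\<close>. Functions of an environment use de Bruijn indices: a
  bound variable is variable \<open>0\<close> of the extended environment.\<close>

definition cfun_at :: "nat \<Rightarrow> ((nat \<Rightarrow> nat) \<Rightarrow> nat) \<Rightarrow> bool" where
  "cfun_at k F \<longleftrightarrow> (\<forall>s t. (\<forall>i<k. s i = t i) \<longrightarrow> F s = F t) \<and>
     (\<forall>\<rho> n. (\<forall>i<k. \<rho> i < n) \<longrightarrow>
        (\<exists>c. \<forall>s. (\<forall>i\<ge>n. s i = 0) \<longrightarrow> exec c s (s(n := F (\<lambda>i. s (\<rho> i))))))"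

definition cfun :: "((nat \<Rightarrow> nat) \<Rightarrow> nat) \<Rightarrow> bool" where
  "cfun F \<longleftrightarrow> (\<exists>k. cfun_at k F)"

lemma cfun_at_cong: "cfun_at k F \<Longrightarrow> (\<forall>i<k. s i = t i) \<Longrightarrow> F s = F t"
  by (simp add: cfun_at_def)

lemma cfun_at_program:
  "cfun_at k F \<Longrightarrow> (\<forall>i<k. \<rho> i < n) \<Longrightarrow>
    \<exists>c. \<forall>s. (\<forall>i\<ge>n. s i = 0) \<longrightarrow> exec c s (s(n := F (\<lambda>i. s (\<rho> i))))"
  by (simp add: cfun_at_def)

lemma cfun_reindex:
  assumes "cfun F"
  shows "cfun (\<lambda>e. F (\<lambda>j. e (g j)))"
proof -
  obtain k where "cfun_at k F"
    using assms unfolding cfun_def by blast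
  note k = cfun_at_cong[OF this] cfun_at_program[OF this]
  define k' where "k' = Suc (Max (g ` {..<k}))"
  have g: "g j < k'" if "j < k" for j
    using that unfolding k'_def by (simp add: le_imp_less_Suc)
  show ?thesis unfolding cfun_def cfun_at_def
  proof (rule exI[of _ k'], intro conjI allI impI)
    fix s t :: "nat \<Rightarrow> nat" assume "\<forall>i<k'. s i = t i"
    then show "F (\<lambda>j. s (g j)) = F (\<lambda>j. t (g j))" by (intro k(1)) (use g in auto)
  next
    fix \<rho> and n :: nat assume "\<forall>i<k'. \<rho> i < n"
    then show "\<exists>c. \<forall>s. (\<forall>i\<ge>n. s i = 0) \<longrightarrow> exec c s (s(n := F (\<lambda>j. s (\<rho> (g j)))))"
      using k(2)[of "\<lambda>j. \<rho> (g j)" n] g by auto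
  qed
qed

lemma cfun_var: "cfun (\<lambda>e. e j)"
  unfolding cfun_def cfun_at_def
proof (rule exI[of _ "Suc j"], intro conjI allI impI)
  fix \<rho> and n :: nat assume "\<forall>i<Suc j. \<rho> i < n"
  then have r: "\<rho> j < n" by simp
  let ?r = "\<rho> j"
  let ?c1 = "LOOP ?r (SEQ (INC n) (INC (Suc n)))" and ?c2 = "LOOP (Suc n) (INC ?r)"
  have "exec (SEQ ?c1 ?c2) s (s(n := s ?r))" if z: "\<forall>i\<ge>n. s i = 0" for s
  proof (rule exec_SEQ)
    let ?S = "\<lambda>i. s(?r := s ?r - i, n := i, Suc n := i)"
    have "exec ?c1 (?S 0) (?S (s ?r))"
    proof (rule exec_loop)
      fix i assume "i < s ?r"
      let ?s = "(?S i)(?r := s ?r - i - 1)"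
      have "exec (SEQ (INC n) (INC (Suc n))) ?s (?s(n := Suc (?s n), Suc n := Suc ((?s(n := Suc (?s n))) (Suc n))))"
        by (rule exec_SEQ[OF exec_INC exec_INC])
      also have "?s(n := Suc (?s n), Suc n := Suc ((?s(n := Suc (?s n))) (Suc n))) = ?S (Suc i)"
        using r by (auto simp: fun_eq_iff)
      finally show "exec (SEQ (INC n) (INC (Suc n))) ?s (?S (Suc i))" .
    qed (use r in auto)
    moreover have "?S 0 = s" using z by auto
    ultimately show "exec ?c1 s (?S (s ?r))" by simp
    let ?t = "?S (s ?r)"
    have "exec ?c2 ?t (?t(Suc n := 0, ?r := ?t ?r + ?t (Suc n)))"
      by (rule exec_move) (use r in auto)
    moreover have "?t(Suc n := 0, ?r := ?t ?r + ?t (Suc n)) = s(n := s ?r)"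
      using r z by (auto simp: fun_eq_iff)
    ultimately show "exec ?c2 ?t (s(n := s ?r))" by simp
  qed
  then show "\<exists>c. \<forall>s. (\<forall>i\<ge>n. s i = 0) \<longrightarrow> exec c s (s(n := s ?r))" by blast
qed simp

lemma cfun_zero: "cfun (\<lambda>e. 0)"
  unfolding cfun_def cfun_at_def
proof (rule exI[of _ 0], intro conjI allI impI)
  fix n :: nat
  have "exec (DEC n) s (s(n := 0))" if "\<forall>i\<ge>n. s i = 0" for s
    using exec_DEC[of n s] that by simp
  then show "\<exists>c. \<forall>s. (\<forall>i\<ge>n. s i = 0) \<longrightarrow> exec c s (s(n := 0))" by blast
qed simp

lemma cfun_Suc:
  assumes "cfun F"
  shows "cfun (\<lambda>e. Suc (F e))"
proof -
  obtain k where "cfun_at k F"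
    using assms unfolding cfun_def by blast
  note k = cfun_at_cong[OF this] cfun_at_program[OF this]
  show ?thesis unfolding cfun_def cfun_at_def
  proof (rule exI[of _ k], intro conjI allI impI)
    fix \<rho> and n :: nat assume "\<forall>i<k. \<rho> i < n"
    from k(2)[OF this] obtain c where
      c: "\<forall>s. (\<forall>i\<ge>n. s i = 0) \<longrightarrow> exec c s (s(n := F (\<lambda>i. s (\<rho> i))))" ..
    have "exec (SEQ c (INC n)) s (s(n := Suc (F (\<lambda>i. s (\<rho> i)))))" if "\<forall>i\<ge>n. s i = 0" for s
      using exec_SEQ[OF c[rule_format] exec_INC[of n]] that by fastforce
    then show "\<exists>c. \<forall>s. (\<forall>i\<ge>n. s i = 0) \<longrightarrow> exec c s (s(n := Suc (F (\<lambda>i. s (\<rho> i)))))" by blast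
  qed (use k(1) in auto)
qed

text \<open>Primitive recursion is the only construct that needs a program of its own. Register
  \<open>n\<close> holds the accumulator, \<open>n + 1\<close> counts the remaining rounds, \<open>n + 2\<close> the rounds done, and the
  new value of the accumulator is computed in \<open>n + 3\<close>.\<close>

lemma cfun_rec:
  assumes "cfun A" "cfun B" and G: "cfun (\<lambda>e. G (e 0) (e 1) (\<lambda>j. e (j + 2)))"
  shows "cfun (\<lambda>e. rec_nat (A e) (\<lambda>i a. G i a e) (B e))"
proof -
  obtain kA where "cfun_at kA A"
    using assms(1) unfolding cfun_def by blast
  note kA = cfun_at_cong[OF this] cfun_at_program[OF this]
  obtain kB where "cfun_at kB B"
    using assms(2) unfolding cfun_def by blast
  note kB = cfun_at_cong[OF this] cfun_at_program[OF this]
  let ?G = "\<lambda>e. G (e 0) (e 1) (\<lambda>j. e (j + 2))"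
  obtain kG where "cfun_at kG ?G"
    using G unfolding cfun_def by blast
  note kG = cfun_at_cong[OF this] cfun_at_program[OF this]
  have G: "G i a s = G i a t" if "\<forall>i<kG. s i = t i" for i a s t
    using kG(1)[of "\<lambda>j. if j = 0 then i else if j = 1 then a else s (j - 2)"
        "\<lambda>j. if j = 0 then i else if j = 1 then a else t (j - 2)"] that by auto
  define k where "k = kA + kB + kG"
  define R where "R e = rec_nat (A e) (\<lambda>i a. G i a e)" for e
  show ?thesis unfolding cfun_def cfun_at_def R_def[symmetric]
  proof (rule exI[of _ k], intro conjI allI impI)
    fix s t :: "nat \<Rightarrow> nat" assume st: "\<forall>i<k. s i = t i"
    have "B s = B t" "A s = A t" by (rule kB kA; use st in \<open>simp add: k_def\<close>)+
    moreover have "G i a s = G i a t" for i a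
      by (rule G) (use st in \<open>simp add: k_def\<close>)
    ultimately show "R s (B s) = R t (B t)" by (simp add: R_def)
  next
    fix \<rho> and n :: nat assume \<rho>: "\<forall>i<k. \<rho> i < n"
    have ne: "\<rho> i \<noteq> n \<and> \<rho> i \<noteq> n + 1 \<and> \<rho> i \<noteq> n + 2" if "i < kA + kB + kG" for i
      using \<rho> that by (force simp: k_def)
    have "\<forall>i<kA. \<rho> i < n" using \<rho> by (simp add: k_def)
    from kA(2)[OF this] obtain cA where
      cA: "\<And>s. (\<forall>i\<ge>n. s i = 0) \<Longrightarrow> exec cA s (s(n := A (\<lambda>i. s (\<rho> i))))" by blast
    have "\<forall>i<kB. \<rho> i < n + 1" using \<rho> by (auto simp: k_def less_Suc_eq)
    from kB(2)[OF this] obtain cB where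
      cB: "\<And>s. (\<forall>i\<ge>n + 1. s i = 0) \<Longrightarrow> exec cB s (s(n + 1 := B (\<lambda>i. s (\<rho> i))))" by blast
    define \<rho>' where "\<rho>' j = (if j = 0 then n + 2 else if j = 1 then n else \<rho> (j - 2))" for j
    have "\<forall>i<kG. \<rho>' i < n + 3" using \<rho> by (auto simp: k_def \<rho>'_def trans_less_add1)
    from kG(2)[OF this] obtain cG where
      cG: "\<And>s. (\<forall>i\<ge>n + 3. s i = 0) \<Longrightarrow> exec cG s (s(n + 3 := ?G (\<lambda>i. s (\<rho>' i))))" by blast
    let ?body = "SEQ cG (SEQ (LOOP n (DEC n)) (SEQ (LOOP (n + 3) (INC n)) (INC (n + 2))))"
    let ?prog = "SEQ cA (SEQ cB (SEQ (LOOP (n + 1) ?body) (LOOP (n + 2) (DEC (n + 2)))))"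
    have "exec ?prog s (s(n := R (\<lambda>i. s (\<rho> i)) (B (\<lambda>i. s (\<rho> i)))))" if z: "\<forall>i\<ge>n. s i = 0" for s
    proof -
      let ?e = "\<lambda>i. s (\<rho> i)"
      let ?N = "B ?e"
      let ?S = "\<lambda>i. s(n := R ?e i, n + 1 := ?N - i, n + 2 := i)"
      have 1: "exec cA s (s(n := A ?e))" by (rule cA) (use z in auto)
      have "B (\<lambda>i. (s(n := A ?e)) (\<rho> i)) = ?N"
        by (rule kB(1)) (use ne in auto)
      then have "exec cB (s(n := A ?e)) (s(n := A ?e, n + 1 := ?N))"
        using cB[of "s(n := A ?e)"] z by simp
      moreover have "s(n := A ?e, n + 1 := ?N) = ?S 0" using z by (auto simp: R_def)
      ultimately have 2: "exec cB (s(n := A ?e)) (?S 0)" by simp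
      have 3: "exec (LOOP (n + 1) ?body) (?S 0) (?S ?N)"
      proof (rule exec_loop)
        fix i assume i: "i < ?N"
        let ?s = "(?S i)(n + 1 := ?N - i - 1)"
        let ?r = "R ?e (Suc i)"
        have "G i (R ?e i) (\<lambda>j. ?s (\<rho> j)) = G i (R ?e i) ?e"
          by (rule G) (use ne in auto)
        then have "?G (\<lambda>i. ?s (\<rho>' i)) = ?r"
          by (simp add: \<rho>'_def R_def)
        then have "exec cG ?s (?s(n + 3 := ?r))"
          using cG[of ?s] z by simp
        moreover have "exec (LOOP n (DEC n)) (?s(n + 3 := ?r)) (?s(n + 3 := ?r, n := 0))"
          by (rule exec_clear)
        moreover have "exec (LOOP (n + 3) (INC n)) (?s(n + 3 := ?r, n := 0)) (?s(n := ?r))"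
        proof -
          have "?s(n := ?r) = (?s(n + 3 := ?r, n := 0))(n + 3 := 0,
              n := (?s(n + 3 := ?r, n := 0)) n + (?s(n + 3 := ?r, n := 0)) (n + 3))"
            using z by (auto simp: fun_eq_iff)
          then show ?thesis using exec_move[of "n + 3" n "?s(n + 3 := ?r, n := 0)"] by simp
        qed
        moreover have "exec (INC (n + 2)) (?s(n := ?r)) (?S (Suc i))"
        proof -
          have "?S (Suc i) = ?s(n := ?r, n + 2 := Suc ((?s(n := ?r)) (n + 2)))"
            by (auto simp: fun_eq_iff)
          then show ?thesis using exec_INC[of "n + 2" "?s(n := ?r)"] by simp
        qed
        ultimately show "exec ?body ?s (?S (Suc i))" by (intro exec_SEQ)
      qed auto
      have "exec (LOOP (n + 2) (DEC (n + 2))) (?S ?N) ((?S ?N)(n + 2 := 0))"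
        by (rule exec_clear)
      moreover have "(?S ?N)(n + 2 := 0) = s(n := R ?e ?N)" using z by (auto simp: fun_eq_iff)
      ultimately have 4: "exec (LOOP (n + 2) (DEC (n + 2))) (?S ?N) (s(n := R ?e ?N))" by simp
      from 1 2 3 4 show ?thesis by (intro exec_SEQ)
    qed
    then show "\<exists>c. \<forall>s. (\<forall>i\<ge>n. s i = 0) \<longrightarrow>
        exec c s (s(n := R (\<lambda>i. s (\<rho> i)) (B (\<lambda>i. s (\<rho> i)))))" by blast
  qed
qed

lemma cfun_const: "cfun (\<lambda>e. c)"
  by (induction c) (auto intro: cfun_zero cfun_Suc)

lemma cfun_add:
  assumes "cfun F" "cfun G"
  shows "cfun (\<lambda>e. F e + G e)"
proof -
  have R: "rec_nat a (\<lambda>i. Suc) b = a + b" for a b :: nat by (induction b) auto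
  show ?thesis using cfun_rec[OF assms cfun_Suc[OF cfun_var[of 1]]] by (simp add: R)
qed

lemma cfun_diff:
  assumes "cfun F" "cfun G"
  shows "cfun (\<lambda>e. F e - G e)"
proof -
  have P: "rec_nat 0 (\<lambda>i a. i) a = a - 1" for a :: nat by (cases a) auto
  have pred: "cfun (\<lambda>e. H e - 1)" if "cfun H" for H
    using cfun_rec[OF cfun_zero that cfun_var[of 0]] by (simp add: P)
  have R: "rec_nat a (\<lambda>i a. a - 1) b = a - b" for a b :: nat by (induction b) auto
  show ?thesis using cfun_rec[OF assms pred[OF cfun_var[of 1]]] by (simp only: R)
qed

lemma cfun_mult:
  assumes "cfun F" "cfun G"
  shows "cfun (\<lambda>e. F e * G e)"
proof -
  have R: "rec_nat 0 (\<lambda>i acc. acc + a) b = a * b" for a b :: nat by (induction b) auto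
  show ?thesis
    using cfun_rec[OF cfun_zero assms(2), of "\<lambda>i a e. a + F e"]
      cfun_add[OF cfun_var[of 1] cfun_reindex[OF assms(1), of "\<lambda>j. j + 2"]] by (simp add: R)
qed

lemma cfun_pow:
  assumes "cfun F" "cfun G"
  shows "cfun (\<lambda>e. F e ^ G e)"
proof -
  have R: "rec_nat 1 (\<lambda>i acc. acc * a) b = a ^ b" for a b :: nat by (induction b) auto
  show ?thesis
    using cfun_rec[OF cfun_const[of 1] assms(2), of "\<lambda>i a e. a * F e"]
      cfun_mult[OF cfun_var[of 1] cfun_reindex[OF assms(1), of "\<lambda>j. j + 2"]] by (simp add: R[unfolded One_nat_def])
qed

lemma cfun_sum:
  assumes "cfun B" "cfun (\<lambda>e. H (e 0) (\<lambda>j. e (Suc j)))"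
  shows "cfun (\<lambda>e. \<Sum>i<B e. H i e)"
proof -
  have "cfun (\<lambda>e. H (e 0) (\<lambda>j. e (j + 2)))"
    using cfun_reindex[OF assms(2), of "\<lambda>j. if j = 0 then 0 else Suc j"] by simp
  note * = cfun_rec[OF cfun_zero assms(1), of "\<lambda>i a e. a + H i e", OF cfun_add[OF cfun_var[of 1] this]]
  have R: "rec_nat 0 (\<lambda>i acc. acc + f i) b = (\<Sum>i<b. f i)" for f and b :: nat
    by (induction b) auto
  show ?thesis using * by (simp add: R)
qed

definition cpred :: "((nat \<Rightarrow> nat) \<Rightarrow> bool) \<Rightarrow> bool" where
  "cpred \<phi> \<longleftrightarrow> cfun (\<lambda>e. of_bool (\<phi> e))"

lemma cpred_transfer:
  assumes "cfun F" "\<And>e. F e = of_bool (\<phi> e)"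
  shows "cpred \<phi>"
proof -
  have "F = (\<lambda>e. of_bool (\<phi> e))" using assms(2) by (rule ext)
  then show ?thesis using assms(1) by (simp add: cpred_def)
qed

lemma cpred_le: "cfun F \<Longrightarrow> cfun G \<Longrightarrow> cpred (\<lambda>e. F e \<le> G e)"
  by (rule cpred_transfer[of "\<lambda>e. 1 - (F e - G e)"]) (auto intro: cfun_diff cfun_const)

lemma cpred_not: "cpred \<phi> \<Longrightarrow> cpred (\<lambda>e. \<not> \<phi> e)"
  by (rule cpred_transfer[of "\<lambda>e. 1 - of_bool (\<phi> e)"])
    (auto simp: cpred_def intro: cfun_diff cfun_const)

lemma cpred_conj: "cpred \<phi> \<Longrightarrow> cpred \<psi> \<Longrightarrow> cpred (\<lambda>e. \<phi> e \<and> \<psi> e)"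
  by (rule cpred_transfer[of "\<lambda>e. of_bool (\<phi> e) * of_bool (\<psi> e)"])
    (auto simp: cpred_def intro: cfun_mult)

lemma cpred_ex:
  assumes "cfun B" "cpred (\<lambda>e. \<phi> (e 0) (\<lambda>j. e (Suc j)))"
  shows "cpred (\<lambda>e. \<exists>i<B e. \<phi> i e)"
proof -
  have "cpred (\<lambda>e. (1::nat) \<le> (\<Sum>i<B e. of_bool (\<phi> i e)))"
    by (intro cpred_le cfun_const cfun_sum assms(1) assms(2)[unfolded cpred_def])
  moreover have "((1::nat) \<le> (\<Sum>i<b. of_bool (P i))) = (\<exists>i<b. P i)" for b and P :: "nat \<Rightarrow> bool"
    by (simp add: Suc_le_eq card_gt_0_iff) blast
  ultimately show ?thesis by simp
qed

lemma cpred_less: "cfun F \<Longrightarrow> cfun G \<Longrightarrow> cpred (\<lambda>e. F e < G e)"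
  using cpred_not[OF cpred_le[of G F]] by (simp add: not_le)

lemma cpred_eq: "cfun F \<Longrightarrow> cfun G \<Longrightarrow> cpred (\<lambda>e. F e = G e)"
  using cpred_conj[OF cpred_le[of F G] cpred_le[of G F]] by (simp add: eq_iff)

lemma cpred_imp: "cpred \<phi> \<Longrightarrow> cpred \<psi> \<Longrightarrow> cpred (\<lambda>e. \<phi> e \<longrightarrow> \<psi> e)"
  using cpred_not[OF cpred_conj[of \<phi> "\<lambda>e. \<not> \<psi> e"]] cpred_not[of \<psi>] by simp

lemma cpred_iff: "cpred \<phi> \<Longrightarrow> cpred \<psi> \<Longrightarrow> cpred (\<lambda>e. \<phi> e \<longleftrightarrow> \<psi> e)"
  using cpred_conj[OF cpred_imp[of \<phi> \<psi>] cpred_imp[of \<psi> \<phi>]] by (simp add: iff_conv_conj_imp)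

lemma cpred_all:
  assumes "cfun B" "cpred (\<lambda>e. \<phi> (e 0) (\<lambda>j. e (Suc j)))"
  shows "cpred (\<lambda>e. \<forall>i<B e. \<phi> i e)"
  using cpred_not[OF cpred_ex[OF assms(1) cpred_not[OF assms(2)]]] by simp

lemma cfun_of_bool: "cpred \<phi> \<Longrightarrow> cfun (\<lambda>e. of_bool (\<phi> e))"
  by (simp add: cpred_def)

lemma cfun_div:
  assumes "cfun F" "cfun G"
  shows "cfun (\<lambda>e. F e div G e)"
proof -
  have "(\<Sum>i<a. of_bool (0 < b \<and> (i + 1) * b \<le> a)) = a div b" for a b :: nat
  proof (cases "b = 0")
    case False
    have "{i. i < a \<and> (i + 1) * b \<le> a} = {..<a div b}"
    proof -
      have *: "(i + 1) * b \<le> a \<longleftrightarrow> i < a div b" for i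
        using False by (metis Suc_eq_plus1 Suc_le_eq bot_nat_0.not_eq_extremum less_eq_div_iff_mult_less_eq)
      have "i < a" if "i < a div b" for i
        using that div_le_dividend[of a b] by linarith
      then show ?thesis unfolding * by blast
    qed
    moreover have "(\<Sum>i<a. of_bool (P i)) = card {i. i < a \<and> P i}" for P
      by (simp add: sum_of_bool_eq Int_def)
    ultimately show ?thesis using False by (simp del: add_Suc)
  qed simp
  moreover have "cfun (\<lambda>e. \<Sum>i<F e. of_bool (0 < G e \<and> (i + 1) * G e \<le> F e))"
    by (intro cfun_sum cfun_of_bool cpred_conj cpred_less cpred_le cfun_mult cfun_add cfun_const cfun_var
        assms assms[THEN cfun_reindex])
  ultimately show ?thesis by simp
qed

lemma cfun_mod: "cfun F \<Longrightarrow> cfun G \<Longrightarrow> cfun (\<lambda>e. F e mod G e)"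
  unfolding modulo_nat_def by (intro cfun_diff cfun_mult cfun_div)

text \<open>Resolution with these rules proves every bounded arithmetical formula computable.\<close>

lemmas cfun_intros = cfun_var cfun_const cfun_Suc cfun_add cfun_diff cfun_mult cfun_pow cfun_sum
  cfun_div cfun_mod cfun_of_bool cpred_le cpred_less cpred_eq cpred_not cpred_conj cpred_imp cpred_iff
  cpred_all cpred_ex

text \<open>Unbounded search: register \<open>3\<close> holds the candidate \<open>m\<close> next to the inputs in the
  registers \<open>0\<close>, \<open>1\<close>, \<open>2\<close>, and register \<open>4\<close> is \<open>1\<close> as long as the candidate fails, which makes it the
  control register of the loop.\<close>

lemma turing_computable_Least:
  assumes "cpred (\<lambda>e. \<phi> (e 0) (e 1) (e 2) (e 3))"
    and ex: "\<And>num den r. num > 0 \<Longrightarrow> den > 0 \<Longrightarrow> \<exists>m. \<phi> m num den r"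
  shows "turing_computable (\<lambda>\<epsilon> r. LEAST m. \<phi> m (nat (fst (quotient_of \<epsilon>))) (nat (snd (quotient_of \<epsilon>))) r)"
proof -
  let ?F = "\<lambda>e. of_bool (\<not> \<phi> (e 0) (e 1) (e 2) (e 3)) :: nat"
  have "cfun ?F" by (intro cfun_of_bool cpred_not assms(1))
  then obtain k where "cfun_at k ?F"
    unfolding cfun_def by blast
  note k = cfun_at_cong[OF this] cfun_at_program[OF this]
  define \<rho> :: "nat \<Rightarrow> nat" where "\<rho> i = (if i = 0 then 3 else if i < 4 then i - 1 else 0)" for i
  have "\<forall>i<k. \<rho> i < 4" by (auto simp: \<rho>_def)
  from k(2)[OF this] obtain c where
    c: "\<And>s. (\<forall>i\<ge>4. s i = 0) \<Longrightarrow> exec c s (s(4 := of_bool (\<not> \<phi> (s 3) (s 0) (s 1) (s 2))))"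
    by (auto simp: \<rho>_def)
  let ?loop = "LOOP 4 (SEQ (INC 3) c)"
  let ?prog = "SEQ c (SEQ ?loop (SEQ (LOOP 0 (DEC 0)) (LOOP 3 (INC 0))))"
  define f where "f xs = (LEAST m. \<phi> m (xs ! 0) (xs ! 1) (xs ! 2))" for xs
  have "\<exists>t. exec ?prog (\<lambda>i. if i < length xs then xs ! i else 0) t \<and> t 0 = f xs"
    if xs: "xs \<in> {xs. length xs = 3 \<and> xs ! 0 > 0 \<and> xs ! 1 > 0}" for xs
  proof -
    let ?s = "\<lambda>i. if i < length xs then xs ! i else 0"
    let ?\<phi> = "\<lambda>m. \<phi> m (xs ! 0) (xs ! 1) (xs ! 2)"
    let ?M = "f xs"
    let ?T = "\<lambda>m b. ?s(3 := m, 4 := of_bool b)"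
    have M: "?\<phi> ?M" using ex[of "xs ! 0" "xs ! 1" "xs ! 2"] xs unfolding f_def by (auto intro: LeastI_ex)
    have nM: "\<not> ?\<phi> m" if "m < ?M" for m using that not_less_Least unfolding f_def by blast
    have step: "exec c (?T m False) (?T m (\<not> ?\<phi> m))" for m
    proof -
      have "(?T m False)(4 := of_bool (\<not> \<phi> ((?T m False) 3) ((?T m False) 0) ((?T m False) 1) ((?T m False) 2)))
          = ?T m (\<not> ?\<phi> m)"
        using xs by (auto simp: fun_eq_iff)
      then show ?thesis using c[of "?T m False"] xs by simp
    qed
    have loop: "exec ?loop (?T m (\<not> ?\<phi> m)) (?T ?M False)" if "m \<le> ?M" for m
      using that
    proof (induction "?M - m" arbitrary: m)
      case 0
      then have "m = ?M" by simp
      then show ?case using M by (auto intro: exec_LOOP0)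
    next
      case (Suc n)
      then have m: "m < ?M" by simp
      have "exec (INC 3) (?T m False) (?T (Suc m) False)"
      proof -
        have "?T (Suc m) False = (?T m False)(3 := Suc ((?T m False) 3))" by (auto simp: fun_eq_iff)
        show ?thesis by (subst \<open>?T (Suc m) False = _\<close>) (rule exec_INC)
      qed
      then have "exec (SEQ (INC 3) c) (?T m False) (?T (Suc m) (\<not> ?\<phi> (Suc m)))"
        by (rule exec_SEQ[OF _ step])
      moreover have "(?T m True)(4 := (?T m True) 4 - 1) = ?T m False" by (auto simp: fun_eq_iff)
      ultimately have "exec (SEQ (INC 3) c) ((?T m True)(4 := (?T m True) 4 - 1)) (?T (Suc m) (\<not> ?\<phi> (Suc m)))"
        by (simp only:)
      moreover have "exec ?loop (?T (Suc m) (\<not> ?\<phi> (Suc m))) (?T ?M False)"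
        using Suc m by simp
      ultimately have "exec ?loop (?T m True) (?T ?M False)"
        by (rule exec_LOOP[rotated]) simp
      then show ?case using nM[OF m] by simp
    qed
    have "?s = ?T 0 False" using xs by (auto simp: fun_eq_iff)
    then have 1: "exec c ?s (?T 0 (\<not> ?\<phi> 0))" using step[of 0] by simp
    have 2: "exec ?loop (?T 0 (\<not> ?\<phi> 0)) (?T ?M False)" by (rule loop) simp
    have 3: "exec (LOOP 0 (DEC 0)) (?T ?M False) ((?T ?M False)(0 := 0))" by (rule exec_clear)
    let ?v = "(?T ?M False)(0 := 0)"
    have 4: "exec (LOOP 3 (INC 0)) ?v (?v(3 := 0, 0 := ?v 0 + ?v 3))" by (rule exec_move) simp
    have "exec ?prog ?s (?v(3 := 0, 0 := ?v 0 + ?v 3))" by (rule exec_SEQ 1 2 3 4)+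
    moreover have "(?v(3 := 0, 0 := ?v 0 + ?v 3)) 0 = ?M" by simp
    ultimately show ?thesis by blast
  qed
  then have "\<exists>M. wf_tm M \<and> (\<forall>xs\<in>{xs. length xs = 3 \<and> xs ! 0 > 0 \<and> xs ! 1 > 0}. tm_computes M xs (f xs))"
    by (intro tm_of_program[where j = 3]) auto
  then obtain M where M: "wf_tm M"
    "\<And>xs. length xs = 3 \<Longrightarrow> xs ! 0 > 0 \<Longrightarrow> xs ! 1 > 0 \<Longrightarrow> tm_computes M xs (f xs)"
    by auto
  have "tm_computes M [nat (fst (quotient_of \<epsilon>)), nat (snd (quotient_of \<epsilon>)), r]
      (LEAST m. \<phi> m (nat (fst (quotient_of \<epsilon>))) (nat (snd (quotient_of \<epsilon>))) r)" if "\<epsilon> > 0" for \<epsilon> r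
  proof -
    have den: "snd (quotient_of \<epsilon>) > 0" by (rule quotient_of_denom_pos')
    have "\<epsilon> = rat_of_int (fst (quotient_of \<epsilon>)) / rat_of_int (snd (quotient_of \<epsilon>))"
      by (rule quotient_of_div) simp
    then have "fst (quotient_of \<epsilon>) > 0"
      using that den by (metis of_int_0_less_iff zero_less_divide_iff not_less_iff_gr_or_eq)
    with den show ?thesis
      using M(2)[of "[nat (fst (quotient_of \<epsilon>)), nat (snd (quotient_of \<epsilon>)), r]"]
      by (simp add: f_def numeral_2_eq_2)
  qed
  then show ?thesis unfolding turing_computable_def using M(1) by blast
qed

section \<open>A finite test for regularity bounds\<close>

text \<open>Numbers below \<open>B ^ n\<close> serve as tables with \<open>n\<close> entries below \<open>B\<close>.\<close>

definition digit :: "nat \<Rightarrow> nat \<Rightarrow> nat \<Rightarrow> nat" where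
  "digit B x i = x div B ^ i mod B"

text \<open>Words are coded by bijective numeration in base \<open>2 * d\<close>, the first letter being the
  least significant digit. Every number is the code of exactly one word, and shorter words have
  smaller codes: the words of length below \<open>n\<close> have the codes below \<open>words_below d n\<close>. Appending a
  letter at the end, unlike prepending one, requires the length of the word.\<close>

definition words_below :: "nat \<Rightarrow> nat \<Rightarrow> nat" where
  "words_below d n = (\<Sum>i<n. (2 * d) ^ i)"

definition cons_code :: "nat \<Rightarrow> nat \<Rightarrow> nat \<Rightarrow> nat" where
  "cons_code d l c = 1 + l + 2 * d * c"

definition inv_code :: "nat \<Rightarrow> nat \<Rightarrow> nat" where
  "inv_code d l = (l + d) mod (2 * d)"

definition length_code :: "nat \<Rightarrow> nat \<Rightarrow> nat" where
  "length_code d c = (\<Sum>k<c. of_bool (words_below d (Suc k) \<le> c))"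

definition snoc_code :: "nat \<Rightarrow> nat \<Rightarrow> nat \<Rightarrow> nat" where
  "snoc_code d c l = c + (1 + l) * (2 * d) ^ length_code d c"

text \<open>Read \<open>f c\<close> as the vertex reached from a root by the word with code \<open>c\<close>. Then the
  conditions say that letters act on vertices and that inverse letters act inversely, as far as the
  codes below \<open>M\<close> can tell. Functions with the same kernel describe the same picture.\<close>

definition local_action :: "nat \<Rightarrow> nat \<Rightarrow> (nat \<Rightarrow> nat) \<Rightarrow> bool" where
  "local_action d M f \<longleftrightarrow>
     (\<forall>c<M. \<forall>c'<M. \<forall>l<2 * d. f c = f c' \<and> cons_code d l c < M \<and> cons_code d l c' < M \<longrightarrow>
        f (cons_code d l c) = f (cons_code d l c')) \<and>
     (\<forall>c<M. \<forall>l<2 * d. cons_code d l (cons_code d (inv_code d l) c) < M \<longrightarrow>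
        f (cons_code d l (cons_code d (inv_code d l) c)) = f c)"

text \<open>The bits of \<open>\<sigma>\<close> tell which words fix the root.\<close>

definition pattern :: "nat \<Rightarrow> nat \<Rightarrow> (nat \<Rightarrow> nat) \<Rightarrow> bool" where
  "pattern q \<sigma> f \<longleftrightarrow> (\<forall>w<q. digit 2 \<sigma> w = 1 \<longleftrightarrow> f w = f 0)"

text \<open>A number \<open>P\<close> encodes weights, integers up to \<open>K\<close>, for the \<open>T = M ^ M\<close> functions with
  tables \<open>j < T\<close>; they approximate \<open>K\<close> times the frequency with which a random vertex shows the local
  picture \<open>j\<close>. A word \<open>w\<close> fixes the neighbour of the root in direction \<open>l\<close> iff \<open>w\<close> followed by \<open>l\<close> on
  the right leads from the root to that neighbour again, which is what \<open>shifted_weight\<close> counts.\<close>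

definition total_weight :: "nat \<Rightarrow> nat \<Rightarrow> nat \<Rightarrow> nat \<Rightarrow> nat \<Rightarrow> nat" where
  "total_weight d M T K P = (\<Sum>j<T. digit (Suc K) P j * of_bool (local_action d M (digit M j)))"

definition pattern_weight :: "nat \<Rightarrow> nat \<Rightarrow> nat \<Rightarrow> nat \<Rightarrow> nat \<Rightarrow> nat \<Rightarrow> nat \<Rightarrow> nat" where
  "pattern_weight d M T K P q \<sigma> = (\<Sum>j<T. digit (Suc K) P j *
     of_bool (local_action d M (digit M j) \<and> pattern q \<sigma> (digit M j)))"

definition shifted_weight :: "nat \<Rightarrow> nat \<Rightarrow> nat \<Rightarrow> nat \<Rightarrow> nat \<Rightarrow> nat \<Rightarrow> nat \<Rightarrow> nat \<Rightarrow> nat" where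
  "shifted_weight d M T K P l q \<sigma> = (\<Sum>j<T. digit (Suc K) P j *
     of_bool (local_action d M (digit M j) \<and> pattern q \<sigma> (\<lambda>w. digit M j (snoc_code d w l))))"

text \<open>Rounding the frequencies down to multiples of \<open>1 / K\<close> costs less than one unit per
  table. This explains the slack \<open>T\<close>.\<close>

definition almost_invariant :: "nat \<Rightarrow> nat \<Rightarrow> nat \<Rightarrow> nat \<Rightarrow> nat \<Rightarrow> nat \<Rightarrow> bool" where
  "almost_invariant d m M T K P \<longleftrightarrow>
     total_weight d M T K P \<le> K \<and> K \<le> total_weight d M T K P + T \<and>
     (\<forall>l<2 * d. \<forall>q<Suc m. \<forall>\<sigma><2 ^ q.
        pattern_weight d M T K P q \<sigma> \<le> shifted_weight d M T K P l q \<sigma> + T \<and>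
        shifted_weight d M T K P l q \<sigma> \<le> pattern_weight d M T K P q \<sigma> + T)"

text \<open>The letter \<open>l\<close> acts by the row of its one-letter word, whose code is \<open>cons_code d l 0\<close>.\<close>

definition action_table :: "nat \<Rightarrow> nat \<Rightarrow> nat \<Rightarrow> (nat \<Rightarrow> nat \<Rightarrow> nat) \<Rightarrow> bool" where
  "action_table d n W h \<longleftrightarrow> (\<forall>x<n. h 0 x = x) \<and>
     (\<forall>x<n. \<forall>c<W. \<forall>l<2 * d. cons_code d l c < W \<longrightarrow>
        h (cons_code d l c) x = h (cons_code d l 0) (h c x)) \<and>
     (\<forall>x<n. \<forall>l<2 * d. h (cons_code d l 0) (h (cons_code d (inv_code d l) 0) x) = x)"

definition table_count :: "nat \<Rightarrow> nat \<Rightarrow> (nat \<Rightarrow> nat \<Rightarrow> nat) \<Rightarrow> nat \<Rightarrow> nat" where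
  "table_count n W h \<sigma> = (\<Sum>x<n. of_bool (pattern W \<sigma> (\<lambda>c. h c x)))"

text \<open>The two inequalities state, without division, that the frequency
  \<open>table_count / n\<close> differs from \<open>pattern_weight / K\<close> by at most \<open>num / (2 * den)\<close>. The other half of
  \<open>num / den\<close> is reserved for the rounding error.\<close>

definition approximated :: "nat \<Rightarrow> nat \<Rightarrow> nat \<Rightarrow> nat \<Rightarrow> nat \<Rightarrow> nat \<Rightarrow> nat \<Rightarrow> nat \<Rightarrow> nat \<Rightarrow> bool" where
  "approximated d m num den M T K W P \<longleftrightarrow>
     (\<exists>n<Suc m. 0 < n \<and> (\<exists>H<n ^ (W * n).
        action_table d n W (\<lambda>c x. digit n H (c * n + x)) \<and>
        (\<forall>\<sigma><2 ^ W.
           2 * den * K * table_count n W (\<lambda>c x. digit n H (c * n + x)) \<sigma>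
             \<le> 2 * den * n * pattern_weight d M T K P W \<sigma> + num * n * K \<and>
           2 * den * n * pattern_weight d M T K P W \<sigma>
             \<le> 2 * den * K * table_count n W (\<lambda>c x. digit n H (c * n + x)) \<sigma> + num * n * K)))"

text \<open>With \<open>K = T * m\<close> the rounding error \<open>T / K\<close> is \<open>1 / m\<close>, and \<open>2 * den < num * m\<close> makes it
  smaller than half of \<open>num / den\<close>.\<close>

definition certified_with ::
    "nat \<Rightarrow> nat \<Rightarrow> nat \<Rightarrow> nat \<Rightarrow> nat \<Rightarrow> nat \<Rightarrow> nat \<Rightarrow> nat \<Rightarrow> bool" where
  "certified_with d m num den M T K W \<longleftrightarrow> 2 * den < num * m \<and> W \<le> m \<and>
     (\<forall>P<Suc K ^ T. almost_invariant d m M T K P \<longrightarrow> approximated d m num den M T K W P)"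

text \<open>An upper bound for the codes that arise from codes below \<open>m\<close> by appending a letter.\<close>

definition table_size :: "nat \<Rightarrow> nat \<Rightarrow> nat" where
  "table_size d m = (2 * d) * (2 * d) * m + 2 * d + 1"

definition certified :: "nat \<Rightarrow> nat \<Rightarrow> nat \<Rightarrow> nat \<Rightarrow> nat \<Rightarrow> bool" where
  "certified d m num den r \<longleftrightarrow> certified_with d m num den
     (table_size d m) (table_size d m ^ table_size d m) (table_size d m ^ table_size d m * m)
     (words_below d (2 * r + 2))"

lemma cpred_certified: "cpred (\<lambda>e. certified d (e 0) (e 1) (e 2) (e 3))"
proof -
  \<comment> \<open>The bounded quantifiers act as a \<open>let\<close>: they name the compound quantities, so that the rest
    of the formula only contains variables.\<close>
  have eq: "certified d m num den r \<longleftrightarrow>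
    (\<exists>M<Suc (table_size d m). M = table_size d m \<and>
    (\<exists>T<Suc (M ^ M). T = M ^ M \<and> (\<exists>K<Suc (T * m). K = T * m \<and>
    (\<exists>W<Suc (words_below d (2 * r + 2)). W = words_below d (2 * r + 2) \<and>
       certified_with d m num den M T K W))))" for m num den r
    by (simp add: certified_def)
  show ?thesis
    unfolding eq certified_with_def approximated_def almost_invariant_def action_table_def
      table_count_def total_weight_def pattern_weight_def shifted_weight_def pattern_def
      local_action_def snoc_code_def length_code_def inv_code_def cons_code_def
      words_below_def table_size_def digit_def
    by (intro cfun_intros)
qed

section \<open>Codes of words\<close>

fun letter_code :: "nat \<Rightarrow> letter \<Rightarrow> nat" where
  "letter_code d (Gen i) = i"
| "letter_code d (Inv i) = d + i"

fun code :: "nat \<Rightarrow> word \<Rightarrow> nat" where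
  "code d [] = 0"
| "code d (l # w) = cons_code d (letter_code d l) (code d w)"

lemma letter_code_less: "l \<in> letters d \<Longrightarrow> letter_code d l < 2 * d"
  by (auto simp: letters_def)

lemma letter_code_inj: "l \<in> letters d \<Longrightarrow> l' \<in> letters d \<Longrightarrow> letter_code d l = letter_code d l' \<Longrightarrow> l = l'"
  by (auto simp: letters_def)

lemma letter_code_surj: "x < 2 * d \<Longrightarrow> \<exists>l\<in>letters d. letter_code d l = x"
proof (cases "x < d")
  case True
  then show ?thesis by (intro bexI[of _ "Gen x"]) (auto simp: letters_def)
next
  case False
  assume "x < 2 * d"
  with False show ?thesis by (intro bexI[of _ "Inv (x - d)"]) (auto simp: letters_def)
qed

lemma letter_code_linv: "l \<in> letters d \<Longrightarrow> letter_code d (linv l) = inv_code d (letter_code d l)"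
proof -
  have "(d + i + d) mod (2 * d) = i" if "i < d" for i
  proof -
    have "d + i + d = i + 2 * d" by simp
    then show ?thesis using that by (simp only: mod_add_self2) simp
  qed
  then show "l \<in> letters d \<Longrightarrow> letter_code d (linv l) = inv_code d (letter_code d l)"
    by (auto simp: letters_def inv_code_def)
qed

lemma all_letter_codes: "(\<forall>l<2 * d. P l) \<longleftrightarrow> (\<forall>l\<in>letters d. P (letter_code d l))"
  using letter_code_surj letter_code_less by metis

lemma code_inj: "w \<in> lists (letters d) \<Longrightarrow> w' \<in> lists (letters d) \<Longrightarrow> code d w = code d w' \<Longrightarrow> w = w'"
proof (induction w arbitrary: w')
  case Nil
  then show ?case by (cases w') (auto simp: cons_code_def)
next
  case (Cons l w)
  then obtain l' u where w': "w' = l' # u" by (cases w') (auto simp: cons_code_def)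
  have l: "letter_code d l < 2 * d" "letter_code d l' < 2 * d"
    using Cons.prems w' by (auto intro: letter_code_less)
  have eq: "letter_code d l + 2 * d * code d w = letter_code d l' + 2 * d * code d u"
    using Cons.prems w' by (simp add: cons_code_def)
  have "letter_code d l = letter_code d l'"
    using arg_cong[OF eq, of "\<lambda>x. x mod (2 * d)"] l by simp
  moreover have "code d w = code d u"
    using arg_cong[OF eq, of "\<lambda>x. x div (2 * d)"] l by simp
  ultimately show ?case using Cons w' letter_code_inj by auto
qed

lemma code_surj: "d \<ge> 1 \<Longrightarrow> \<exists>w\<in>lists (letters d). code d w = c"
proof (induction c rule: less_induct)
  case (less c)
  show ?case
  proof (cases c)
    case 0
    then show ?thesis by (intro bexI[of _ "[]"]) auto
  next
    case (Suc b)
    have "b div (2 * d) < c" using Suc by (simp add: le_imp_less_Suc)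
    then obtain w where w: "w \<in> lists (letters d)" "code d w = b div (2 * d)"
      using less by blast
    have "b mod (2 * d) < 2 * d" using less.prems by simp
    then obtain l where l: "l \<in> letters d" "letter_code d l = b mod (2 * d)"
      using letter_code_surj by blast
    show ?thesis using l w Suc by (intro bexI[of _ "l # w"]) (auto simp: cons_code_def)
  qed
qed

definition word_of :: "nat \<Rightarrow> nat \<Rightarrow> word" where
  "word_of d c = (THE w. w \<in> lists (letters d) \<and> code d w = c)"

lemma word_of_code: "w \<in> lists (letters d) \<Longrightarrow> word_of d (code d w) = w"
  unfolding word_of_def using code_inj by (intro the_equality) auto

lemma word_of:
  assumes "d \<ge> 1"
  shows "word_of d c \<in> lists (letters d)" "code d (word_of d c) = c"
proof -
  obtain w where "w \<in> lists (letters d)" "code d w = c" using code_surj[OF assms] by blast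
  with word_of_code[of w d] show "word_of d c \<in> lists (letters d)" "code d (word_of d c) = c" by auto
qed

lemma word_of_cons:
  assumes "d \<ge> 1" "l \<in> letters d"
  shows "word_of d (cons_code d (letter_code d l) c) = l # word_of d c"
proof -
  have "l # word_of d c \<in> lists (letters d)" using word_of(1)[OF assms(1), of c] assms(2) by simp
  from word_of_code[OF this] show ?thesis using word_of(2)[OF assms(1)] by simp
qed

lemma words_below_Suc: "words_below d (Suc n) = 1 + 2 * d * words_below d n"
proof -
  have "(\<Sum>i<Suc n. D ^ i) = 1 + D * (\<Sum>i<n. D ^ i)" for D :: nat
    by (simp add: sum.lessThan_Suc_shift sum_distrib_left del: sum.lessThan_Suc)
  then show ?thesis unfolding words_below_def .
qed

lemma words_below_mono: "n \<le> m \<Longrightarrow> words_below d n \<le> words_below d m"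
  unfolding words_below_def by (intro sum_mono2) auto

lemma words_below_ge: "d \<ge> 1 \<Longrightarrow> n \<le> words_below d n"
proof (induction n)
  case (Suc n)
  then have "words_below d n \<le> 2 * d * words_below d n" by simp
  with Suc show ?case unfolding words_below_Suc by linarith
qed simp

lemma code_bounds:
  assumes "w \<in> lists (letters d)"
  shows "words_below d (length w) \<le> code d w \<and> code d w < words_below d (Suc (length w))"
  using assms
proof (induction w)
  case (Cons l w)
  then have l: "letter_code d l < 2 * d" using letter_code_less by simp
  have IH: "words_below d (length w) \<le> code d w" "code d w + 1 \<le> words_below d (Suc (length w))"
    using Cons by auto
  have "2 * d * words_below d (length w) \<le> 2 * d * code d w" using IH(1) by simp
  moreover have "2 * d * (code d w + 1) \<le> 2 * d * words_below d (Suc (length w))"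
    using IH(2) mult_le_mono2 by blast
  ultimately show ?case using l
    unfolding code.simps cons_code_def length_Cons words_below_Suc[of d "length w"]
      words_below_Suc[of d "Suc (length w)"] distrib_left
    by linarith
qed (simp add: words_below_def)

text \<open>The order of the codes refines the order by length, so balls of words are initial
  segments of the natural numbers.\<close>

lemma code_less_iff:
  assumes "w \<in> lists (letters d)"
  shows "code d w < words_below d n \<longleftrightarrow> length w < n"
  using code_bounds[OF assms] words_below_mono[of "Suc (length w)" n d] words_below_mono[of n "length w" d]
  by (meson Suc_leI not_less order.strict_trans1 order.strict_trans2)

lemma length_code:
  assumes "w \<in> lists (letters d)" "d \<ge> 1"
  shows "length_code d (code d w) = length w"
proof -
  have 1: "words_below d (Suc k) \<le> code d w \<longleftrightarrow> k < length w" for k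
    using code_less_iff[OF assms(1), of "Suc k"] by auto
  have "length w \<le> code d w"
    using words_below_ge[OF assms(2), of "length w"] code_bounds[OF assms(1)] by linarith
  then have "{k. k < code d w \<and> k < length w} = {..<length w}" by auto
  then show ?thesis unfolding length_code_def 1 by (simp add: Int_def)
qed

lemma code_snoc:
  "code d (w @ [l]) = code d w + (1 + letter_code d l) * (2 * d) ^ length w"
  by (induction w) (auto simp: cons_code_def algebra_simps)

lemma snoc_code:
  assumes "w \<in> lists (letters d)" "d \<ge> 1"
  shows "snoc_code d (code d w) (letter_code d l) = code d (w @ [l])"
  using assms by (simp add: snoc_code_def length_code code_snoc)

text \<open>Codes grow by a factor close to \<open>2 * d\<close> with each letter, but the code of a word can be
  near either end of the range for its length, which costs another factor \<open>2 * d\<close>.\<close>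

lemma code_snoc_bound:
  assumes "w \<in> lists (letters d)" "l \<in> letters d"
  shows "code d (w @ [l]) \<le> (2 * d) * (2 * d) * code d w + 2 * d"
  using assms(1)
proof (induction w)
  case Nil
  then show ?case using letter_code_less[OF assms(2)] by (simp add: cons_code_def)
next
  case (Cons k w)
  define D where "D = 2 * d"
  define x where "x = letter_code d k"
  have "k \<in> letters d" using Cons by simp
  then have x: "x < D" using letter_code_less[of k d] by (simp add: D_def x_def)
  have "code d ((k # w) @ [l]) \<le> 1 + x + D * (D * D * code d w + D)"
    using Cons by (simp add: cons_code_def D_def x_def)
  also have "\<dots> \<le> D * D * (1 + x + D * code d w) + D"
  proof -
    have "1 + x \<le> D" using x by simp
    moreover have "0 \<le> D * D * x" by simp
    ultimately show ?thesis by (simp add: algebra_simps)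
  qed
  finally show ?case by (simp add: cons_code_def D_def x_def)
qed

lemma code_snoc_less:
  assumes "w \<in> lists (letters d)" "l \<in> letters d" "code d w < m"
  shows "code d (w @ [l]) < table_size d m"
proof -
  have "(2 * d) * (2 * d) * code d w \<le> (2 * d) * (2 * d) * m" using assms(3) by simp
  then show ?thesis using code_snoc_bound[OF assms(1,2)] unfolding table_size_def by linarith
qed

lemma code_append_mono: "d \<ge> 1 \<Longrightarrow> code d w \<le> code d (u @ w)"
proof (induction u)
  case (Cons l u)
  have "code d (u @ w) \<le> 2 * d * code d (u @ w)" using Cons by simp
  then show ?case using Cons.IH Cons.prems unfolding append_Cons code.simps cons_code_def by linarith
qed simp

lemma digit_less: "B > 0 \<Longrightarrow> digit B x i < B"
  by (simp add: digit_def)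

lemma digits_exist:
  assumes "\<And>i. i < n \<Longrightarrow> p i < B"
  shows "\<exists>x<B ^ n. \<forall>i<n. digit B x i = p i"
  using assms
proof (induction n)
  case (Suc n)
  then obtain x where x: "x < B ^ n" "\<forall>i<n. digit B x i = p i" by auto
  have p: "p n < B" using Suc.prems by simp
  let ?y = "x + p n * B ^ n"
  have "?y < (1 + p n) * B ^ n" using x by simp
  also have "\<dots> \<le> B * B ^ n" using p by (intro mult_le_mono1) simp
  finally have "?y < B ^ Suc n" by simp
  moreover have "digit B ?y i = p i" if "i < Suc n" for i
  proof (cases "i = n")
    case True
    then show ?thesis using x p by (simp add: digit_def)
  next
    case False
    then have i: "i < n" using that by simp
    have B: "B ^ i \<noteq> 0" using p by (cases B) auto
    have "n = i + Suc (n - Suc i)" using i by simp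
    then have "B ^ n = B ^ i * (B * B ^ (n - Suc i))" by (metis power_Suc power_add)
    then have "?y = x + B ^ i * (B * (p n * B ^ (n - Suc i)))" by simp
    then have "?y div B ^ i = x div B ^ i + B * (p n * B ^ (n - Suc i))"
      using div_mult_self2[OF B] by (simp only: add.commute)
    then show ?thesis using x i by (simp add: digit_def)
  qed
  ultimately show ?case by blast
qed simp

section \<open>Balls in Schreier graphs\<close>

definition neighbour :: "'v lgraph \<Rightarrow> letter \<Rightarrow> 'v \<Rightarrow> 'v" where
  "neighbour G l x = (THE y. (x, y) \<in> edges G \<and> l \<in> lab G x y)"

definition walk :: "'v lgraph \<Rightarrow> word \<Rightarrow> 'v \<Rightarrow> 'v" where
  "walk G = foldr (neighbour G)"

lemma walk_simps [simp]: "walk G [] x = x" "walk G (l # w) x = neighbour G l (walk G w x)"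
  "walk G (u @ w) x = walk G u (walk G w x)"
  by (simp_all add: walk_def)

definition inv_word :: "word \<Rightarrow> word" where
  "inv_word w = rev (map linv w)"

lemma inv_word_simps [simp]: "length (inv_word w) = length w" "inv_word [] = []"
  "inv_word (l # w) = inv_word w @ [linv l]" "inv_word (inv_word w) = w"
  "set w \<subseteq> letters d \<Longrightarrow> set (inv_word w) \<subseteq> letters d"
  by (auto simp: inv_word_def rev_map o_def)

lemma schreier_edgeE:
  assumes "schreier_graph d G" "(x, y) \<in> edges G"
  shows "x \<in> verts G" "y \<in> verts G" "(y, x) \<in> edges G" "lab G x y \<noteq> {}" "lab G x y \<subseteq> letters d"
    "l \<in> lab G x y \<Longrightarrow> linv l \<in> lab G y x"
proof -
  have L: "edges G \<subseteq> verts G \<times> verts G" "sym (edges G)"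
    "\<And>x y. (x, y) \<in> edges G \<Longrightarrow> lab G x y \<noteq> {} \<and> lab G x y \<subseteq> letters d \<and>
        (\<forall>i<d. Gen i \<in> lab G x y \<longleftrightarrow> Inv i \<in> lab G y x)"
    using assms(1) unfolding schreier_graph_def labeled_graph_def by auto
  show yx: "(y, x) \<in> edges G" using L(2) assms(2) by (meson symD)
  show "x \<in> verts G" "y \<in> verts G" using L(1) assms(2) by auto
  show "lab G x y \<noteq> {}" "lab G x y \<subseteq> letters d" using L(3)[OF assms(2)] by auto
  assume l: "l \<in> lab G x y"
  then have "l \<in> letters d" using L(3)[OF assms(2)] by auto
  then show "linv l \<in> lab G y x"
    using L(3)[OF assms(2)] L(3)[OF yx] l by (cases l) (auto simp: letters_def)
qed

lemma neighbour_edge: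
  assumes "schreier_graph d G" "x \<in> verts G" "l \<in> letters d"
  shows "(x, neighbour G l x) \<in> edges G" "l \<in> lab G x (neighbour G l x)" "neighbour G l x \<in> verts G"
proof -
  have "\<exists>!y. (x, y) \<in> edges G \<and> l \<in> lab G x y"
    using assms unfolding schreier_graph_def by blast
  from theI'[OF this] show "(x, neighbour G l x) \<in> edges G" "l \<in> lab G x (neighbour G l x)"
    by (auto simp: neighbour_def)
  then show "neighbour G l x \<in> verts G" using schreier_edgeE(2)[OF assms(1)] by blast
qed

lemma neighbour_eqI:
  assumes "schreier_graph d G" "(x, y) \<in> edges G" "l \<in> lab G x y"
  shows "neighbour G l x = y"
proof -
  have "x \<in> verts G" "l \<in> letters d" using schreier_edgeE[OF assms(1,2)] assms(3) by auto
  then have "\<exists>!y. (x, y) \<in> edges G \<and> l \<in> lab G x y"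
    using assms(1) unfolding schreier_graph_def by blast
  then show ?thesis using assms unfolding neighbour_def by (simp add: the1_equality)
qed

lemma neighbour_linv:
  assumes "schreier_graph d G" "x \<in> verts G" "l \<in> letters d"
  shows "neighbour G (linv l) (neighbour G l x) = x" "neighbour G l (neighbour G (linv l) x) = x"
proof -
  have *: "neighbour G (linv l) (neighbour G l x) = x" if "l \<in> letters d" for l
    using neighbour_edge[OF assms(1,2) that] schreier_edgeE(3,6)[OF assms(1)]
    by (intro neighbour_eqI[OF assms(1)]) blast+
  show "neighbour G (linv l) (neighbour G l x) = x" by (rule *) fact
  show "neighbour G l (neighbour G (linv l) x) = x" using *[of "linv l"] assms(3) by simp
qed

lemma edge_iff_neighbour:
  assumes "schreier_graph d G"
  shows "(x, y) \<in> edges G \<longleftrightarrow> x \<in> verts G \<and> (\<exists>l\<in>letters d. neighbour G l x = y)"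
proof
  assume e: "(x, y) \<in> edges G"
  then obtain l where "l \<in> lab G x y" using schreier_edgeE(4)[OF assms] by blast
  then show "x \<in> verts G \<and> (\<exists>l\<in>letters d. neighbour G l x = y)"
    using neighbour_eqI[OF assms e] schreier_edgeE[OF assms e] by blast
qed (use neighbour_edge[OF assms] in blast)

lemma lab_eq_neighbour:
  assumes "schreier_graph d G" "(x, y) \<in> edges G"
  shows "lab G x y = {l \<in> letters d. neighbour G l x = y}"
  using neighbour_eqI[OF assms] schreier_edgeE(1,5)[OF assms] neighbour_edge(2)[OF assms(1)]
  by blast

lemma walk_in_verts:
  "schreier_graph d G \<Longrightarrow> x \<in> verts G \<Longrightarrow> set w \<subseteq> letters d \<Longrightarrow> walk G w x \<in> verts G"
  by (induction w) (auto intro: neighbour_edge)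

lemma walk_inv_word:
  "schreier_graph d G \<Longrightarrow> x \<in> verts G \<Longrightarrow> set w \<subseteq> letters d \<Longrightarrow> walk G (inv_word w) (walk G w x) = x"
  by (induction w) (auto simp: neighbour_linv walk_in_verts)

lemma walk_eq_iff:
  assumes "schreier_graph d G" "x \<in> verts G" "y \<in> verts G" "set w \<subseteq> letters d"
  shows "walk G w x = y \<longleftrightarrow> x = walk G (inv_word w) y"
  using walk_inv_word[OF assms(1,2,4)] walk_inv_word[OF assms(1,3), of "inv_word w"] assms(4) by auto

lemma relpow_iff_walk:
  assumes "schreier_graph d G" "x \<in> verts G"
  shows "(x, y) \<in> edges G ^^ k \<longleftrightarrow> (\<exists>w. set w \<subseteq> letters d \<and> length w = k \<and> walk G w x = y)"
proof (induction k arbitrary: y)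
  case (Suc k)
  have "(x, y) \<in> edges G ^^ Suc k \<longleftrightarrow>
      (\<exists>z. (\<exists>w. set w \<subseteq> letters d \<and> length w = k \<and> walk G w x = z) \<and> (z, y) \<in> edges G)"
    using Suc by auto
  also have "\<dots> \<longleftrightarrow> (\<exists>w l. set w \<subseteq> letters d \<and> length w = k \<and> l \<in> letters d \<and> walk G (l # w) x = y)"
    using edge_iff_neighbour[OF assms(1)] walk_in_verts[OF assms] by auto
  also have "\<dots> \<longleftrightarrow> (\<exists>w. set w \<subseteq> letters d \<and> length w = Suc k \<and> walk G w x = y)"
  proof safe
    fix w l assume "set w \<subseteq> letters d" "l \<in> letters d"
    then show "\<exists>wa. set wa \<subseteq> letters d \<and> length wa = Suc (length w) \<and> walk G wa x = walk G (l # w) x"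
      by (intro exI[of _ "l # w"]) auto
  next
    fix w assume "set w \<subseteq> letters d" "length w = Suc k"
    then show "\<exists>wa l. set wa \<subseteq> letters d \<and> length wa = k \<and> l \<in> letters d \<and> walk G (l # wa) x = walk G w x"
      by (cases w) auto
  qed
  finally show ?case .
qed auto

lemma ball_verts_eq:
  assumes "schreier_graph d G" "v \<in> verts G"
  shows "ball_verts G r v = (\<lambda>w. walk G w v) ` {w. set w \<subseteq> letters d \<and> length w \<le> r}"
  unfolding ball_verts_def using relpow_iff_walk[OF assms] walk_in_verts[OF assms] by auto

lemma finite_letters: "finite (letters d)"
  by (simp add: letters_def)

lemma finite_ball_verts: "schreier_graph d G \<Longrightarrow> v \<in> verts G \<Longrightarrow> finite (ball_verts G r v)"
  by (simp add: ball_verts_eq finite_lists_length_le finite_letters)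

text \<open>A word of length at most \<open>2 * r + 1\<close> that fixes the root splits in the middle: it says that
  two words of length at most \<open>r\<close> lead to the same vertex, or to the ends of an edge with a given
  label. These are the data that an isomorphism of \<open>r\<close>-balls has to respect.\<close>

lemma fixing_words_pairs:
  assumes G: "schreier_graph d G" "v \<in> verts G" and G': "schreier_graph d G'" "v' \<in> verts G'"
  shows "(\<forall>w. set w \<subseteq> letters d \<and> length w \<le> 2 * r + 1 \<longrightarrow> (walk G w v = v \<longleftrightarrow> walk G' w v' = v')) \<longleftrightarrow>
    (\<forall>u w. set u \<subseteq> letters d \<and> set w \<subseteq> letters d \<and> length u \<le> r \<and> length w \<le> r \<longrightarrow>
       (walk G w v = walk G u v \<longleftrightarrow> walk G' w v' = walk G' u v') \<and>
       (\<forall>l\<in>letters d. walk G (l # w) v = walk G u v \<longleftrightarrow> walk G' (l # w) v' = walk G' u v'))"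
    (is "?L \<longleftrightarrow> ?R")
proof -
  have shift: "walk K w x = walk K u x \<longleftrightarrow> walk K (inv_word u @ w) x = x"
    if "schreier_graph d K" "x \<in> verts K" "set u \<subseteq> letters d" "set w \<subseteq> letters d" for K x u w
    using walk_eq_iff[OF that(1,2) walk_in_verts[OF that(1,2,4)] that(3)] by auto
  show ?thesis
  proof
    assume L: ?L
    show ?R
    proof (intro allI impI conjI ballI)
      fix u w assume uw: "set u \<subseteq> letters d \<and> set w \<subseteq> letters d \<and> length u \<le> r \<and> length w \<le> r"
      show "walk G w v = walk G u v \<longleftrightarrow> walk G' w v' = walk G' u v'"
        using uw L[rule_format, of "inv_word u @ w"] by (simp only: shift G G') simp
      fix l assume l: "l \<in> letters d"
      have s: "set (l # w) \<subseteq> letters d" "set u \<subseteq> letters d" using uw l by auto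
      show "walk G (l # w) v = walk G u v \<longleftrightarrow> walk G' (l # w) v' = walk G' u v'"
        unfolding shift[OF G s(2,1)] shift[OF G' s(2,1)]
        using uw l by (intro L[rule_format]) simp
    qed
  next
    assume R: ?R
    show ?L
    proof (intro allI impI)
      fix w assume w: "set w \<subseteq> letters d \<and> length w \<le> 2 * r + 1"
      show "walk G w v = v \<longleftrightarrow> walk G' w v' = v'"
      proof (cases "length w \<le> 2 * r")
        case True
        define a b where "a = inv_word (take r w)" and "b = drop r w"
        have ab: "w = inv_word a @ b" "length a \<le> r" "length b \<le> r"
          using True by (auto simp: a_def b_def)
        have s: "set a \<subseteq> letters d" "set b \<subseteq> letters d"
          using w set_take_subset[of r w] set_drop_subset[of r w] unfolding a_def b_def
          by (meson inv_word_simps(5) subset_trans)+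
        show ?thesis
          unfolding ab(1) shift[OF G s, symmetric] shift[OF G' s, symmetric]
          using R ab s by blast
      next
        case False
        define a l b where "a = inv_word (take r w)" and "l = w ! r" and "b = drop (Suc r) w"
        have len: "length w = 2 * r + 1" using w False by simp
        have ab: "w = inv_word a @ l # b" "length a \<le> r" "length b \<le> r"
          using len by (auto simp: a_def b_def l_def Cons_nth_drop_Suc)
        have l: "l \<in> letters d" using w len by (auto simp: l_def)
        have s: "set a \<subseteq> letters d" "set b \<subseteq> letters d" "set (l # b) \<subseteq> letters d"
          using w set_take_subset[of r w] set_drop_subset[of "Suc r" w] l unfolding a_def b_def
          by (meson inv_word_simps(5) subset_trans, meson subset_trans,
              metis insert_subset list.simps(15) subset_trans)
        show ?thesis
          unfolding ab(1) shift[OF G s(1,3), symmetric] shift[OF G' s(1,3), symmetric]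
          using R ab s l by blast
      qed
    qed
  qed
qed

text \<open>An isomorphism commutes with all walks that stay in the ball. Conversely, sending the end of
  a walk in one ball to the end of the walk with the same word in the other is well defined and
  injective, and it preserves labelled edges because these are induced from the whole graph, also
  between two vertices at distance \<open>r\<close>.\<close>

lemma rball_iso_iff:
  assumes G: "schreier_graph d G" "v \<in> verts G" and G': "schreier_graph d G'" "v' \<in> verts G'"
  shows "rooted_iso (rball G r v) (rball G' r v') \<longleftrightarrow>
    (\<forall>w. set w \<subseteq> letters d \<and> length w \<le> 2 * r + 1 \<longrightarrow> (walk G w v = v \<longleftrightarrow> walk G' w v' = v'))"
  unfolding fixing_words_pairs[OF assms]
proof
  let ?W = "{w. set w \<subseteq> letters d \<and> length w \<le> r}"
  note B = ball_verts_eq[OF G, of r] and B' = ball_verts_eq[OF G', of r]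
  {
    assume "rooted_iso (rball G r v) (rball G' r v')"
    then obtain f where f: "bij_betw f (ball_verts G r v) (ball_verts G' r v')" "f v = v'"
      and fel: "\<And>x y. x \<in> ball_verts G r v \<Longrightarrow> y \<in> ball_verts G r v \<Longrightarrow>
         ((x, y) \<in> edges G \<inter> (ball_verts G r v \<times> ball_verts G r v) \<longleftrightarrow>
          (f x, f y) \<in> edges G' \<inter> (ball_verts G' r v' \<times> ball_verts G' r v')) \<and>
         ((x, y) \<in> edges G \<inter> (ball_verts G r v \<times> ball_verts G r v) \<longrightarrow> lab G x y = lab G' (f x) (f y))"
      unfolding rooted_iso_def rball_def prod.case lgraph.select_convs by blast
    have fm: "f x \<in> ball_verts G' r v'" if "x \<in> ball_verts G r v" for x
      using f(1) that by (auto simp: bij_betw_def)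
    have fe: "(x, y) \<in> edges G \<longleftrightarrow> (f x, f y) \<in> edges G'"
      and fl: "(x, y) \<in> edges G \<Longrightarrow> lab G x y = lab G' (f x) (f y)"
      if "x \<in> ball_verts G r v" "y \<in> ball_verts G r v" for x y
      using fel[OF that] fm that by auto
    have nb: "neighbour G l x = y \<longleftrightarrow> neighbour G' l (f x) = f y"
      if xy: "x \<in> ball_verts G r v" "y \<in> ball_verts G r v" and l: "l \<in> letters d" for l x y
    proof -
      have x: "x \<in> verts G" using xy by (simp add: ball_verts_def)
      have x': "f x \<in> verts G'" using xy f(1) by (auto simp: bij_betw_def ball_verts_def)
      have "neighbour G l x = y \<longleftrightarrow> (x, y) \<in> edges G \<and> l \<in> lab G x y"
        using neighbour_edge[OF G(1) x l] neighbour_eqI[OF G(1)] by blast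
      also have "\<dots> \<longleftrightarrow> (f x, f y) \<in> edges G' \<and> l \<in> lab G' (f x) (f y)"
        using fe[OF xy] fl[OF xy] by blast
      also have "\<dots> \<longleftrightarrow> neighbour G' l (f x) = f y"
        using neighbour_edge[OF G'(1) x' l] neighbour_eqI[OF G'(1)] by metis
      finally show ?thesis .
    qed
    have fw: "f (walk G w v) = walk G' w v'" if "w \<in> ?W" for w
      using that
    proof (induction w)
      case (Cons l w)
      have "walk G w v \<in> ball_verts G r v" unfolding B by (rule imageI) (use Cons.prems in simp)
      moreover have "walk G (l # w) v \<in> ball_verts G r v" unfolding B by (rule imageI) (use Cons.prems in simp)
      ultimately have "neighbour G' l (f (walk G w v)) = f (walk G (l # w) v)"
        using nb[of "walk G w v" "walk G (l # w) v" l] Cons.prems by simp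
      then show ?case using Cons by simp
    qed (simp add: f)
    show "\<forall>u w. set u \<subseteq> letters d \<and> set w \<subseteq> letters d \<and> length u \<le> r \<and> length w \<le> r \<longrightarrow>
       (walk G w v = walk G u v \<longleftrightarrow> walk G' w v' = walk G' u v') \<and>
       (\<forall>l\<in>letters d. walk G (l # w) v = walk G u v \<longleftrightarrow> walk G' (l # w) v' = walk G' u v')"
    proof (intro allI impI)
      fix u w assume "set u \<subseteq> letters d \<and> set w \<subseteq> letters d \<and> length u \<le> r \<and> length w \<le> r"
      then have uw: "u \<in> ?W" "w \<in> ?W" by auto
      then have b: "walk G u v \<in> ball_verts G r v" "walk G w v \<in> ball_verts G r v" unfolding B by auto
      have "walk G w v = walk G u v \<longleftrightarrow> walk G' w v' = walk G' u v'"
        using f(1) b fw[OF uw(1)] fw[OF uw(2)] unfolding bij_betw_def by (metis inj_on_eq_iff)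
      moreover have "walk G (l # w) v = walk G u v \<longleftrightarrow> walk G' (l # w) v' = walk G' u v'" if "l \<in> letters d" for l
        using nb[OF b(2,1) that] fw[OF uw(1)] fw[OF uw(2)] by simp
      ultimately show "(walk G w v = walk G u v \<longleftrightarrow> walk G' w v' = walk G' u v') \<and>
       (\<forall>l\<in>letters d. walk G (l # w) v = walk G u v \<longleftrightarrow> walk G' (l # w) v' = walk G' u v')" by blast
    qed
  }
  {
    assume R: "\<forall>u w. set u \<subseteq> letters d \<and> set w \<subseteq> letters d \<and> length u \<le> r \<and> length w \<le> r \<longrightarrow>
       (walk G w v = walk G u v \<longleftrightarrow> walk G' w v' = walk G' u v') \<and>
       (\<forall>l\<in>letters d. walk G (l # w) v = walk G u v \<longleftrightarrow> walk G' (l # w) v' = walk G' u v')"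
    have R1: "walk G w v = walk G u v \<longleftrightarrow> walk G' w v' = walk G' u v'" if "u \<in> ?W" "w \<in> ?W" for u w
      using R that by blast
    have R2: "neighbour G l (walk G w v) = walk G u v \<longleftrightarrow> neighbour G' l (walk G' w v') = walk G' u v'"
      if "u \<in> ?W" "w \<in> ?W" "l \<in> letters d" for u w l
      using R that by simp
    define f where "f x = walk G' (SOME w. w \<in> ?W \<and> walk G w v = x) v'" for x
    have fw: "f (walk G w v) = walk G' w v'" if w: "w \<in> ?W" for w
    proof -
      have "\<exists>u. u \<in> ?W \<and> walk G u v = walk G w v" using w by blast
      from someI_ex[OF this] show ?thesis unfolding f_def using R1[OF w] by blast
    qed
    have "inj_on f (ball_verts G r v)"
      unfolding B inj_on_def using R1 fw by auto
    moreover have "f ` ball_verts G r v = ball_verts G' r v'"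
      unfolding B B' image_image using fw by (intro image_cong) auto
    ultimately have bij: "bij_betw f (ball_verts G r v) (ball_verts G' r v')" by (simp add: bij_betw_def)
    have "f v = v'" using fw[of "[]"] by simp
    moreover have "((x, y) \<in> edges G \<longleftrightarrow> (f x, f y) \<in> edges G') \<and>
        ((x, y) \<in> edges G \<longrightarrow> lab G x y = lab G' (f x) (f y))"
      if xy: "x \<in> ball_verts G r v" "y \<in> ball_verts G r v" for x y
    proof -
      obtain w u where wu: "w \<in> ?W" "x = walk G w v" "u \<in> ?W" "y = walk G u v"
        using xy unfolding B by blast
      have nb: "neighbour G l x = y \<longleftrightarrow> neighbour G' l (f x) = f y" if "l \<in> letters d" for l
        using R2[OF wu(3,1) that] wu fw by simp
      have x: "x \<in> verts G" using xy by (simp add: ball_verts_def)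
      have "f x \<in> ball_verts G' r v'" using xy(1) bij by (auto simp: bij_betw_def)
      then have x': "f x \<in> verts G'" by (simp add: ball_verts_def)
      have e: "(x, y) \<in> edges G \<longleftrightarrow> (f x, f y) \<in> edges G'"
        unfolding edge_iff_neighbour[OF G(1)] edge_iff_neighbour[OF G'(1)] using x x' nb by blast
      moreover have "lab G x y = lab G' (f x) (f y)" if "(x, y) \<in> edges G"
        unfolding lab_eq_neighbour[OF G(1) that] lab_eq_neighbour[OF G'(1) e[THEN iffD1, OF that]]
        using nb by blast
      ultimately show ?thesis by blast
    qed
    moreover have "f x \<in> ball_verts G' r v'" if "x \<in> ball_verts G r v" for x
      using bij that by (auto simp: bij_betw_def)
    ultimately show "rooted_iso (rball G r v) (rball G' r v')"
      unfolding rooted_iso_def rball_def prod.case lgraph.select_convs using bij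
      by (intro exI[of _ f]) auto
  }
qed

lemma rooted_iso_refl: "rooted_iso P P"
  unfolding rooted_iso_def by (cases P) (auto intro!: exI[of _ id])

lemma rooted_iso_trans:
  assumes "rooted_iso P Q" "rooted_iso Q R"
  shows "rooted_iso P R"
proof -
  obtain G v H w K z where PQR: "P = (G, v)" "Q = (H, w)" "R = (K, z)" by (meson surj_pair)
  obtain f where f: "bij_betw f (verts G) (verts H)" "f v = w"
    "\<And>x y. x \<in> verts G \<Longrightarrow> y \<in> verts G \<Longrightarrow> ((x, y) \<in> edges G \<longleftrightarrow> (f x, f y) \<in> edges H) \<and>
          ((x, y) \<in> edges G \<longrightarrow> lab G x y = lab H (f x) (f y))"
    using assms(1) unfolding rooted_iso_def PQR by auto
  obtain g where g: "bij_betw g (verts H) (verts K)" "g w = z"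
    "\<And>x y. x \<in> verts H \<Longrightarrow> y \<in> verts H \<Longrightarrow> ((x, y) \<in> edges H \<longleftrightarrow> (g x, g y) \<in> edges K) \<and>
          ((x, y) \<in> edges H \<longrightarrow> lab H x y = lab K (g x) (g y))"
    using assms(2) unfolding rooted_iso_def PQR by auto
  have m: "f x \<in> verts H" if "x \<in> verts G" for x using f(1) that by (auto simp: bij_betw_def)
  show ?thesis unfolding rooted_iso_def PQR prod.case
  proof (intro exI[of _ "g \<circ> f"] conjI ballI)
    show "bij_betw (g \<circ> f) (verts G) (verts K)" using bij_betw_trans[OF f(1) g(1)] .
  qed (use f g m in auto)
qed

lemma rooted_iso_sym:
  assumes "rooted_iso P Q" "snd P \<in> verts (fst P)"
  shows "rooted_iso Q P"
proof -
  obtain G v H w where PQ: "P = (G, v)" "Q = (H, w)" by (meson surj_pair)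
  obtain f where f: "bij_betw f (verts G) (verts H)" "f v = w"
    "\<And>x y. x \<in> verts G \<Longrightarrow> y \<in> verts G \<Longrightarrow> ((x, y) \<in> edges G \<longleftrightarrow> (f x, f y) \<in> edges H) \<and>
          ((x, y) \<in> edges G \<longrightarrow> lab G x y = lab H (f x) (f y))"
    using assms(1) unfolding rooted_iso_def PQ by auto
  let ?g = "inv_into (verts G) f"
  have g: "?g y \<in> verts G" "f (?g y) = y" if "y \<in> verts H" for y
    using f(1) that by (auto simp: bij_betw_def inv_into_into f_inv_into_f)
  show ?thesis unfolding rooted_iso_def PQ prod.case
  proof (intro exI[of _ ?g] conjI ballI)
    show "bij_betw ?g (verts H) (verts G)" using f(1) by (rule bij_betw_inv_into)
    show "?g w = v" using f(1,2) assms(2) PQ by (auto simp: bij_betw_def inv_into_f_eq)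
  next
    fix x y assume "x \<in> verts H" "y \<in> verts H"
    then show "((x, y) \<in> edges H) = ((?g x, ?g y) \<in> edges G)"
      "(x, y) \<in> edges H \<longrightarrow> lab H x y = lab G (?g x) (?g y)"
      using f(3)[of "?g x" "?g y"] g by auto
  qed
qed

lemma root_in_rball: "v \<in> verts G \<Longrightarrow> snd (rball G r v) \<in> verts (fst (rball G r v))"
  by (auto simp: rball_def ball_verts_def intro: exI[of _ 0])

lemma has_type_iso:
  assumes "rooted_iso P Q" "has_type Q C"
  shows "has_type P C"
  using assms rooted_iso_trans unfolding has_type_def by blast

text \<open>Elements of a class are isomorphic to each other, although \<open>has_type\<close> only asks for an
  isomorphism to one of them.\<close>

lemma has_type_unique:
  assumes C: "C \<in> ball_classes d r" and "has_type P C" "has_type Q C" and Q: "snd Q \<in> verts (fst Q)"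
  shows "rooted_iso P Q"
proof -
  obtain F F' where F: "F \<in> C" "rooted_iso P F" and F': "F' \<in> C" "rooted_iso Q F'"
    using assms unfolding has_type_def by blast
  obtain X where X: "rooted_iso X F" "rooted_iso X F'" "X \<in> rooted_graphs d r"
    using C F(1) F'(1) unfolding ball_classes_def quotient_def by auto
  have "snd X \<in> verts (fst X)" using X(3) by (auto simp: rooted_graphs_def)
  with X(1) have "rooted_iso F X" by (rule rooted_iso_sym)
  with F(2) X(2) rooted_iso_sym[OF F'(2) Q] show ?thesis by (meson rooted_iso_trans)
qed

text \<open>The ball is finite, so an injection into the natural numbers turns it into one of the
  graphs that the classes are made of.\<close>

lemma rball_class_exists:
  assumes G: "schreier_graph d G" "v \<in> verts G"
  shows "\<exists>C\<in>ball_classes d r. has_type (rball G r v) C"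
proof -
  let ?B = "ball_verts G r v"
  obtain f :: "_ \<Rightarrow> nat" where f: "inj_on f ?B"
    using finite_imp_inj_to_nat_seg[OF finite_ball_verts[OF G]] by blast
  let ?g = "inv_into ?B f"
  define F :: "nat lgraph" where "F = \<lparr>verts = f ` ?B,
    edges = (\<lambda>(x, y). (f x, f y)) ` (edges G \<inter> ?B \<times> ?B), lab = (\<lambda>a b. lab G (?g a) (?g b))\<rparr>"
  have g: "?g (f x) = x" if "x \<in> ?B" for x using f that by (rule inv_into_f_f)
  have FE: "(f x, f y) \<in> edges F \<longleftrightarrow> (x, y) \<in> edges G" if "x \<in> ?B" "y \<in> ?B" for x y
  proof
    assume "(f x, f y) \<in> edges F"
    then obtain x' y' where "x' \<in> ?B" "y' \<in> ?B" "(x', y') \<in> edges G" "f x = f x'" "f y = f y'"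
      unfolding F_def by auto
    then show "(x, y) \<in> edges G" using f that by (auto dest: inj_onD)
  next
    assume "(x, y) \<in> edges G"
    then show "(f x, f y) \<in> edges F" using that unfolding F_def by auto
  qed
  have FL: "lab F (f x) (f y) = lab G x y" if "x \<in> ?B" "y \<in> ?B" for x y
    using g that by (simp add: F_def)
  have FEE: "\<exists>x\<in>?B. \<exists>y\<in>?B. a = f x \<and> b = f y \<and> (x, y) \<in> edges G" if "(a, b) \<in> edges F" for a b
    using that unfolding F_def by auto
  have vB: "v \<in> ?B" using root_in_rball[OF G(2)] by (simp add: rball_def)
  have lg: "labeled_graph d F"
    unfolding labeled_graph_def
  proof (intro conjI)
    show "verts F \<noteq> {}" using vB by (auto simp: F_def)
    show "edges F \<subseteq> verts F \<times> verts F" by (auto simp: F_def)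
    show "sym (edges F)" using FEE FE schreier_edgeE(3)[OF G(1)] by (intro symI) blast
    have "labeled_graph d G" using G(1) by (simp add: schreier_graph_def)
    then have "\<And>x y. (x, y) \<in> edges G \<Longrightarrow> lab G x y \<noteq> {} \<and> lab G x y \<subseteq> letters d \<and>
        (\<forall>i<d. Gen i \<in> lab G x y \<longleftrightarrow> Inv i \<in> lab G y x)" unfolding labeled_graph_def by auto
    then show "\<forall>(x, y)\<in>edges F. lab F x y \<noteq> {} \<and> lab F x y \<subseteq> letters d \<and>
        (\<forall>i<d. (Gen i \<in> lab F x y) = (Inv i \<in> lab F y x))"
      using FL by (auto dest!: FEE) blast
  qed
  have reach: "(f v, f (walk G w v)) \<in> edges F ^^ length w" if "set w \<subseteq> letters d" "length w \<le> r" for w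
    using that
  proof (induction w)
    case (Cons l w)
    have 1: "walk G w v \<in> ?B" "walk G (l # w) v \<in> ?B"
      unfolding ball_verts_eq[OF G] by (rule imageI, use Cons.prems in simp)+
    have "(walk G w v, walk G (l # w) v) \<in> edges G"
      using neighbour_edge(1)[OF G(1) walk_in_verts[OF G]] Cons.prems by simp
    then show ?case using Cons FE[OF 1] by auto
  qed simp
  have "ball_verts F r (f v) = verts F"
  proof
    show "verts F \<subseteq> ball_verts F r (f v)"
    proof
      fix a assume "a \<in> verts F"
      then obtain w where "set w \<subseteq> letters d" "length w \<le> r" "a = f (walk G w v)"
        unfolding F_def by (auto simp: ball_verts_eq[OF G])
      then show "a \<in> ball_verts F r (f v)"
        unfolding ball_verts_def using reach \<open>a \<in> verts F\<close> by auto
    qed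
  qed (auto simp: ball_verts_def)
  moreover have "f v \<in> verts F" using vB by (simp add: F_def)
  moreover have "b = c" if abc: "(a, b) \<in> edges F" "l \<in> lab F a b" "(a, c) \<in> edges F" "l \<in> lab F a c" for a b c l
  proof -
    obtain x y where xy: "x \<in> ?B" "y \<in> ?B" "a = f x" "b = f y" "(x, y) \<in> edges G" using FEE[OF abc(1)] by blast
    obtain x' z where xz: "x' \<in> ?B" "z \<in> ?B" "a = f x'" "c = f z" "(x', z) \<in> edges G" using FEE[OF abc(3)] by blast
    have "x' = x" using f xy xz by (auto simp: inj_on_def)
    then have "y = z"
      using neighbour_eqI[OF G(1), of x _ l] xy xz abc FL by metis
    then show ?thesis using xy xz by simp
  qed
  ultimately have R: "(F, f v) \<in> rooted_graphs d r"
    unfolding rooted_graphs_def mem_Collect_eq prod.case using lg by blast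
  define C where "C = {(P, Q). P \<in> rooted_graphs d r \<and> Q \<in> rooted_graphs d r \<and> rooted_iso P Q} `` {(F, f v)}"
  have "C \<in> ball_classes d r" unfolding C_def ball_classes_def using R by (rule quotientI)
  moreover have "(F, f v) \<in> C" unfolding C_def using R rooted_iso_refl by auto
  moreover have "rooted_iso (rball G r v) (F, f v)"
    unfolding rooted_iso_def rball_def prod.case lgraph.select_convs
  proof (intro exI[of _ f] conjI ballI)
    show "bij_betw f ?B (verts F)" using f by (simp add: F_def bij_betw_def)
  qed (use FE FL in auto)
  ultimately show ?thesis unfolding has_type_def by blast
qed

lemma has_type_iff_fixing_words:
  assumes G: "schreier_graph d G" "v \<in> verts G" and G': "schreier_graph d G'" "v' \<in> verts G'"
    and C: "C \<in> ball_classes d r" "has_type (rball G r v) C"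
  shows "has_type (rball G' r v') C \<longleftrightarrow>
    (\<forall>w. set w \<subseteq> letters d \<and> length w \<le> 2 * r + 1 \<longrightarrow> (walk G' w v' = v' \<longleftrightarrow> walk G w v = v))"
  using has_type_unique[OF C(1) _ C(2) root_in_rball[OF G(2)], of "rball G' r v'"]
    has_type_iso[OF _ C(2), of "rball G' r v'"] rball_iso_iff[OF G' G, of r]
  by blast


section \<open>Coset graphs\<close>

abbreviation reduce :: "word \<Rightarrow> word" where
  "reduce w \<equiv> foldr cons_red w []"

lemma reduce_carrier: "set w \<subseteq> letters d \<Longrightarrow> reduce w \<in> carrier (free_group d)"
  using set_foldr[of w "[]"] by (auto simp: free_group_def intro: reduced_foldr)

context
  fixes d H assumes H: "subgroup H (free_group d)"
begin

interpretation group "free_group d" by (rule group_free_group)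

lemma letter_carrier: "l \<in> letters d \<Longrightarrow> [l] \<in> carrier (free_group d)"
  by (simp add: free_group_def reduced_Cons)

lemma coset_graph_edge:
  "(X, Y) \<in> edges (coset_graph d H) \<longleftrightarrow>
     X \<in> verts (coset_graph d H) \<and> (\<exists>l\<in>letters d. Y = [l] <#\<^bsub>free_group d\<^esub> X)"
  by (auto simp: coset_graph_def)

lemma coset_in: "X \<in> verts (coset_graph d H) \<Longrightarrow> l \<in> letters d \<Longrightarrow> [l] <#\<^bsub>free_group d\<^esub> X \<in> verts (coset_graph d H)"
  using letter_carrier[of l] lcos_m_assoc[OF subgroup.subset[OF H]]
  by (auto simp: coset_graph_def LCOSETS_def)

lemma coset_cancel:
  assumes "X \<in> verts (coset_graph d H)" "l \<in> letters d"
  shows "[linv l] <#\<^bsub>free_group d\<^esub> ([l] <#\<^bsub>free_group d\<^esub> X) = X"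
proof -
  have X: "X \<subseteq> carrier (free_group d)"
    using assms(1) lcosets_subset_PowG[OF H] by (auto simp: coset_graph_def)
  have "[linv l] \<otimes>\<^bsub>free_group d\<^esub> [l] = \<one>\<^bsub>free_group d\<^esub>"
    by (simp add: free_group_def)
  then show ?thesis using lcos_m_assoc[OF X letter_carrier letter_carrier, of "linv l" l] assms(2)
      lcos_mult_one[OF X] by simp
qed

lemma schreier_coset_graph: "schreier_graph d (coset_graph d H)"
proof -
  let ?G = "coset_graph d H"
  have flip: "Y = [l] <#\<^bsub>free_group d\<^esub> X \<longleftrightarrow> X = [linv l] <#\<^bsub>free_group d\<^esub> Y"
    if "X \<in> verts ?G" "Y \<in> verts ?G" "l \<in> letters d" for X Y l
    using coset_cancel[OF that(1,3)] coset_cancel[OF that(2), of "linv l"] that(3) by auto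
  have e: "X \<in> verts ?G" "Y \<in> verts ?G" if "(X, Y) \<in> edges ?G" for X Y
    using that coset_in by (auto simp: coset_graph_edge)
  have lab: "lab ?G X Y = {l \<in> letters d. Y = [l] <#\<^bsub>free_group d\<^esub> X}" for X Y
    by (simp add: coset_graph_def)
  have "labeled_graph d ?G" unfolding labeled_graph_def
  proof (intro conjI)
    show "verts ?G \<noteq> {}" by (auto simp: coset_graph_def LCOSETS_def)
    show "edges ?G \<subseteq> verts ?G \<times> verts ?G" using e by auto
    show "sym (edges ?G)"
    proof (rule symI)
      fix X Y assume XY: "(X, Y) \<in> edges ?G"
      then obtain l where l: "l \<in> letters d" "Y = [l] <#\<^bsub>free_group d\<^esub> X" by (auto simp: coset_graph_edge)
      then have "X = [linv l] <#\<^bsub>free_group d\<^esub> Y" using flip e[OF XY] by blast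
      then show "(Y, X) \<in> edges ?G" using e[OF XY] l(1) unfolding coset_graph_edge
        by (auto intro!: bexI[of _ "linv l"])
    qed
    show "\<forall>(X, Y)\<in>edges ?G. lab ?G X Y \<noteq> {} \<and> lab ?G X Y \<subseteq> letters d \<and>
        (\<forall>i<d. (Gen i \<in> lab ?G X Y) = (Inv i \<in> lab ?G Y X))"
    proof (safe)
      fix X Y assume XY: "(X, Y) \<in> edges ?G" and "lab ?G X Y = {}"
      then show False by (auto simp: coset_graph_edge lab)
    next
      fix X Y i assume XY: "(X, Y) \<in> edges ?G" and i: "i < d"
      have "Gen i \<in> letters d" "Inv i \<in> letters d" using i by (auto simp: letters_def)
      then show "Gen i \<in> lab ?G X Y \<Longrightarrow> Inv i \<in> lab ?G Y X" "Inv i \<in> lab ?G Y X \<Longrightarrow> Gen i \<in> lab ?G X Y"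
        using flip[OF e[OF XY], of "Gen i"] by (auto simp: lab)
    qed (auto simp: lab)
  qed
  moreover have "\<exists>!Y. (X, Y) \<in> edges ?G \<and> l \<in> lab ?G X Y" if "X \<in> verts ?G" "l \<in> letters d" for X l
    using that by (auto simp: coset_graph_edge lab)
  ultimately show ?thesis unfolding schreier_graph_def by blast
qed

lemma root_coset: "H \<in> verts (coset_graph d H)"
  using lcos_mult_one[OF subgroup.subset[OF H]] one_closed by (force simp: coset_graph_def LCOSETS_def)

lemma walk_coset_graph:
  assumes "set w \<subseteq> letters d"
  shows "walk (coset_graph d H) w H = reduce w <#\<^bsub>free_group d\<^esub> H"
  using assms
proof (induction w)
  case Nil
  then show ?case using lcos_mult_one[OF subgroup.subset[OF H]] by (simp add: free_group_def)
next
  case (Cons l w)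
  let ?X = "walk (coset_graph d H) w H"
  have l: "l \<in> letters d" and w: "set w \<subseteq> letters d" using Cons.prems by auto
  have X: "?X \<in> verts (coset_graph d H)"
    using walk_in_verts[OF schreier_coset_graph root_coset w] .
  have "neighbour (coset_graph d H) l ?X = [l] <#\<^bsub>free_group d\<^esub> ?X"
    using X l by (intro neighbour_eqI[OF schreier_coset_graph]) (auto simp: coset_graph_def)
  also have "\<dots> = [l] <#\<^bsub>free_group d\<^esub> (reduce w <#\<^bsub>free_group d\<^esub> H)" using Cons by simp
  also have "\<dots> = ([l] \<otimes>\<^bsub>free_group d\<^esub> reduce w) <#\<^bsub>free_group d\<^esub> H"
    by (rule lcos_m_assoc[OF subgroup.subset[OF H] letter_carrier[OF l] reduce_carrier[OF w]])
  finally show ?case by (simp add: free_group_def)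
qed

text \<open>The stabilizer of the root coset is the subgroup itself.\<close>

lemma walk_coset_graph_fixes:
  assumes "set w \<subseteq> letters d"
  shows "walk (coset_graph d H) w H = H \<longleftrightarrow> reduce w \<in> H"
  unfolding walk_coset_graph[OF assms]
  using coset_join3[OF reduce_carrier[OF assms] H] lcos_self[OF reduce_carrier[OF assms] H] by auto

end

text \<open>Frequencies of ball types are frequencies of patterns of fixing words, by
  \<open>rball_iso_iff\<close>; the remaining arguments only deal with patterns.\<close>

definition pattern_count :: "nat \<Rightarrow> nat lgraph \<Rightarrow> nat \<Rightarrow> nat \<Rightarrow> nat" where
  "pattern_count d G W \<sigma> = card {v \<in> verts G. pattern W \<sigma> (\<lambda>c. walk G (word_of d c) v)}"

lemma word_of_0: "word_of d 0 = []"
  using word_of_code[of "[]" d] by simp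

lemma word_of_set: "d \<ge> 1 \<Longrightarrow> set (word_of d c) \<subseteq> letters d"
  using word_of(1)[of d c] by auto

lemma all_short_words:
  assumes "d \<ge> 1"
  shows "(\<forall>w. set w \<subseteq> letters d \<and> length w \<le> k \<longrightarrow> P w) \<longleftrightarrow> (\<forall>c<words_below d (Suc k). P (word_of d c))"
proof safe
  fix c assume a: "\<forall>w. set w \<subseteq> letters d \<and> length w \<le> k \<longrightarrow> P w" "c < words_below d (Suc k)"
  then have "length (word_of d c) < Suc k"
    using code_less_iff[OF word_of(1)[OF assms]] word_of(2)[OF assms] by metis
  then show "P (word_of d c)" using a word_of_set[OF assms] by auto
next
  fix w assume a: "\<forall>c<words_below d (Suc k). P (word_of d c)" "set w \<subseteq> letters d" "length w \<le> k"
  have w: "w \<in> lists (letters d)" using a by auto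
  then have "code d w < words_below d (Suc k)" using a code_less_iff by simp
  then show "P w" using a word_of_code[OF w] by metis
qed

lemma has_type_iff_pattern:
  fixes G' :: "nat lgraph"
  assumes "d \<ge> 1" and G: "schreier_graph d G" "v \<in> verts G" and G': "schreier_graph d G'" "v' \<in> verts G'"
    and C: "C \<in> ball_classes d r" "has_type (rball G r v) C"
    and \<sigma>: "\<And>c. c < words_below d (2 * r + 2) \<Longrightarrow> digit 2 \<sigma> c = 1 \<longleftrightarrow> walk G (word_of d c) v = v"
  shows "has_type (rball G' r v') C \<longleftrightarrow>
    pattern (words_below d (2 * r + 2)) \<sigma> (\<lambda>c. walk G' (word_of d c) v')"
  unfolding has_type_iff_fixing_words[OF G G' C] all_short_words[OF assms(1)]
  using \<sigma> by (auto simp: pattern_def word_of_0)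

text \<open>Any vertex of any Schreier graph, such as a coset graph, may be used to find the pattern
  that belongs to the class \<open>C\<close>.\<close>

lemma u_stat_eq_pattern:
  assumes "d \<ge> 1" and G: "schreier_graph d G" "v \<in> verts G" and G': "schreier_graph d G'"
    and C: "C \<in> ball_classes d r" "has_type (rball G r v) C"
    and \<sigma>: "\<And>c. c < words_below d (2 * r + 2) \<Longrightarrow> digit 2 \<sigma> c = 1 \<longleftrightarrow> walk G (word_of d c) v = v"
  shows "u_stat r C G' = real (pattern_count d G' (words_below d (2 * r + 2)) \<sigma>) / real (card (verts G'))"
  unfolding u_stat_def pattern_count_def
  using has_type_iff_pattern[OF assms(1) G G' _ C \<sigma>] by (metis (mono_tags, lifting) Collect_cong)

lemma bits_exist: "\<exists>\<sigma><2 ^ q. \<forall>c<q. digit 2 \<sigma> c = 1 \<longleftrightarrow> P c"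
proof -
  have "\<exists>\<sigma><2 ^ q. \<forall>c<q. digit 2 \<sigma> c = of_bool (P c)" by (rule digits_exist) simp
  then obtain \<sigma> where "\<sigma> < 2 ^ q" "\<forall>c<q. digit 2 \<sigma> c = of_bool (P c)" by blast
  then show ?thesis by (intro exI[of _ \<sigma>]) auto
qed

section \<open>Tables of finite Schreier graphs\<close>

definition table_graph :: "nat \<Rightarrow> nat \<Rightarrow> (nat \<Rightarrow> nat \<Rightarrow> nat) \<Rightarrow> nat lgraph" where
  "table_graph d n h = \<lparr>verts = {..<n},
     edges = {(x, y). x < n \<and> (\<exists>l\<in>letters d. y = h (cons_code d (letter_code d l) 0) x)},
     lab = (\<lambda>x y. {l \<in> letters d. y = h (cons_code d (letter_code d l) 0) x})\<rparr>"

lemma words_below_2: "words_below d 2 = 1 + 2 * d"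
  by (simp add: words_below_def numeral_2_eq_2)

text \<open>The rows of the one-letter words define the graph; the recursion in \<open>action_table\<close> then
  forces the other rows to describe its walks.\<close>

lemma table_graph:
  assumes h: "action_table d n W h" and n: "0 < n" and W: "words_below d 2 \<le> W" and "d \<ge> 1"
    and range: "\<And>c x. c < W \<Longrightarrow> x < n \<Longrightarrow> h c x < n"
  shows "table_graph d n h \<in> finite_schreier_graphs d"
    and "card (verts (table_graph d n h)) = n"
    and "pattern_count d (table_graph d n h) W \<sigma> = table_count n W h \<sigma>"
proof -
  let ?G = "table_graph d n h"
  let ?a = "\<lambda>l. h (cons_code d (letter_code d l) 0)"
  have lW: "cons_code d (letter_code d l) 0 < W" if "l \<in> letters d" for l
    using letter_code_less[OF that] W by (simp add: words_below_2 cons_code_def)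
  have a: "?a l x < n" if "l \<in> letters d" "x < n" for l x
    using range lW that by blast
  have inv: "?a l (?a (linv l) x) = x" if "l \<in> letters d" "x < n" for l x
    using h that letter_code_less[OF that(1)] unfolding action_table_def by (simp add: letter_code_linv)
  have flip: "y = ?a l x \<longleftrightarrow> x = ?a (linv l) y" if "l \<in> letters d" "x < n" "y < n" for l x y
    using inv[OF that(1,3)] inv[of "linv l" x] that by auto
  have S: "schreier_graph d ?G"
    unfolding schreier_graph_def labeled_graph_def
  proof (intro conjI)
    show "verts ?G \<noteq> {}" using n by (auto simp: table_graph_def)
    show "edges ?G \<subseteq> verts ?G \<times> verts ?G" using a by (auto simp: table_graph_def)
    show "sym (edges ?G)"
    proof (rule symI)
      fix x y assume "(x, y) \<in> edges ?G"
      then obtain l where l: "l \<in> letters d" "x < n" "y = ?a l x" by (auto simp: table_graph_def)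
      then have "y < n" "x = ?a (linv l) y" using a flip by blast+
      then show "(y, x) \<in> edges ?G" using l(1) by (auto simp: table_graph_def intro!: bexI[of _ "linv l"])
    qed
    show "\<forall>(x, y)\<in>edges ?G. lab ?G x y \<noteq> {} \<and> lab ?G x y \<subseteq> letters d \<and>
        (\<forall>i<d. (Gen i \<in> lab ?G x y) = (Inv i \<in> lab ?G y x))"
    proof safe
      fix x y i assume xy: "(x, y) \<in> edges ?G" and i: "i < d"
      have "x < n" "y < n" using xy a by (auto simp: table_graph_def)
      moreover have "Gen i \<in> letters d" "Inv i \<in> letters d" using i by (auto simp: letters_def)
      ultimately show "Gen i \<in> lab ?G x y \<Longrightarrow> Inv i \<in> lab ?G y x" "Inv i \<in> lab ?G y x \<Longrightarrow> Gen i \<in> lab ?G x y"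
        using flip[of "Gen i" x y] by (auto simp: table_graph_def)
    qed (auto simp: table_graph_def)
    show "\<forall>x\<in>verts ?G. \<forall>l\<in>letters d. \<exists>!y. (x, y) \<in> edges ?G \<and> l \<in> lab ?G x y"
      by (auto simp: table_graph_def)
  qed
  then show "?G \<in> finite_schreier_graphs d" by (simp add: finite_schreier_graphs_def table_graph_def)
  show "card (verts ?G) = n" by (simp add: table_graph_def)
  have walk: "walk ?G w x = h (code d w) x" if "w \<in> lists (letters d)" "code d w < W" "x < n" for w x
    using that
  proof (induction w)
    case Nil
    then show ?case using h by (simp add: action_table_def)
  next
    case (Cons l w)
    have w: "code d w < W" using Cons.prems code_append_mono[OF assms(4), of w "[l]"] by simp
    have "neighbour ?G l (walk ?G w x) = ?a l (walk ?G w x)"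
      using Cons w range[OF w] by (intro neighbour_eqI[OF S]) (auto simp: table_graph_def)
    then show ?case using Cons w h letter_code_less[of l d] by (auto simp: action_table_def)
  qed
  have "pattern W \<sigma> (\<lambda>c. walk ?G (word_of d c) x) \<longleftrightarrow> pattern W \<sigma> (\<lambda>c. h c x)" if "x < n" for x
  proof -
    have "walk ?G (word_of d c) x = h c x" if "c < W" for c
      using walk[OF word_of(1)[OF assms(4)], of c x] word_of(2)[OF assms(4)] \<open>x < n\<close> that by simp
    moreover have "0 < W" using W by (simp add: words_below_2)
    ultimately show ?thesis unfolding pattern_def by simp
  qed
  then have "{x \<in> verts ?G. pattern W \<sigma> (\<lambda>c. walk ?G (word_of d c) x)} = {..<n} \<inter> {x. pattern W \<sigma> (\<lambda>c. h c x)}"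
    by (auto simp: table_graph_def)
  then show "pattern_count d ?G W \<sigma> = table_count n W h \<sigma>"
    unfolding pattern_count_def table_count_def by simp
qed

lemma table_exists:
  assumes "G \<in> finite_schreier_graphs d" and d: "d \<ge> 1" and W: "words_below d 2 \<le> W"
  defines "n \<equiv> card (verts G)"
  shows "0 < n \<and> (\<exists>H<n ^ (W * n). action_table d n W (\<lambda>c x. digit n H (c * n + x)) \<and>
    (\<forall>\<sigma>. table_count n W (\<lambda>c x. digit n H (c * n + x)) \<sigma> = pattern_count d G W \<sigma>))"
proof -
  have G: "schreier_graph d G" and fin: "finite (verts G)"
    using assms by (auto simp: finite_schreier_graphs_def)
  have n: "0 < n" using G fin unfolding n_def schreier_graph_def labeled_graph_def by (simp add: card_gt_0_iff)
  obtain b where b: "bij_betw b {..<n} (verts G)"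
    using ex_bij_betw_nat_finite[OF fin] by (auto simp: n_def atLeast0LessThan)
  let ?i = "inv_into {..<n} b"
  have i: "?i v < n" "b (?i v) = v" if "v \<in> verts G" for v
    using b that inv_into_into[of v b "{..<n}"] by (auto simp: bij_betw_def f_inv_into_f)
  have ib: "?i (b x) = x" "b x \<in> verts G" if "x < n" for x
    using b that by (auto simp: bij_betw_def)
  let ?h = "\<lambda>c x. ?i (walk G (word_of d c) (b x))"
  have wv: "walk G (word_of d c) v \<in> verts G" if "v \<in> verts G" for c v
    using walk_in_verts[OF G that word_of_set[OF d]] .
  have "\<exists>H<n ^ (W * n). \<forall>k<W * n. digit n H k = ?h (k div n) (k mod n)"
    by (rule digits_exist) (use i wv ib n in auto)
  then obtain H where H: "H < n ^ (W * n)" "\<And>k. k < W * n \<Longrightarrow> digit n H k = ?h (k div n) (k mod n)"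
    by blast
  let ?t = "\<lambda>c x. digit n H (c * n + x)"
  have t: "?t c x = ?h c x" if "c < W" "x < n" for c x
  proof -
    have "c * n + x < Suc c * n" using that by simp
    also have "\<dots> \<le> W * n" using that by (intro mult_le_mono1) simp
    finally show ?thesis using H(2)[of "c * n + x"] that by simp
  qed
  have hn: "?h c x < n" if "x < n" for c x using i wv ib that by simp
  have W0: "0 < W" using W by (simp add: words_below_2)
  have cons: "?h (cons_code d (letter_code d l) c) x = ?i (neighbour G l (walk G (word_of d c) (b x)))"
    if "l \<in> letters d" "x < n" for l c x
    using word_of_cons[OF d that(1)] by simp
  have lW: "cons_code d (letter_code d l) 0 < W" if "l \<in> letters d" for l
    using letter_code_less[OF that] W by (simp add: words_below_2 cons_code_def)
  have bh: "b (?h c x) = walk G (word_of d c) (b x)" if "x < n" for c x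
    using i wv ib that by simp
  have "action_table d n W ?t"
    unfolding action_table_def all_letter_codes
  proof (intro conjI allI impI ballI)
    fix x assume x: "x < n"
    show "?t 0 x = x" using t[OF W0 x] ib x by (simp add: word_of_0)
    fix l assume l: "l \<in> letters d"
    have l': "linv l \<in> letters d" using l by simp
    have b: "b (?h (cons_code d (letter_code d (linv l)) 0) x) = neighbour G (linv l) (b x)"
      using bh[OF x, of "cons_code d (letter_code d (linv l)) 0"] by (simp add: word_of_cons[OF d l'] word_of_0)
    have "?t (cons_code d (letter_code d l) 0) (?t (cons_code d (letter_code d (linv l)) 0) x) =
        ?h (cons_code d (letter_code d l) 0) (?h (cons_code d (letter_code d (linv l)) 0) x)"
      using t lW l l' x hn by simp
    also have "\<dots> = ?i (neighbour G l (neighbour G (linv l) (b x)))"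
      unfolding b word_of_cons[OF d l] by (simp add: word_of_0)
    also have "\<dots> = x" using neighbour_linv(2)[OF G ib(2)[OF x] l] ib(1)[OF x] by simp
    finally show "?t (cons_code d (letter_code d l) 0) (?t (cons_code d (inv_code d (letter_code d l)) 0) x) = x"
      using letter_code_linv[OF l] by simp
  next
    fix x c l assume x: "x < n" and c: "c < W" and l: "l \<in> letters d"
      and lc: "cons_code d (letter_code d l) c < W"
    show "?t (cons_code d (letter_code d l) c) x = ?t (cons_code d (letter_code d l) 0) (?t c x)"
      using t[OF lc x] t[OF c x] t[OF lW[OF l] hn[OF x]] cons[OF l x, of c] cons[OF l hn[OF x], of 0 c] bh[OF x, of c]
      by (simp add: word_of_0)
  qed
  moreover have "table_count n W ?t \<sigma> = pattern_count d G W \<sigma>" for \<sigma>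
  proof -
    have "pattern W \<sigma> (\<lambda>c. ?t c x) \<longleftrightarrow> pattern W \<sigma> (\<lambda>c. walk G (word_of d c) (b x))" if x: "x < n" for x
    proof -
      have "?t c x = ?t 0 x \<longleftrightarrow> walk G (word_of d c) (b x) = walk G (word_of d 0) (b x)" if c: "c < W" for c
        unfolding t[OF c x] t[OF W0 x] using bh[OF x] by metis
      then show ?thesis unfolding pattern_def by simp
    qed
    then have "{..<n} \<inter> {x. pattern W \<sigma> (\<lambda>c. ?t c x)} =
        {x \<in> {..<n}. pattern W \<sigma> (\<lambda>c. walk G (word_of d c) (b x))}" by auto
    moreover have "{v \<in> verts G. pattern W \<sigma> (\<lambda>c. walk G (word_of d c) v)} =
        b ` {x \<in> {..<n}. pattern W \<sigma> (\<lambda>c. walk G (word_of d c) (b x))}"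
    proof -
      have vG: "verts G = b ` {..<n}" using b by (simp add: bij_betw_def)
      show ?thesis unfolding vG by auto
    qed
    ultimately have "bij_betw b ({..<n} \<inter> {x. pattern W \<sigma> (\<lambda>c. ?t c x)})
        {v \<in> verts G. pattern W \<sigma> (\<lambda>c. walk G (word_of d c) v)}"
      by (intro bij_betw_subset[OF b]) auto
    from bij_betw_same_card[OF this] show ?thesis unfolding table_count_def pattern_count_def by simp
  qed
  ultimately show ?thesis using n H(1) by blast
qed

section \<open>Soundness of the test\<close>

lemma rounded_weights:
  fixes j :: "'v \<Rightarrow> nat" and K :: nat
  assumes "finite V" "\<And>v. v \<in> V \<Longrightarrow> j v < T" "0 < card V"
  defines "p \<equiv> \<lambda>i. K * card {v \<in> V. j v = i} div card V"
  shows "card V * (\<Sum>i<T. p i * of_bool (Q i)) \<le> K * card {v \<in> V. Q (j v)}"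
    and "K * card {v \<in> V. Q (j v)} \<le> card V * (\<Sum>i<T. p i * of_bool (Q i)) + card V * T"
proof -
  let ?n = "card V" and ?c = "\<lambda>i. card {v \<in> V. j v = i}"
  have "card {v \<in> V. Q (j v)} = (\<Sum>v\<in>V. of_bool (Q (j v)))"
    using assms(1) by (simp add: Int_def)
  also have "\<dots> = (\<Sum>i<T. \<Sum>v\<in>{v \<in> V. j v = i}. of_bool (Q (j v)))"
    by (rule sum.group[symmetric]) (use assms in auto)
  also have "\<dots> = (\<Sum>i<T. ?c i * of_bool (Q i))"
    by (intro sum.cong) (auto simp: sum_constant)
  finally have K: "K * card {v \<in> V. Q (j v)} = (\<Sum>i<T. K * ?c i * of_bool (Q i))"
    by (simp only: sum_distrib_left mult.assoc)
  have lo: "?n * p i \<le> K * ?c i" for i unfolding p_def by simp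
  have hi: "K * ?c i \<le> ?n * p i + ?n" for i
    unfolding p_def using mult_div_mod_eq[of ?n "K * ?c i"] mod_less_divisor[OF assms(3), of "K * ?c i"]
    by linarith
  have "?n * (\<Sum>i<T. p i * of_bool (Q i)) = (\<Sum>i<T. ?n * p i * of_bool (Q i))"
    by (simp only: sum_distrib_left mult.assoc)
  also have "\<dots> \<le> (\<Sum>i<T. K * ?c i * of_bool (Q i))"
    using lo by (intro sum_mono) auto
  finally show "?n * (\<Sum>i<T. p i * of_bool (Q i)) \<le> K * card {v \<in> V. Q (j v)}" using K by simp
  have "(\<Sum>i<T. K * ?c i * of_bool (Q i)) \<le> (\<Sum>i<T. ?n * p i * of_bool (Q i) + ?n)"
    using hi by (intro sum_mono) auto
  also have "\<dots> = ?n * (\<Sum>i<T. p i * of_bool (Q i)) + ?n * T"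
    by (simp only: sum.distrib sum_distrib_left mult.assoc) simp
  finally show "K * card {v \<in> V. Q (j v)} \<le> ?n * (\<Sum>i<T. p i * of_bool (Q i)) + ?n * T" using K by simp
qed

lemma approximation_arith:
  fixes A a S n n' K T m num den :: nat
  assumes "n * S \<le> K * A" "K * A \<le> n * S + n * T" "K = T * m" "2 * den < num * m"
    and "2 * den * K * a \<le> 2 * den * n' * S + num * n' * K"
    and "2 * den * n' * S \<le> 2 * den * K * a + num * n' * K"
    and pos: "0 < n" "0 < n'" "0 < T" "0 < den"
  shows "\<bar>real A / real n - real a / real n'\<bar> < real num / real den"
proof -
  have m: "0 < m" using assms(4) by (cases m) auto
  then have K: "0 < K" using assms(3) pos by simp
  have r: "real n * real S \<le> real K * real A" "real K * real A \<le> real n * real S + real n * real T"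
    "2 * real den * real K * real a \<le> 2 * real den * real n' * real S + real num * real n' * real K"
    "2 * real den * real n' * real S \<le> 2 * real den * real K * real a + real num * real n' * real K"
    using assms(1,2,5,6)[THEN of_nat_mono[where 'a = real]] by simp_all
  have 1: "real S / real K \<le> real A / real n" "real A / real n \<le> real S / real K + real T / real K"
    using r(1,2) K pos by (simp_all add: field_simps)
  have "real T / real K = 1 / real m" using assms(3) pos by simp
  also have "\<dots> < real num / (2 * real den)"
  proof -
    have "real (2 * den) < real (num * m)" using assms(4) by (simp only: of_nat_less_iff)
    then show ?thesis using m pos by (simp add: field_simps)
  qed
  finally have 2: "real T / real K < real num / (2 * real den)" .
  have 3: "real a / real n' \<le> real S / real K + real num / (2 * real den)"
    "real S / real K \<le> real a / real n' + real num / (2 * real den)"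
    using r(3,4) K pos by (simp_all add: field_simps)
  have "real num / real den = real num / (2 * real den) + real num / (2 * real den)"
    using pos by (simp add: field_simps)
  then show ?thesis using 1 2 3 by linarith
qed

text \<open>The frequencies of the local pictures around the vertices of \<open>G\<close>, rounded to integer
  multiples of \<open>1 / K\<close>, are almost invariant because moving all vertices along a letter permutes
  them. The test then supplies a small graph with nearly the same pattern frequencies.\<close>

lemma certified_sound:
  assumes d: "d \<ge> 1" and cert: "certified d m num den r" and den: "0 < den"
    and GF: "G \<in> finite_schreier_graphs d"
  shows "\<exists>G'\<in>finite_schreier_graphs d. card (verts G') \<le> m \<and>
    (\<forall>C\<in>ball_classes d r. \<bar>u_stat r C G - u_stat r C G'\<bar> < real num / real den)"
proof -
  define M where "M = table_size d m"
  define T where "T = M ^ M"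
  define K where "K = T * m"
  define W where "W = words_below d (2 * r + 2)"
  define n where "n = card (verts G)"
  have c: "2 * den < num * m" "W \<le> m"
    "\<And>P. P < Suc K ^ T \<Longrightarrow> almost_invariant d m M T K P \<Longrightarrow> approximated d m num den M T K W P"
    using cert unfolding certified_def certified_with_def M_def[symmetric] T_def[symmetric]
      K_def[symmetric] W_def[symmetric] by blast+
  have G: "schreier_graph d G" and fin: "finite (verts G)"
    using GF by (auto simp: finite_schreier_graphs_def)
  have W2: "words_below d 2 \<le> W" unfolding W_def by (rule words_below_mono) simp
  have n: "0 < n" using table_exists[OF GF d W2] by (simp add: n_def)
  have "m \<le> (2 * d) * (2 * d) * m" using d by simp
  then have mM: "m \<le> M" and M0: "0 < M" unfolding M_def table_size_def by linarith+
  have T0: "0 < T" using M0 by (simp add: T_def)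
  let ?V = "verts G"
  define F where "F v c = walk G (word_of d c) v" for v c
  \<comment> \<open>A canonical table with entries below \<open>M\<close>: a vertex is represented by the least code that
    leads to it from \<open>v\<close>.\<close>
  define L where "L v c = (LEAST c'. F v c' = F v c)" for v c
  have Lle: "L v c \<le> c" for v c unfolding L_def by (rule Least_le) simp
  have FL: "F v (L v c) = F v c" for v c unfolding L_def by (rule LeastI[of _ c]) simp
  have Leq: "L v c = L v c' \<longleftrightarrow> F v c = F v c'" for v c c'
    using FL by (metis L_def)
  have "\<forall>v. \<exists>x<T. \<forall>i<M. digit M x i = L v i"
    unfolding T_def using Lle by (intro allI digits_exist) (meson le_less_trans)
  then obtain j where j: "\<And>v. j v < T" "\<And>v i. i < M \<Longrightarrow> digit M (j v) i = L v i" by metis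
  have deq: "digit M (j v) c = digit M (j v) c' \<longleftrightarrow> F v c = F v c'" if "c < M" "c' < M" for v c c'
    using j(2) that Leq by simp
  have Fcons: "F v (cons_code d (letter_code d l) c) = neighbour G l (F v c)" if "l \<in> letters d" for v l c
    unfolding F_def using word_of_cons[OF d that] by simp
  have FV: "F v c \<in> ?V" if "v \<in> ?V" for v c
    unfolding F_def using walk_in_verts[OF G that word_of_set[OF d]] .
  have local: "local_action d M (digit M (j v))" if v: "v \<in> ?V" for v
    unfolding local_action_def all_letter_codes
  proof (intro conjI allI impI ballI)
    fix c c' l assume "c < M" "c' < M" "l \<in> letters d"
      "digit M (j v) c = digit M (j v) c' \<and> cons_code d (letter_code d l) c < M \<and> cons_code d (letter_code d l) c' < M"
    then show "digit M (j v) (cons_code d (letter_code d l) c) = digit M (j v) (cons_code d (letter_code d l) c')"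
      using deq Fcons by simp
  next
    fix c l assume l: "l \<in> letters d" and c: "c < M"
      and lc: "cons_code d (letter_code d l) (cons_code d (inv_code d (letter_code d l)) c) < M"
    have "F v (cons_code d (letter_code d l) (cons_code d (letter_code d (linv l)) c)) = F v c"
      using Fcons l neighbour_linv(2)[OF G FV[OF v] l] by simp
    then show "digit M (j v) (cons_code d (letter_code d l) (cons_code d (inv_code d (letter_code d l)) c)) = digit M (j v) c"
      using deq[OF lc c] letter_code_linv[OF l] by simp
  qed
  have pat: "pattern q \<sigma> (digit M (j v)) \<longleftrightarrow> pattern q \<sigma> (F v)" if "q \<le> M" for q \<sigma> v
    unfolding pattern_def using deq M0 that by (meson order_less_le_trans)
  have spat: "pattern q \<sigma> (\<lambda>w. digit M (j v) (snoc_code d w (letter_code d l))) \<longleftrightarrow> pattern q \<sigma> (F (neighbour G l v))"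
    if q: "q \<le> m" and l: "l \<in> letters d" for q \<sigma> v l
  proof -
    have s: "snoc_code d w (letter_code d l) < M \<and> F v (snoc_code d w (letter_code d l)) = F (neighbour G l v) w"
      if "w < m" for w
    proof -
      have e: "snoc_code d w (letter_code d l) = code d (word_of d w @ [l])"
        using snoc_code[OF word_of(1)[OF d] d, of w l] word_of(2)[OF d] by simp
      have "word_of d w @ [l] \<in> lists (letters d)" using word_of(1)[OF d, of w] l by simp
      from word_of_code[OF this] have "F v (code d (word_of d w @ [l])) = F (neighbour G l v) w"
        by (simp add: F_def)
      moreover have "code d (word_of d w @ [l]) < M"
        unfolding M_def by (rule code_snoc_less[OF word_of(1)[OF d] l]) (simp add: word_of(2)[OF d] that)
      ultimately show ?thesis unfolding e by blast
    qed
    show ?thesis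
    proof (cases "q = 0")
      case False
      then have 0: "0 < m" using q by simp
      have "digit M (j v) (snoc_code d w (letter_code d l)) = digit M (j v) (snoc_code d 0 (letter_code d l)) \<longleftrightarrow>
          F (neighbour G l v) w = F (neighbour G l v) 0" if "w < q" for w
        using s[of w] s[OF 0] deq[of "snoc_code d w (letter_code d l)" "snoc_code d 0 (letter_code d l)" v] q that
        by simp
      then show ?thesis unfolding pattern_def by simp
    qed (simp add: pattern_def)
  qed
  define p where "p i = K * card {v \<in> ?V. j v = i} div n" for i
  have "p i < Suc K" for i
  proof -
    have "card {v \<in> ?V. j v = i} \<le> n" unfolding n_def using fin by (intro card_mono) auto
    then have "p i \<le> K * n div n" unfolding p_def by (intro div_le_mono mult_le_mono2)
    then show ?thesis using n by simp
  qed
  then obtain P where P: "P < Suc K ^ T" "\<And>i. i < T \<Longrightarrow> digit (Suc K) P i = p i"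
    using digits_exist[of T p "Suc K"] by blast
  have S: "(\<Sum>i<T. digit (Suc K) P i * f i) = (\<Sum>i<T. p i * f i)" for f
    using P(2) by (intro sum.cong) auto
  have round: "n * (\<Sum>i<T. digit (Suc K) P i * of_bool (Q i)) \<le> K * card {v \<in> ?V. Q (j v)}"
    "K * card {v \<in> ?V. Q (j v)} \<le> n * (\<Sum>i<T. digit (Suc K) P i * of_bool (Q i)) + n * T" for Q
    using rounded_weights[of ?V j T K Q] fin j(1) n unfolding S p_def n_def by auto
  have tot: "n * total_weight d M T K P \<le> K * n" "K * n \<le> n * total_weight d M T K P + n * T"
  proof -
    have "{v \<in> ?V. local_action d M (digit M (j v))} = ?V" using local by auto
    then show "n * total_weight d M T K P \<le> K * n" "K * n \<le> n * total_weight d M T K P + n * T"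
      using round[of "\<lambda>i. local_action d M (digit M i)"] unfolding total_weight_def n_def by auto
  qed
  have pw: "n * pattern_weight d M T K P q \<sigma> \<le> K * pattern_count d G q \<sigma>"
    "K * pattern_count d G q \<sigma> \<le> n * pattern_weight d M T K P q \<sigma> + n * T" if "q \<le> m" for q \<sigma>
  proof -
    have "{v \<in> ?V. local_action d M (digit M (j v)) \<and> pattern q \<sigma> (digit M (j v))} = {v \<in> ?V. pattern q \<sigma> (F v)}"
      using local pat that mM by auto
    then show "n * pattern_weight d M T K P q \<sigma> \<le> K * pattern_count d G q \<sigma>"
      "K * pattern_count d G q \<sigma> \<le> n * pattern_weight d M T K P q \<sigma> + n * T"
      using round[of "\<lambda>i. local_action d M (digit M i) \<and> pattern q \<sigma> (digit M i)"]
      unfolding pattern_weight_def pattern_count_def F_def[abs_def] by auto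
  qed
  have sw: "n * shifted_weight d M T K P (letter_code d l) q \<sigma> \<le> K * pattern_count d G q \<sigma>"
    "K * pattern_count d G q \<sigma> \<le> n * shifted_weight d M T K P (letter_code d l) q \<sigma> + n * T"
    if q: "q \<le> m" and l: "l \<in> letters d" for q \<sigma> l
  proof -
    let ?Q = "\<lambda>i. local_action d M (digit M i) \<and> pattern q \<sigma> (\<lambda>w. digit M i (snoc_code d w (letter_code d l)))"
    have e: "{v \<in> ?V. ?Q (j v)} = {v \<in> ?V. pattern q \<sigma> (F (neighbour G l v))}"
      using local spat[OF q l] by auto
    have "bij_betw (neighbour G l) {v \<in> ?V. pattern q \<sigma> (F (neighbour G l v))} {v \<in> ?V. pattern q \<sigma> (F v)}"
      by (rule bij_betw_byWitness[where f' = "neighbour G (linv l)"])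
        (use neighbour_linv[OF G _ l] neighbour_edge(3)[OF G] l in auto)
    then have "card {v \<in> ?V. ?Q (j v)} = pattern_count d G q \<sigma>"
      unfolding e pattern_count_def F_def by (rule bij_betw_same_card)
    then show "n * shifted_weight d M T K P (letter_code d l) q \<sigma> \<le> K * pattern_count d G q \<sigma>"
      "K * pattern_count d G q \<sigma> \<le> n * shifted_weight d M T K P (letter_code d l) q \<sigma> + n * T"
      using round[of ?Q] unfolding shifted_weight_def by auto
  qed
  have cancel: "a \<le> b" if "n * a \<le> n * b" for a b using that n by simp
  have "almost_invariant d m M T K P"
    unfolding almost_invariant_def all_letter_codes
  proof (intro conjI allI impI ballI)
    show "total_weight d M T K P \<le> K" by (rule cancel) (use tot(1) in \<open>simp add: mult.commute\<close>)
    show "K \<le> total_weight d M T K P + T"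
      by (rule cancel) (use tot(2) in \<open>simp add: mult.commute distrib_left\<close>)
  next
    fix l q \<sigma> assume l: "l \<in> letters d" and "q < Suc m"
    then have q: "q \<le> m" by simp
    show "pattern_weight d M T K P q \<sigma> \<le> shifted_weight d M T K P (letter_code d l) q \<sigma> + T"
      by (rule cancel) (use pw(1)[OF q, of \<sigma>] sw(2)[OF q l, of \<sigma>] in \<open>simp add: distrib_left\<close>)
    show "shifted_weight d M T K P (letter_code d l) q \<sigma> \<le> pattern_weight d M T K P q \<sigma> + T"
      by (rule cancel) (use sw(1)[OF q l, of \<sigma>] pw(2)[OF q, of \<sigma>] in \<open>simp add: distrib_left\<close>)
  qed
  from c(3)[OF P(1) this] obtain n' H where n': "n' \<le> m" "0 < n'"
    and h: "action_table d n' W (\<lambda>c x. digit n' H (c * n' + x))"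
    and close: "\<And>\<sigma>. \<sigma> < 2 ^ W \<Longrightarrow>
      2 * den * K * table_count n' W (\<lambda>c x. digit n' H (c * n' + x)) \<sigma>
        \<le> 2 * den * n' * pattern_weight d M T K P W \<sigma> + num * n' * K \<and>
      2 * den * n' * pattern_weight d M T K P W \<sigma>
        \<le> 2 * den * K * table_count n' W (\<lambda>c x. digit n' H (c * n' + x)) \<sigma> + num * n' * K"
    unfolding approximated_def less_Suc_eq_le by blast
  define G' where "G' = table_graph d n' (\<lambda>c x. digit n' H (c * n' + x))"
  have G': "G' \<in> finite_schreier_graphs d" "card (verts G') = n'"
    "\<And>\<sigma>. pattern_count d G' W \<sigma> = table_count n' W (\<lambda>c x. digit n' H (c * n' + x)) \<sigma>"
    unfolding G'_def by (intro table_graph[OF h n'(2) W2 d] digit_less n'(2))+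
  then have SG': "schreier_graph d G'" by (simp add: finite_schreier_graphs_def)
  have num: "0 < num" using c(1) by (cases num) auto
  have "\<bar>u_stat r C G - u_stat r C G'\<bar> < real num / real den" if C: "C \<in> ball_classes d r" for C
  proof -
    have key: "\<bar>u_stat r C G - u_stat r C G'\<bar> < real num / real den"
      if G0: "schreier_graph d G0" "v \<in> verts G0" "has_type (rball G0 r v) C" for G0 :: "nat lgraph" and v
    proof -
      obtain \<sigma> where \<sigma>: "\<sigma> < 2 ^ W" "\<And>c. c < W \<Longrightarrow> digit 2 \<sigma> c = 1 \<longleftrightarrow> walk G0 (word_of d c) v = v"
        using bits_exist[of W "\<lambda>c. walk G0 (word_of d c) v = v"] by blast
      have u: "u_stat r C K = real (pattern_count d K W \<sigma>) / real (card (verts K))" if "schreier_graph d K" for K :: "nat lgraph"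
        unfolding W_def by (rule u_stat_eq_pattern[OF d G0(1,2) that C G0(3) \<sigma>(2)[unfolded W_def]])
      show ?thesis unfolding u[OF G] u[OF SG'] G'(2) n_def[symmetric]
        by (rule approximation_arith[OF pw[OF c(2)] K_def c(1) _ _ n n'(2) T0 den])
          (use close[OF \<sigma>(1)] G'(3) in auto)
    qed
    \<comment> \<open>A class that occurs in neither graph has frequency zero in both.\<close>
    show ?thesis
    proof (cases "(\<exists>v\<in>verts G. has_type (rball G r v) C) \<or> (\<exists>v\<in>verts G'. has_type (rball G' r v) C)")
      case True
      then show ?thesis using key[OF G] key[OF SG'] by blast
    next
      case False
      then have e: "{v \<in> verts G. has_type (rball G r v) C} = {}" "{v \<in> verts G'. has_type (rball G' r v) C} = {}"
        by auto
      have "u_stat r C G = 0" "u_stat r C G' = 0" unfolding u_stat_def e by simp_all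
      then show ?thesis using num den by simp
    qed
  qed
  then show ?thesis using G'(1,2) n'(1) by blast
qed

section \<open>Limits of random sets of natural numbers\<close>

text \<open>Bit lists have the bit of the largest number first, so that refining a cylinder is \<open>Cons\<close>.\<close>

fun agrees :: "bool list \<Rightarrow> nat set \<Rightarrow> bool" where
  "agrees [] A = True"
| "agrees (b # bs) A = ((b \<longleftrightarrow> length bs \<in> A) \<and> agrees bs A)"

fun bits :: "nat \<Rightarrow> nat set \<Rightarrow> bool list" where
  "bits 0 A = []"
| "bits (Suc n) A = (n \<in> A) # bits n A"

lemma length_bits [simp]: "length (bits n A) = n"
  by (induction n) auto

lemma agrees_iff_bits: "agrees bs A \<longleftrightarrow> bs = bits (length bs) A"
  by (induction bs) auto

lemma agrees_restrict: "agrees bs A \<Longrightarrow> agrees bs B \<Longrightarrow> A \<inter> {..<length bs} = B \<inter> {..<length bs}"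
  by (induction bs) (auto simp: less_Suc_eq lessThan_Suc)

text \<open>Consistent probabilities \<open>y bs\<close> of the cylinders are realized on the unit interval: the
  interval of \<open>bs\<close>, with left end \<open>lower y bs\<close> and length \<open>y bs\<close>, is divided into the interval of
  \<open>False # bs\<close> followed by that of \<open>True # bs\<close>. The random set of \<open>\<omega>\<close> is read off from the nested
  intervals that contain \<open>\<omega>\<close>.\<close>

fun lower :: "(bool list \<Rightarrow> real) \<Rightarrow> bool list \<Rightarrow> real" where
  "lower y [] = 0"
| "lower y (b # bs) = lower y bs + (if b then y (False # bs) else 0)"

fun path :: "(bool list \<Rightarrow> real) \<Rightarrow> real \<Rightarrow> nat \<Rightarrow> bool list" where
  "path y \<omega> 0 = []"
| "path y \<omega> (Suc n) = (lower y (path y \<omega> n) + y (False # path y \<omega> n) \<le> \<omega>) # path y \<omega> n"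

definition path_set :: "(bool list \<Rightarrow> real) \<Rightarrow> real \<Rightarrow> nat set" where
  "path_set y \<omega> = {n. hd (path y \<omega> (Suc n))}"

lemma bits_path_set: "bits n (path_set y \<omega>) = path y \<omega> n"
  by (induction n) (auto simp: path_set_def)

definition unit_measure :: "real measure" where
  "unit_measure = restrict_space lborel {0..<1}"

lemma space_unit: "space unit_measure = {0..<1}"
  by (simp add: unit_measure_def space_restrict_space)

interpretation unit: prob_space unit_measure
  by (rule prob_spaceI) (simp add: unit_measure_def space_restrict_space emeasure_restrict_space)

context
  fixes y :: "bool list \<Rightarrow> real"
  assumes y_nonneg: "\<And>bs. 0 \<le> y bs" and y_Nil: "y [] = 1"
    and y_split: "\<And>bs. y bs = y (False # bs) + y (True # bs)"
begin

lemma lower_bounds: "0 \<le> lower y bs \<and> lower y bs + y bs \<le> 1"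
proof (induction bs)
  case (Cons b bs)
  then show ?case
    using y_split[of bs] y_nonneg[of "False # bs"] y_nonneg[of "True # bs"] by (cases b) auto
qed (simp add: y_Nil)

lemma path_iff:
  assumes "0 \<le> \<omega>" "\<omega> < 1"
  shows "path y \<omega> (length bs) = bs \<longleftrightarrow> lower y bs \<le> \<omega> \<and> \<omega> < lower y bs + y bs"
proof (induction bs)
  case (Cons b bs)
  have "path y \<omega> (length (b # bs)) = b # bs \<longleftrightarrow>
      path y \<omega> (length bs) = bs \<and> b = (lower y bs + y (False # bs) \<le> \<omega>)" by auto
  also have "\<dots> \<longleftrightarrow> (lower y bs \<le> \<omega> \<and> \<omega> < lower y bs + y bs) \<and> b = (lower y bs + y (False # bs) \<le> \<omega>)"
    using Cons by simp
  also have "\<dots> \<longleftrightarrow> lower y (b # bs) \<le> \<omega> \<and> \<omega> < lower y (b # bs) + y (b # bs)"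
    using y_split[of bs] y_nonneg[of "False # bs"] y_nonneg[of "True # bs"] by (cases b) auto
  finally show ?case .
qed (use assms in \<open>simp add: y_Nil\<close>)

lemma agrees_event:
  "{\<omega> \<in> space unit_measure. agrees bs (path_set y \<omega>)} = {lower y bs..<lower y bs + y bs}"
proof -
  have "agrees bs (path_set y \<omega>) \<longleftrightarrow> path y \<omega> (length bs) = bs" for \<omega>
    unfolding agrees_iff_bits bits_path_set by auto
  then show ?thesis using path_iff[of _ bs] lower_bounds[of bs] by (auto simp: space_unit)
qed

lemma agrees_measure:
  "{\<omega> \<in> space unit_measure. agrees bs (path_set y \<omega>)} \<in> sets unit_measure"
  "measure unit_measure {\<omega> \<in> space unit_measure. agrees bs (path_set y \<omega>)} = y bs"
proof -
  have sub: "{lower y bs..<lower y bs + y bs} \<subseteq> {0..<1}" using lower_bounds[of bs] by auto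
  then show "{\<omega> \<in> space unit_measure. agrees bs (path_set y \<omega>)} \<in> sets unit_measure"
    unfolding agrees_event by (simp add: unit_measure_def sets_restrict_space_iff)
  have "measure unit_measure {lower y bs..<lower y bs + y bs} = y bs"
    unfolding unit_measure_def using sub y_nonneg[of bs] by (simp add: measure_restrict_space)
  then show "measure unit_measure {\<omega> \<in> space unit_measure. agrees bs (path_set y \<omega>)} = y bs"
    unfolding agrees_event .
qed

end

lemma compact_pointwise_unit: "compact {f :: 'a::countable \<Rightarrow> real. \<forall>i. 0 \<le> f i \<and> f i \<le> 1}"
proof -
  have "{f :: 'a \<Rightarrow> real. \<forall>i. 0 \<le> f i \<and> f i \<le> 1} = PiE UNIV (\<lambda>_. {0..1})"
    by (auto simp: PiE_def)
  moreover have "compactin (product_topology (\<lambda>_. euclidean) UNIV) (PiE UNIV (\<lambda>_::'a. {0..1::real}))"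
    by (simp add: compactin_PiE)
  ultimately show ?thesis by (simp add: euclidean_product_topology)
qed

text \<open>Events that depend on finitely many members of the random set; they are finite unions of
  cylinders.\<close>

definition local_event :: "(nat set \<Rightarrow> bool) \<Rightarrow> bool" where
  "local_event \<Phi> \<longleftrightarrow> (\<exists>q. \<forall>A B. A \<inter> {..<q} = B \<inter> {..<q} \<longrightarrow> \<Phi> A = \<Phi> B)"

lemma local_eventI:
  assumes "finite F" "\<And>A B. (\<And>c. c \<in> F \<Longrightarrow> c \<in> A \<longleftrightarrow> c \<in> B) \<Longrightarrow> \<Phi> A = \<Phi> B"
  shows "local_event \<Phi>"
proof -
  obtain q where "F \<subseteq> {..<q}" using assms(1) finite_nat_iff_bounded by blast
  then have "\<forall>A B. A \<inter> {..<q} = B \<inter> {..<q} \<longrightarrow> \<Phi> A = \<Phi> B"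
    by (intro allI impI assms(2)) blast
  then show ?thesis unfolding local_event_def by blast
qed

lemma agrees_cong: "(\<And>c. c < length bs \<Longrightarrow> c \<in> A \<longleftrightarrow> c \<in> B) \<Longrightarrow> agrees bs A = agrees bs B"
  by (induction bs) auto

lemma local_event_agrees: "local_event (agrees bs)"
  by (rule local_eventI[of "{..<length bs}"], simp, rule agrees_cong) simp

lemma local_event_bits:
  assumes "local_event \<Phi>"
  shows "\<exists>q L. finite L \<and> (\<forall>bs\<in>L. length bs = q) \<and> (\<forall>A. \<Phi> A \<longleftrightarrow> bits q A \<in> L)"
proof -
  obtain q where q: "\<And>A B. A \<inter> {..<q} = B \<inter> {..<q} \<Longrightarrow> \<Phi> A = \<Phi> B"
    using assms unfolding local_event_def by blast
  define L where "L = {bs. length bs = q \<and> (\<exists>A. agrees bs A \<and> \<Phi> A)}"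
  have fin: "finite L"
    by (rule finite_subset[OF _ finite_lists_length_eq[of UNIV q]]) (auto simp: L_def)
  have iff: "\<Phi> A \<longleftrightarrow> bits q A \<in> L" for A
  proof
    have A: "agrees (bits q A) A" by (simp add: agrees_iff_bits)
    then show "\<Phi> A \<Longrightarrow> bits q A \<in> L" unfolding L_def by auto
    assume "bits q A \<in> L"
    then obtain B where B: "agrees (bits q A) B" "\<Phi> B" unfolding L_def by blast
    have "\<Phi> A = \<Phi> B" by (rule q) (use agrees_restrict[OF A B(1)] in simp)
    then show "\<Phi> A" using B by simp
  qed
  have "\<forall>bs\<in>L. length bs = q" by (simp add: L_def)
  with fin iff show ?thesis by blast
qed

lemma prob_local_event:
  assumes L: "finite L" "\<forall>bs\<in>L. length bs = q" "\<forall>A. \<Phi> A \<longleftrightarrow> bits q A \<in> L"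
    and Z: "\<And>bs. {\<omega> \<in> space unit_measure. agrees bs (Z \<omega>)} \<in> sets unit_measure"
  shows "{\<omega> \<in> space unit_measure. \<Phi> (Z \<omega>)} \<in> sets unit_measure"
    and "measure unit_measure {\<omega> \<in> space unit_measure. \<Phi> (Z \<omega>)} =
      (\<Sum>bs\<in>L. measure unit_measure {\<omega> \<in> space unit_measure. agrees bs (Z \<omega>)})"
proof -
  let ?A = "\<lambda>bs. {\<omega> \<in> space unit_measure. agrees bs (Z \<omega>)}"
  have agr: "agrees bs A \<longleftrightarrow> bs = bits q A" if "bs \<in> L" for bs A
    using L(2) that agrees_iff_bits[of bs A] by simp
  have U: "{\<omega> \<in> space unit_measure. \<Phi> (Z \<omega>)} = (\<Union>bs\<in>L. ?A bs)"
    using L(3) agr by auto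
  show "{\<omega> \<in> space unit_measure. \<Phi> (Z \<omega>)} \<in> sets unit_measure"
    unfolding U using L(1) Z by (intro sets.finite_UN) auto
  show "measure unit_measure {\<omega> \<in> space unit_measure. \<Phi> (Z \<omega>)} = (\<Sum>bs\<in>L. measure unit_measure (?A bs))"
    unfolding U
  proof (rule unit.finite_measure_finite_Union[OF L(1)])
    show "?A ` L \<subseteq> unit.events" using Z by blast
    show "disjoint_family_on ?A L" unfolding disjoint_family_on_def using agr by auto
  qed
qed

text \<open>Compactness of the space of random sets. The probabilities of the countably many cylinders
  form a point of a compact metrizable product of unit intervals, so along a subsequence they all
  converge, and the limits are consistent because consistency is a closed condition.\<close>

lemma random_set_limit:
  fixes J :: "nat \<Rightarrow> 'j set" and a :: "nat \<Rightarrow> 'j \<Rightarrow> real" and X :: "nat \<Rightarrow> 'j \<Rightarrow> nat set"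
  assumes fin: "\<And>m. finite (J m)" and a: "\<And>m j. j \<in> J m \<Longrightarrow> 0 \<le> a m j"
    and le1: "\<And>m. sum (a m) (J m) \<le> 1" and lim1: "(\<lambda>m. sum (a m) (J m)) \<longlonglongrightarrow> 1"
  shows "\<exists>s S. strict_mono s \<and> (\<forall>\<Phi>. local_event \<Phi> \<longrightarrow>
     {\<omega> \<in> space unit_measure. \<Phi> (S \<omega>)} \<in> sets unit_measure \<and>
     (\<lambda>k. \<Sum>j\<in>J (s k). a (s k) j * of_bool (\<Phi> (X (s k) j)))
        \<longlonglongrightarrow> measure unit_measure {\<omega> \<in> space unit_measure. \<Phi> (S \<omega>)})"
proof -
  define E where "E m \<Phi> = (\<Sum>j\<in>J m. a m j * of_bool (\<Phi> (X m j)))" for m \<Phi>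
  define x where "x m bs = E m (agrees bs)" for m bs
  have E0: "0 \<le> E m \<Phi>" for m \<Phi> unfolding E_def using a by (intro sum_nonneg) auto
  have E1: "E m \<Phi> \<le> 1" for m \<Phi>
  proof -
    have "E m \<Phi> \<le> sum (a m) (J m)" unfolding E_def using a by (intro sum_mono) auto
    then show ?thesis using le1 order_trans by blast
  qed
  have "seq_compact {f :: bool list \<Rightarrow> real. \<forall>i. 0 \<le> f i \<and> f i \<le> 1}"
    using compact_pointwise_unit by (rule compact_imp_seq_compact)
  moreover have "\<forall>m. x m \<in> {f. \<forall>i. 0 \<le> f i \<and> f i \<le> 1}" using E0 E1 by (simp add: x_def)
  ultimately obtain y s where "y \<in> {f. \<forall>i. 0 \<le> f i \<and> f i \<le> 1}"
    and s: "strict_mono s" "(x \<circ> s) \<longlonglongrightarrow> y"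
    unfolding seq_compact_def by blast
  then have y: "0 \<le> y i" for i by simp
  have lim: "(\<lambda>k. x (s k) bs) \<longlonglongrightarrow> y bs" for bs
  proof -
    have "continuous_on UNIV (\<lambda>f :: bool list \<Rightarrow> real. f bs)" by (rule continuous_on_product_coordinates)
    then have "isCont (\<lambda>f :: bool list \<Rightarrow> real. f bs) y"
      by (metis continuous_on_eq_continuous_at open_UNIV UNIV_I)
    from isCont_tendsto_compose[OF this s(2)] show ?thesis by simp
  qed
  have "x m [] = sum (a m) (J m)" for m by (simp add: x_def E_def)
  then have "(\<lambda>k. sum (a (s k)) (J (s k))) \<longlonglongrightarrow> y []" using lim[of "[]"] by simp
  moreover have "(\<lambda>k. sum (a (s k)) (J (s k))) \<longlonglongrightarrow> 1"
    using LIMSEQ_subseq_LIMSEQ[OF lim1 s(1)] by (simp add: o_def)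
  ultimately have y1: "y [] = 1" by (rule LIMSEQ_unique)
  have "x m bs = x m (False # bs) + x m (True # bs)" for m bs
    unfolding x_def E_def sum.distrib[symmetric] by (rule sum.cong) auto
  then have xs: "(\<lambda>k. x (s k) bs) = (\<lambda>k. x (s k) (False # bs) + x (s k) (True # bs))" for bs by blast
  have "(\<lambda>k. x (s k) bs) \<longlonglongrightarrow> y (False # bs) + y (True # bs)" for bs
    unfolding xs[of bs] by (rule tendsto_add[OF lim lim])
  then have ys: "y bs = y (False # bs) + y (True # bs)" for bs by (rule LIMSEQ_unique[OF lim])
  note am = agrees_measure[of y, OF y y1 ys]
  have "{\<omega> \<in> space unit_measure. \<Phi> (path_set y \<omega>)} \<in> sets unit_measure \<and>
      (\<lambda>k. E (s k) \<Phi>) \<longlonglongrightarrow> measure unit_measure {\<omega> \<in> space unit_measure. \<Phi> (path_set y \<omega>)}"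
    if \<Phi>: "local_event \<Phi>" for \<Phi>
  proof -
    obtain q L where L: "finite L" "\<forall>bs\<in>L. length bs = q" "\<forall>A. \<Phi> A \<longleftrightarrow> bits q A \<in> L"
      using local_event_bits[OF \<Phi>] by blast
    have ofb: "of_bool (\<Phi> A) = (\<Sum>bs\<in>L. of_bool (agrees bs A) :: real)" for A
    proof -
      have "(\<Sum>bs\<in>L. of_bool (agrees bs A) :: real) = (\<Sum>bs\<in>L. if bs = bits q A then 1 else 0)"
        by (intro sum.cong) (auto simp: agrees_iff_bits L(2))
      then show ?thesis using L by simp
    qed
    have "E m \<Phi> = (\<Sum>bs\<in>L. x m bs)" for m
      unfolding E_def x_def ofb sum_distrib_left by (rule sum.swap)
    then have "(\<lambda>k. E (s k) \<Phi>) \<longlonglongrightarrow> (\<Sum>bs\<in>L. y bs)"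
      using lim by (simp add: tendsto_sum)
    then show ?thesis using prob_local_event[OF L am(1)] am(2) by simp
  qed
  then show ?thesis unfolding E_def using s(1) by (intro exI[of _ s] exI[of _ "path_set y"]) blast
qed

section \<open>Kernels of local actions\<close>

lemma local_action_cons:
  assumes "local_action d M f" "l \<in> letters d" "c < M" "c' < M" "f c = f c'"
    "cons_code d (letter_code d l) c < M" "cons_code d (letter_code d l) c' < M"
  shows "f (cons_code d (letter_code d l) c) = f (cons_code d (letter_code d l) c')"
  using assms letter_code_less[OF assms(2)] unfolding local_action_def by blast

lemma local_action_cancel:
  assumes "local_action d M f" "l \<in> letters d" "c < M"
    "cons_code d (letter_code d l) (cons_code d (letter_code d (linv l)) c) < M"
  shows "f (cons_code d (letter_code d l) (cons_code d (letter_code d (linv l)) c)) = f c"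
  using assms letter_code_less[OF assms(2)] letter_code_linv[OF assms(2)]
  unfolding local_action_def by auto

definition ker :: "nat \<Rightarrow> (nat \<Rightarrow> nat) \<Rightarrow> nat set" where
  "ker M f = {c. c < M \<and> f c = f 0}"

text \<open>For words so short that all codes involved are below \<open>M\<close>, the words that fix the root behave
  like a subgroup of the free group. This is all that is needed in the limit \<open>M \<rightarrow> \<infinity>\<close>.\<close>

context
  fixes d M n f
  assumes act: "local_action d M f" and M: "words_below d (Suc n) \<le> M"
begin

lemma short_code: "set w \<subseteq> letters d \<Longrightarrow> length w \<le> n \<Longrightarrow> code d w < M"
  using code_less_iff[of w d "Suc n"] M by (auto simp: subset_iff in_lists_conv_set)

lemma local_action_append:
  assumes "set w \<subseteq> letters d" "set w' \<subseteq> letters d" "f (code d w) = f (code d w')"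
  shows "set u \<subseteq> letters d \<Longrightarrow> length u + length w \<le> n \<Longrightarrow> length u + length w' \<le> n \<Longrightarrow>
    f (code d (u @ w)) = f (code d (u @ w'))"
proof (induction u)
  case (Cons l u)
  show ?case unfolding append_Cons code.simps
    by (rule local_action_cons[OF act])
      (use Cons assms short_code[of "u @ w"] short_code[of "u @ w'"] short_code[of "l # u @ w"]
        short_code[of "l # u @ w'"] in auto)
qed (use assms in simp)

lemma length_foldr: "length (foldr cons_red u v) \<le> length u + length v"
proof (induction u)
  case (Cons l u)
  have "length (cons_red l w) \<le> Suc (length w)" for w by (cases w) auto
  then show ?case using Cons le_trans by fastforce
qed simp

lemma local_action_reduce:
  assumes "set v \<subseteq> letters d"
  shows "set u \<subseteq> letters d \<Longrightarrow> length u + length v \<le> n \<Longrightarrow> f (code d (foldr cons_red u v)) = f (code d (u @ v))"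
proof (induction u)
  case (Cons l u)
  let ?w = "foldr cons_red u v"
  have w: "set ?w \<subseteq> letters d" using set_foldr[of u v] Cons.prems assms by auto
  have lw: "length ?w \<le> length u + length v" by (rule length_foldr)
  have IH: "f (code d ?w) = f (code d (u @ v))" using Cons by simp
  have "f (code d (l # ?w)) = f (code d (l # u @ v))"
    using local_action_append[OF w _ IH, of "[l]"] Cons.prems assms lw by auto
  moreover have "f (code d (cons_red l ?w)) = f (code d (l # ?w))"
  proof (cases ?w)
    case (Cons m x)
    show ?thesis
    proof (cases "m = linv l")
      case True
      have s: "set x \<subseteq> letters d" "length x + 2 \<le> n" "l \<in> letters d"
        using w lw Cons Cons.prems \<open>set (l # u) \<subseteq> letters d\<close> \<open>length (l # u) + length v \<le> n\<close> by auto
      have "f (code d (l # linv l # x)) = f (code d x)"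
        unfolding code.simps
        by (rule local_action_cancel[OF act s(3)])
          (use s short_code[of x] short_code[of "l # linv l # x"] in auto)
      then show ?thesis using Cons True by simp
    qed (simp add: Cons)
  qed simp
  ultimately show ?case by simp
qed simp

lemma ker_iff: "set w \<subseteq> letters d \<Longrightarrow> length w \<le> n \<Longrightarrow> code d w \<in> ker M f \<longleftrightarrow> f (code d w) = f (code d [])"
  using short_code by (simp add: ker_def)

lemma ker_reduce:
  assumes "set w \<subseteq> letters d" "length w \<le> n"
  shows "code d (reduce w) \<in> ker M f \<longleftrightarrow> code d w \<in> ker M f"
proof -
  have "set (reduce w) \<subseteq> letters d" "length (reduce w) \<le> n"
    using set_foldr[of w "[]"] length_foldr[of w "[]"] assms by auto
  then show ?thesis using local_action_reduce[of "[]" w] assms by (simp add: ker_iff)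
qed

lemma ker_append:
  assumes "set u \<subseteq> letters d" "set v \<subseteq> letters d" "length u + length v \<le> n"
    and "code d u \<in> ker M f" "code d v \<in> ker M f"
  shows "code d (u @ v) \<in> ker M f"
proof -
  have "f (code d (u @ v)) = f (code d (u @ []))"
    by (rule local_action_append) (use assms in \<open>auto simp: ker_def\<close>)
  then show ?thesis using assms ker_iff[of "u @ v"] by (auto simp: ker_def)
qed

lemma ker_inv_word:
  assumes "set u \<subseteq> letters d" "reduced u" "2 * length u \<le> n" "code d u \<in> ker M f"
  shows "code d (inv_word u) \<in> ker M f"
proof -
  have s: "set (inv_word u) \<subseteq> letters d" using assms by simp
  have "f (code d (inv_word u @ u)) = f (code d (inv_word u @ []))"
    by (rule local_action_append) (use assms s in \<open>auto simp: ker_def\<close>)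
  moreover have "f (code d (foldr cons_red (inv_word u) u)) = f (code d (inv_word u @ u))"
    by (rule local_action_reduce) (use assms s in auto)
  moreover have "foldr cons_red (inv_word u) u = []" unfolding inv_word_def by (rule foldr_inverse[OF assms(2)])
  ultimately show ?thesis using ker_iff[OF s] assms(3) by simp
qed

text \<open>The words fixing the neighbour of the root in direction \<open>l\<close> form a conjugate of the words
  fixing the root.\<close>

lemma ker_conj:
  assumes w: "set w \<subseteq> letters d" and l: "l \<in> letters d" and "length w + 3 \<le> n"
  shows "code d (linv l # w @ [l]) \<in> ker M f \<longleftrightarrow> f (code d (w @ [l])) = f (code d [l])"
proof -
  have s: "set (linv l # w @ [l]) \<subseteq> letters d" "set (l # linv l # w @ [l]) \<subseteq> letters d"
    "set [linv l] \<subseteq> letters d" "set [l] \<subseteq> letters d" "set (w @ [l]) \<subseteq> letters d"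
    using w l by auto
  have c1: "f (code d (l # linv l # w @ [l])) = f (code d (w @ [l]))"
    unfolding code.simps by (rule local_action_cancel[OF act l]) (use assms s short_code[OF s(5)] short_code[OF s(2)] in auto)
  have c2: "f (code d (linv l # l # [])) = f (code d [])"
    using local_action_cancel[OF act, of "linv l" 0] l short_code[of "[]"] short_code[of "[linv l, l]"] assms(3)
    by simp
  have "code d (linv l # w @ [l]) \<in> ker M f \<longleftrightarrow> f (code d (linv l # w @ [l])) = f (code d [])"
    by (rule ker_iff) (use s assms in auto)
  also have "\<dots> \<longleftrightarrow> f (code d (w @ [l])) = f (code d [l])"
  proof
    assume "f (code d (linv l # w @ [l])) = f (code d [])"
    then have "f (code d ([l] @ linv l # w @ [l])) = f (code d ([l] @ []))"
      by (intro local_action_append) (use s assms in auto)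
    then show "f (code d (w @ [l])) = f (code d [l])" using c1 by simp
  next
    assume "f (code d (w @ [l])) = f (code d [l])"
    then have "f (code d ([linv l] @ w @ [l])) = f (code d ([linv l] @ [l]))"
      by (intro local_action_append) (use s assms in auto)
    then show "f (code d (linv l # w @ [l])) = f (code d [])" using c2 by simp
  qed
  finally show ?thesis .
qed

end

section \<open>Borel sets of a countable power set\<close>

definition member_sets :: "'a set \<Rightarrow> 'a set set set" where
  "member_sets A = (\<lambda>w. {H \<in> Pow A. w \<in> H}) ` A"

text \<open>For a countable base set there are only countably many cylinders, so every open set is a
  countable union of them.\<close>

lemma sigma_sets_powerset_topology:
  assumes "countable A"
  shows "sigma_sets (Pow A) {U. openin (powerset_topology A) U} = sigma_sets (Pow A) (member_sets A)"
proof
  let ?f = "\<lambda>S. \<lambda>x\<in>A. x \<in> S"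
  let ?T = "product_topology (\<lambda>_. discrete_topology (UNIV :: bool set)) A"
  have op: "openin (powerset_topology A) U \<longleftrightarrow> (\<exists>V. openin ?T V \<and> U = ?f -` V \<inter> Pow A)" for U
    unfolding powerset_topology_def openin_pullback_topology ..
  show "sigma_sets (Pow A) (member_sets A) \<subseteq> sigma_sets (Pow A) {U. openin (powerset_topology A) U}"
  proof (rule sigma_sets_mono')
    show "member_sets A \<subseteq> {U. openin (powerset_topology A) U}"
    proof
      fix U assume "U \<in> member_sets A"
      then obtain w where w: "w \<in> A" "U = {H \<in> Pow A. w \<in> H}" by (auto simp: member_sets_def)
      let ?V = "PiE A (\<lambda>i. if i = w then {True} else UNIV)"
      have "openin ?T ?V"
      proof (rule product_topology_basis)
        show "finite {i. (if i = w then {True} else UNIV) \<noteq> topspace (discrete_topology UNIV)}"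
          by (rule finite_subset[of _ "{w}"]) auto
      qed auto
      moreover have "U = ?f -` ?V \<inter> Pow A" unfolding w(2) using w(1) by (auto simp: PiE_iff split: if_splits)
      ultimately show "U \<in> {U. openin (powerset_topology A) U}" unfolding mem_Collect_eq op by blast
    qed
  qed
  define cyl where "cyl = (\<lambda>(F, s). {H \<in> Pow A. H \<inter> F = s})"
  define I where "I = {F. finite F \<and> F \<subseteq> A} \<times> {F. finite F \<and> F \<subseteq> A}"
  have cI: "countable I" unfolding I_def using assms
    by (intro countable_SIGMA) (auto intro: countable_Collect_finite_subset)
  interpret sigma_algebra "Pow A" "sigma_sets (Pow A) (member_sets A)"
    by (rule sigma_algebra_sigma_sets) (auto simp: member_sets_def)
  have mem: "{H \<in> Pow A. w \<in> H} \<in> sigma_sets (Pow A) (member_sets A)" if "w \<in> A" for w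
    using that by (intro sigma_sets.Basic) (auto simp: member_sets_def)
  have mem': "{H \<in> Pow A. w \<in> H \<longleftrightarrow> w \<in> s} \<in> sigma_sets (Pow A) (member_sets A)" if "w \<in> A" for w s
  proof (cases "w \<in> s")
    case False
    then have "{H \<in> Pow A. w \<in> H \<longleftrightarrow> w \<in> s} = Pow A - {H \<in> Pow A. w \<in> H}" by auto
    then show ?thesis using mem[OF that] compl_sets by simp
  qed (use mem[OF that] in simp)
  have cyl_in: "cyl i \<in> sigma_sets (Pow A) (member_sets A)" if i_in: "i \<in> I" for i
  proof -
    obtain F s where i: "i = (F, s)" "finite F" "F \<subseteq> A" using i_in by (auto simp: I_def)
    show ?thesis
    proof (cases "s \<subseteq> F")
      case True
      have "finite G \<Longrightarrow> G \<subseteq> A \<Longrightarrow> {H \<in> Pow A. \<forall>w\<in>G. w \<in> H \<longleftrightarrow> w \<in> s} \<in> sigma_sets (Pow A) (member_sets A)" for G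
      proof (induction G rule: finite_induct)
        case (insert w G)
        have "{H \<in> Pow A. \<forall>w\<in>insert w G. w \<in> H \<longleftrightarrow> w \<in> s} =
            {H \<in> Pow A. w \<in> H \<longleftrightarrow> w \<in> s} \<inter> {H \<in> Pow A. \<forall>w\<in>G. w \<in> H \<longleftrightarrow> w \<in> s}" by auto
        then show ?case using insert mem'[of w s] Int by auto
      qed (use top in \<open>simp add: Pow_def\<close>)
      moreover have "cyl i = {H \<in> Pow A. \<forall>w\<in>F. w \<in> H \<longleftrightarrow> w \<in> s}"
        unfolding i cyl_def using True by auto
      ultimately show ?thesis using i by simp
    next
      case False
      then have "cyl i = {}" unfolding i cyl_def by auto
      then show ?thesis by simp
    qed
  qed
  show "sigma_sets (Pow A) {U. openin (powerset_topology A) U} \<subseteq> sigma_sets (Pow A) (member_sets A)"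
  proof (rule sigma_sets_mono, rule subsetI)
    fix U assume "U \<in> {U. openin (powerset_topology A) U}"
    then obtain V where V: "openin ?T V" "U = ?f -` V \<inter> Pow A" using op by auto
    define I' where "I' = {i \<in> I. cyl i \<subseteq> U}"
    have "U \<subseteq> (\<Union>i\<in>I'. cyl i)"
    proof
      fix H assume H: "H \<in> U"
      then have "?f H \<in> V" using V by auto
      then obtain Y where Y: "finite {i. Y i \<noteq> topspace (discrete_topology (UNIV :: bool set))}"
        "?f H \<in> PiE A Y" "PiE A Y \<subseteq> V"
        using product_topology_open_contains_basis[OF V(1)] by blast
      define F where "F = {i \<in> A. Y i \<noteq> UNIV}"
      have F: "finite F" "F \<subseteq> A" using Y(1) by (auto simp: F_def elim: rev_finite_subset)
      have "cyl (F, H \<inter> F) \<subseteq> U"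
      proof
        fix K assume "K \<in> cyl (F, H \<inter> F)"
        then have K: "K \<subseteq> A" "K \<inter> F = H \<inter> F" by (auto simp: cyl_def)
        have "?f K \<in> PiE A Y"
        proof (rule PiE_I)
          fix x assume x: "x \<in> A"
          show "?f K x \<in> Y x"
          proof (cases "x \<in> F")
            case True
            then have eq: "?f K x = ?f H x" using K x by auto
            have "?f H x \<in> Y x" using Y(2) x by (rule PiE_mem)
            then show ?thesis unfolding eq .
          next
            case False
            then show ?thesis using x by (simp add: F_def)
          qed
        qed simp
        then have "?f K \<in> V" using Y(3) by blast
        then show "K \<in> U" unfolding V(2) using K(1) by blast
      qed
      moreover have "(F, H \<inter> F) \<in> I" using F by (auto simp: I_def)
      moreover have "H \<in> cyl (F, H \<inter> F)" using H V(2) by (auto simp: cyl_def)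
      ultimately show "H \<in> (\<Union>i\<in>I'. cyl i)" unfolding I'_def by blast
    qed
    then have "U = (\<Union>i\<in>I'. cyl i)" by (auto simp: I'_def)
    moreover have "(\<Union>i\<in>I'. cyl i) \<in> sigma_sets (Pow A) (member_sets A)"
    proof (rule countable_UN')
      show "countable I'" using cI by (rule countable_subset[rotated]) (auto simp: I'_def)
    qed (use cyl_in in \<open>auto simp: I'_def\<close>)
    ultimately show "U \<in> sigma_sets (Pow A) (member_sets A)" by simp
  qed
qed

section \<open>Limits of almost invariant weights\<close>

definition type_count :: "nat \<Rightarrow> nat \<Rightarrow> nat" where
  "type_count d m = table_size d m ^ table_size d m"

definition resolution :: "nat \<Rightarrow> nat \<Rightarrow> nat" where
  "resolution d m = type_count d m * m"

definition local_actions :: "nat \<Rightarrow> nat \<Rightarrow> nat set" where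
  "local_actions d m = {j. j < type_count d m \<and> local_action d (table_size d m) (digit (table_size d m) j)}"

definition weight :: "nat \<Rightarrow> nat \<Rightarrow> nat \<Rightarrow> nat \<Rightarrow> real" where
  "weight d m P j = real (digit (Suc (resolution d m)) P j) / real (resolution d m)"

abbreviation fixed_codes :: "nat \<Rightarrow> nat \<Rightarrow> nat \<Rightarrow> nat set" where
  "fixed_codes d m j \<equiv> ker (table_size d m) (digit (table_size d m) j)"

lemma finite_local_actions: "finite (local_actions d m)"
  unfolding local_actions_def by auto

lemma weighted_sum_of_bool:
  "real (\<Sum>j<type_count d m. digit (Suc (resolution d m)) P j *
      of_bool (local_action d (table_size d m) (digit (table_size d m) j) \<and> Q j)) / real (resolution d m) =
    (\<Sum>j\<in>local_actions d m. weight d m P j * of_bool (Q j))"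
proof -
  let ?l = "\<lambda>j. local_action d (table_size d m) (digit (table_size d m) j)"
  have "local_actions d m = {j \<in> {..<type_count d m}. ?l j}" by (auto simp: local_actions_def)
  then have "(\<Sum>j\<in>local_actions d m. weight d m P j * of_bool (Q j)) =
      (\<Sum>j<type_count d m. if ?l j then weight d m P j * of_bool (Q j) else 0)"
    by (simp only:) (rule sum.inter_filter, simp)
  also have "\<dots> = (\<Sum>j<type_count d m. weight d m P j * of_bool (?l j \<and> Q j))"
    by (intro sum.cong) auto
  finally show ?thesis
    by (simp only: weight_def of_nat_sum of_nat_mult of_nat_of_bool sum_divide_distrib times_divide_eq_left)
qed

lemma table_size_ge: "d \<ge> 1 \<Longrightarrow> m < table_size d m"
proof -
  assume "d \<ge> 1"
  then have "m \<le> (2 * d) * (2 * d) * m" by simp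
  then show "m < table_size d m" unfolding table_size_def by linarith
qed

text \<open>The random set \<open>S\<close> is the limit in distribution of the sets of fixed codes, with local
  actions chosen at random according to the almost invariant weights \<open>P k\<close> at level \<open>lv k\<close>. The levels
  tend to infinity, so finite statements about local actions pass to \<open>S\<close>.\<close>

locale limit_set =
  fixes d :: nat and lv :: "nat \<Rightarrow> nat" and P :: "nat \<Rightarrow> nat" and S :: "real \<Rightarrow> nat set"
  assumes d: "d \<ge> 1" and lv_pos: "\<And>k. 0 < lv k" and lv: "filterlim lv at_top sequentially"
    and almost_inv: "\<And>k. almost_invariant d (lv k) (table_size d (lv k)) (type_count d (lv k)) (resolution d (lv k)) (P k)"
    and lim: "\<And>\<Phi>. local_event \<Phi> \<Longrightarrow>
     {\<omega> \<in> space unit_measure. \<Phi> (S \<omega>)} \<in> sets unit_measure \<and>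
     (\<lambda>k. \<Sum>j\<in>local_actions d (lv k). weight d (lv k) (P k) j * of_bool (\<Phi> (fixed_codes d (lv k) j)))
        \<longlonglongrightarrow> measure unit_measure {\<omega> \<in> space unit_measure. \<Phi> (S \<omega>)}"

lemma total_weight_bounds:
  assumes "almost_invariant d m (table_size d m) (type_count d m) (resolution d m) P" "d \<ge> 1" "0 < m"
  shows "sum (weight d m P) (local_actions d m) \<le> 1" "1 - 1 / real m \<le> sum (weight d m P) (local_actions d m)"
proof -
  have T: "0 < type_count d m" using table_size_ge[OF assms(2), of m] by (simp add: type_count_def)
  then have K: "0 < resolution d m" using assms(3) by (simp add: resolution_def)
  let ?t = "total_weight d (table_size d m) (type_count d m) (resolution d m) P"
  have t: "?t \<le> resolution d m" "resolution d m \<le> ?t + type_count d m"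
    using assms(1) unfolding almost_invariant_def by auto
  have e: "sum (weight d m P) (local_actions d m) = real ?t / real (resolution d m)"
    using weighted_sum_of_bool[of d m P "\<lambda>_. True"] by (simp add: total_weight_def)
  show "sum (weight d m P) (local_actions d m) \<le> 1" unfolding e using t(1) K by simp
  have "real (resolution d m) \<le> real ?t + real (type_count d m)" using t(2) by linarith
  then have "1 \<le> real ?t / real (resolution d m) + real (type_count d m) / real (resolution d m)"
    using K by (simp add: field_simps)
  moreover have "real (type_count d m) / real (resolution d m) = 1 / real m"
    using T by (simp add: resolution_def)
  ultimately show "1 - 1 / real m \<le> sum (weight d m P) (local_actions d m)" unfolding e by linarith
qed

context limit_set
begin

abbreviation E :: "nat \<Rightarrow> (nat set \<Rightarrow> bool) \<Rightarrow> real" where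
  "E k \<Phi> \<equiv> \<Sum>j\<in>local_actions d (lv k). weight d (lv k) (P k) j * of_bool (\<Phi> (fixed_codes d (lv k) j))"

abbreviation Pr :: "(nat set \<Rightarrow> bool) \<Rightarrow> real" where
  "Pr \<Phi> \<equiv> measure unit_measure {\<omega> \<in> space unit_measure. \<Phi> (S \<omega>)}"

lemma event: "local_event \<Phi> \<Longrightarrow> {\<omega> \<in> space unit_measure. \<Phi> (S \<omega>)} \<in> sets unit_measure"
  and limit: "local_event \<Phi> \<Longrightarrow> (\<lambda>k. E k \<Phi>) \<longlonglongrightarrow> Pr \<Phi>"
  using lim[of \<Phi>] by blast+

lemma inverse_lv: "(\<lambda>k. 1 / real (lv k)) \<longlonglongrightarrow> 0"
proof -
  have "filterlim (\<lambda>k. real (lv k)) at_top sequentially"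
    using filterlim_compose[OF filterlim_real_sequentially lv] .
  from tendsto_inverse_0_at_top[OF this] show ?thesis by (simp add: inverse_eq_divide)
qed

lemma total_limit: "(\<lambda>k. sum (weight d (lv k) (P k)) (local_actions d (lv k))) \<longlonglongrightarrow> 1"
proof (rule tendsto_sandwich)
  show "(\<lambda>k. 1 - 1 / real (lv k)) \<longlonglongrightarrow> 1"
    using tendsto_diff[OF tendsto_const inverse_lv, of 1] by simp
qed (use total_weight_bounds[OF almost_inv d lv_pos] in auto)

text \<open>The approximating random sets satisfy the event with all their weight, which tends to
  \<open>1\<close>.\<close>

lemma almost_surely:
  assumes "finite F" "\<And>A B. (\<And>c. c \<in> F \<Longrightarrow> c \<in> A \<longleftrightarrow> c \<in> B) \<Longrightarrow> \<Phi> A = \<Phi> B"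
    and all: "\<And>k j. N \<le> lv k \<Longrightarrow> j \<in> local_actions d (lv k) \<Longrightarrow> \<Phi> (fixed_codes d (lv k) j)"
  shows "AE \<omega> in unit_measure. \<Phi> (S \<omega>)"
proof -
  have \<Phi>: "local_event \<Phi>" using assms(1,2) by (rule local_eventI)
  have "eventually (\<lambda>k. N \<le> lv k) sequentially" using lv by (simp add: filterlim_at_top)
  then have "eventually (\<lambda>k. sum (weight d (lv k) (P k)) (local_actions d (lv k)) = E k \<Phi>) sequentially"
    by eventually_elim (auto intro!: sum.cong simp: all)
  from Lim_transform_eventually[OF total_limit this] have "Pr \<Phi> = 1"
    using limit[OF \<Phi>] LIMSEQ_unique by blast
  then show ?thesis using unit.prob_Collect_eq_1[OF event[OF \<Phi>]] by simp
qed

lemma eventually_short: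
  "N \<ge> words_below d (Suc n) \<Longrightarrow> N \<le> lv k \<Longrightarrow> words_below d (Suc n) \<le> table_size d (lv k)"
  using table_size_ge[OF d, of "lv k"] by linarith

lemma local_actionsD: "j \<in> local_actions d m \<Longrightarrow> local_action d (table_size d m) (digit (table_size d m) j)"
  by (simp add: local_actions_def)

lemma AE_empty_word: "AE \<omega> in unit_measure. 0 \<in> S \<omega>"
  by (rule almost_surely[where F = "{0}" and N = 0])
    (simp, simp, use table_size_ge[OF d, THEN le_less_trans[OF le0]] in \<open>simp add: ker_def\<close>)

lemma AE_reduce:
  assumes "set w \<subseteq> letters d"
  shows "AE \<omega> in unit_measure. code d (reduce w) \<in> S \<omega> \<longleftrightarrow> code d w \<in> S \<omega>"
  by (rule almost_surely[where F = "{code d (reduce w), code d w}" and N = "words_below d (Suc (length w))"])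
    (simp, simp, rule ker_reduce[OF local_actionsD eventually_short assms], auto)

lemma AE_append:
  assumes "set u \<subseteq> letters d" "set v \<subseteq> letters d"
  shows "AE \<omega> in unit_measure. code d u \<in> S \<omega> \<longrightarrow> code d v \<in> S \<omega> \<longrightarrow> code d (u @ v) \<in> S \<omega>"
  by (rule almost_surely[where F = "{code d u, code d v, code d (u @ v)}"
        and N = "words_below d (Suc (length u + length v))"])
    (simp, simp, intro impI, rule ker_append[OF local_actionsD eventually_short assms], auto)

lemma AE_inv_word:
  assumes "set u \<subseteq> letters d" "reduced u"
  shows "AE \<omega> in unit_measure. code d u \<in> S \<omega> \<longrightarrow> code d (inv_word u) \<in> S \<omega>"
  by (rule almost_surely[where F = "{code d u, code d (inv_word u)}"
        and N = "words_below d (Suc (2 * length u))"])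
    (simp, simp, intro impI, rule ker_inv_word[OF local_actionsD eventually_short assms], auto)

text \<open>The set seen from the neighbour of the root in direction \<open>l\<close>.\<close>

definition conj_shift :: "letter \<Rightarrow> nat set \<Rightarrow> nat set" where
  "conj_shift l A = {c. code d (reduce (linv l # word_of d c @ [l])) \<in> A}"

lemma pattern_iff_agrees:
  assumes "\<And>c. c < length bs \<Longrightarrow> digit 2 \<sigma> c = 1 \<longleftrightarrow> rev bs ! c"
    and "\<And>c. c < length bs \<Longrightarrow> c \<in> A \<longleftrightarrow> f c = f 0"
  shows "pattern (length bs) \<sigma> f \<longleftrightarrow> agrees bs A"
proof -
  have "agrees bs A \<longleftrightarrow> (\<forall>c<length bs. rev bs ! c \<longleftrightarrow> c \<in> A)" for bs
    by (induction bs) (auto simp: less_Suc_eq nth_append)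
  then show ?thesis unfolding pattern_def using assms by simp
qed

text \<open>At level \<open>m\<close> the probabilities of a cylinder seen from the root and from its neighbour differ
  by at most \<open>T / K = 1 / m\<close>.\<close>

lemma agrees_invariant:
  assumes l: "l \<in> letters d"
  shows "Pr (agrees bs) = Pr (\<lambda>A. agrees bs (conj_shift l A))"
    and "local_event (\<lambda>A. agrees bs (conj_shift l A))"
proof -
  define q where "q = length bs"
  define F where "F = (\<lambda>c. code d (reduce (linv l # word_of d c @ [l]))) ` {..<q}"
  show le: "local_event (\<lambda>A. agrees bs (conj_shift l A))"
    by (rule local_eventI[of F], simp add: F_def, rule agrees_cong) (simp add: conj_shift_def F_def q_def)
  obtain \<sigma> where \<sigma>: "\<sigma> < 2 ^ q" "\<And>c. c < q \<Longrightarrow> digit 2 \<sigma> c = 1 \<longleftrightarrow> rev bs ! c"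
    using bits_exist[of q "\<lambda>c. rev bs ! c"] by blast
  let ?pw = "\<lambda>k. real (pattern_weight d (table_size d (lv k)) (type_count d (lv k)) (resolution d (lv k)) (P k) q \<sigma>)
      / real (resolution d (lv k))"
  let ?sw = "\<lambda>k. real (shifted_weight d (table_size d (lv k)) (type_count d (lv k)) (resolution d (lv k)) (P k) (letter_code d l) q \<sigma>)
      / real (resolution d (lv k))"
  have pw: "?pw k = E k (agrees bs)" if "q \<le> lv k" for k
    unfolding pattern_weight_def weighted_sum_of_bool
  proof (intro sum.cong refl, goal_cases)
    case (1 j)
    have "pattern q \<sigma> (digit (table_size d (lv k)) j) \<longleftrightarrow> agrees bs (fixed_codes d (lv k) j)"
      unfolding q_def by (rule pattern_iff_agrees)
        (use \<sigma>(2) that table_size_ge[OF d, of "lv k"] in \<open>auto simp: q_def ker_def\<close>)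
    then show ?case by simp
  qed
  \<comment> \<open>The words \<open>w\<close> with code below \<open>q\<close> have length at most \<open>q\<close>, and three more letters are needed
    to conjugate \<open>w\<close> and to cancel again.\<close>
  define m0 where "m0 = Suc q + words_below d (Suc (q + 3))"
  have sw: "?sw k = E k (\<lambda>A. agrees bs (conj_shift l A))" if k: "m0 \<le> lv k" for k
    unfolding shifted_weight_def weighted_sum_of_bool
  proof (intro sum.cong refl, goal_cases)
    case (1 j)
    let ?f = "digit (table_size d (lv k)) j"
    have M: "words_below d (Suc (q + 3)) \<le> table_size d (lv k)"
      by (rule eventually_short[OF _ k]) (simp add: m0_def)
    have "c \<in> conj_shift l (fixed_codes d (lv k) j) \<longleftrightarrow>
        ?f (snoc_code d c (letter_code d l)) = ?f (snoc_code d 0 (letter_code d l))" if c: "c < q" for c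
    proof -
      let ?w = "word_of d c"
      have w: "set ?w \<subseteq> letters d" by (rule word_of_set[OF d])
      have "length ?w \<le> c"
        using words_below_ge[OF d, of "length ?w"] code_bounds[OF word_of(1)[OF d], of c] word_of(2)[OF d, of c]
        by linarith
      then have lw: "length ?w + 3 \<le> q + 3" using c by simp
      have s: "set (linv l # ?w @ [l]) \<subseteq> letters d" "length (linv l # ?w @ [l]) \<le> q + 3"
        using w l lw by auto
      have e: "snoc_code d c (letter_code d l) = code d (?w @ [l])" "snoc_code d 0 (letter_code d l) = code d [l]"
        using snoc_code[OF word_of(1)[OF d] d, of c l] word_of(2)[OF d] snoc_code[of "[]" d l] d by simp_all
      show ?thesis unfolding conj_shift_def mem_Collect_eq e
          ker_reduce[OF local_actionsD[OF 1] M s] ker_conj[OF local_actionsD[OF 1] M w l lw] ..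
    qed
    then have "pattern q \<sigma> (\<lambda>w. ?f (snoc_code d w (letter_code d l))) \<longleftrightarrow>
        agrees bs (conj_shift l (fixed_codes d (lv k) j))"
      unfolding q_def by (intro pattern_iff_agrees) (use \<sigma>(2) in \<open>auto simp: q_def\<close>)
    then show ?case by simp
  qed
  have close: "\<bar>?pw k - ?sw k\<bar> \<le> 1 / real (lv k)" if "q \<le> lv k" for k
  proof -
    have T: "0 < type_count d (lv k)" using table_size_ge[OF d, of "lv k"] by (simp add: type_count_def)
    then have K: "0 < resolution d (lv k)" using lv_pos by (simp add: resolution_def)
    have "\<bar>real a / real K - real b / real K\<bar> \<le> real T / real K" if "a \<le> b + T" "b \<le> a + T" "0 < K" for a b T K :: nat
    proof -
      have "\<bar>real a - real b\<bar> \<le> real T" using that by linarith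
      then have "\<bar>real a - real b\<bar> / real K \<le> real T / real K" using that by (intro divide_right_mono) auto
      then show ?thesis by (simp add: diff_divide_distrib[symmetric])
    qed
    moreover have "real (type_count d (lv k)) / real (resolution d (lv k)) = 1 / real (lv k)"
      using T by (simp add: resolution_def)
    ultimately show ?thesis
      using almost_inv[of k] K \<open>q \<le> lv k\<close> \<sigma>(1) letter_code_less[OF l] unfolding almost_invariant_def
      by (metis less_Suc_eq_le)
  qed
  have "eventually (\<lambda>k. m0 \<le> lv k) sequentially" using lv by (simp add: filterlim_at_top)
  then have "eventually (\<lambda>k. \<bar>E k (agrees bs) - E k (\<lambda>A. agrees bs (conj_shift l A))\<bar> \<le> 1 / real (lv k)) sequentially"
  proof eventually_elim
    case (elim k)
    then have "q \<le> lv k" by (simp add: m0_def)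
    then show ?case using close[of k] pw[of k] sw[OF elim] by simp
  qed
  then have "(\<lambda>k. E k (agrees bs) - E k (\<lambda>A. agrees bs (conj_shift l A))) \<longlonglongrightarrow> 0"
    by (intro Lim_null_comparison[OF _ inverse_lv]) simp
  moreover from tendsto_diff[OF limit[OF local_event_agrees] limit[OF le]]
  have "(\<lambda>k. E k (agrees bs) - E k (\<lambda>A. agrees bs (conj_shift l A)))
      \<longlonglongrightarrow> Pr (agrees bs) - Pr (\<lambda>A. agrees bs (conj_shift l A))" .
  ultimately show "Pr (agrees bs) = Pr (\<lambda>A. agrees bs (conj_shift l A))"
    using LIMSEQ_unique by fastforce
qed

lemma event_invariant:
  assumes l: "l \<in> letters d" and \<Phi>: "local_event \<Phi>"
  shows "Pr \<Phi> = Pr (\<lambda>A. \<Phi> (conj_shift l A))"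
proof -
  obtain q L where L: "finite L" "\<forall>bs\<in>L. length bs = q" "\<forall>A. \<Phi> A \<longleftrightarrow> bits q A \<in> L"
    using local_event_bits[OF \<Phi>] by blast
  show ?thesis
    using prob_local_event(2)[OF L, of S] prob_local_event(2)[OF L, of "\<lambda>\<omega>. conj_shift l (S \<omega>)"]
      event[OF local_event_agrees] event[OF agrees_invariant(2)[OF l]] agrees_invariant(1)[OF l] by simp
qed

end

section \<open>The limit is an invariant random subgroup\<close>

lemma free_group_simps:
  "x \<in> carrier (free_group d) \<longleftrightarrow> set x \<subseteq> letters d \<and> reduced x"
  "x \<otimes>\<^bsub>free_group d\<^esub> y = foldr cons_red x y" "\<one>\<^bsub>free_group d\<^esub> = []"
  by (auto simp: free_group_def)

lemma inv_free_group:
  assumes "x \<in> carrier (free_group d)"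
  shows "inv\<^bsub>free_group d\<^esub> x = inv_word x"
proof -
  interpret group "free_group d" by (rule group_free_group)
  have x: "set x \<subseteq> letters d" "reduced x" using assms by (auto simp: free_group_simps)
  show ?thesis
  proof (rule inv_equality)
    show "inv_word x \<otimes>\<^bsub>free_group d\<^esub> x = \<one>\<^bsub>free_group d\<^esub>"
      unfolding inv_word_def free_group_simps by (rule foldr_inverse[OF x(2)])
    show "inv_word x \<in> carrier (free_group d)"
      using x reduced_inverse[OF x(2)] by (simp add: free_group_simps inv_word_def[symmetric])
  qed fact
qed

lemma mult_eq_reduce:
  assumes "v \<in> carrier (free_group d)"
  shows "u \<otimes>\<^bsub>free_group d\<^esub> v = reduce (u @ v)"
  using assms foldr_reduced[of v] by (simp add: free_group_simps)

lemma countable_carrier: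
  assumes "d \<ge> 1"
  shows "countable (carrier (free_group d))"
proof (rule countable_subset)
  show "carrier (free_group d) \<subseteq> range (word_of d)"
  proof
    fix w assume "w \<in> carrier (free_group d)"
    then have "w = word_of d (code d w)" by (intro word_of_code[symmetric]) (auto simp: free_group_simps)
    then show "w \<in> range (word_of d)" by blast
  qed
qed simp

lemma conj_set_subset:
  assumes "g \<in> carrier (free_group d)" "K \<subseteq> carrier (free_group d)"
  shows "conj_set d g K \<subseteq> carrier (free_group d)"
proof -
  interpret group "free_group d" by (rule group_free_group)
  show ?thesis using assms unfolding conj_set_def by auto
qed

lemma mem_conj_set:
  assumes g: "g \<in> carrier (free_group d)" and w: "w \<in> carrier (free_group d)" and K: "K \<subseteq> carrier (free_group d)"
  shows "w \<in> conj_set d g K \<longleftrightarrow> inv\<^bsub>free_group d\<^esub> g \<otimes>\<^bsub>free_group d\<^esub> w \<otimes>\<^bsub>free_group d\<^esub> g \<in> K"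
proof -
  interpret group "free_group d" by (rule group_free_group)
  have 1: "inv\<^bsub>free_group d\<^esub> g \<otimes>\<^bsub>free_group d\<^esub> (g \<otimes>\<^bsub>free_group d\<^esub> x \<otimes>\<^bsub>free_group d\<^esub> inv\<^bsub>free_group d\<^esub> g) \<otimes>\<^bsub>free_group d\<^esub> g = x" if "x \<in> carrier (free_group d)" for x
    using g that by (simp add: m_assoc[symmetric]) (simp add: m_assoc)
  have 2: "g \<otimes>\<^bsub>free_group d\<^esub> (inv\<^bsub>free_group d\<^esub> g \<otimes>\<^bsub>free_group d\<^esub> w \<otimes>\<^bsub>free_group d\<^esub> g) \<otimes>\<^bsub>free_group d\<^esub> inv\<^bsub>free_group d\<^esub> g = w"
    using g w by (simp add: m_assoc[symmetric]) (simp add: m_assoc)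
  show ?thesis
  proof
    assume "w \<in> conj_set d g K"
    then obtain x where "x \<in> K" "w = g \<otimes>\<^bsub>free_group d\<^esub> x \<otimes>\<^bsub>free_group d\<^esub> inv\<^bsub>free_group d\<^esub> g" by (auto simp: conj_set_def)
    then show "inv\<^bsub>free_group d\<^esub> g \<otimes>\<^bsub>free_group d\<^esub> w \<otimes>\<^bsub>free_group d\<^esub> g \<in> K" using 1[of x] K by auto
  next
    assume "inv\<^bsub>free_group d\<^esub> g \<otimes>\<^bsub>free_group d\<^esub> w \<otimes>\<^bsub>free_group d\<^esub> g \<in> K"
    then show "w \<in> conj_set d g K" unfolding conj_set_def using 2 by (metis (no_types, lifting) image_eqI)
  qed
qed

lemma conj_set_mult:
  assumes "g \<in> carrier (free_group d)" "h \<in> carrier (free_group d)" "K \<subseteq> carrier (free_group d)"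
  shows "conj_set d (g \<otimes>\<^bsub>free_group d\<^esub> h) K = conj_set d g (conj_set d h K)"
proof -
  interpret group "free_group d" by (rule group_free_group)
  have "g \<otimes>\<^bsub>free_group d\<^esub> h \<otimes>\<^bsub>free_group d\<^esub> x \<otimes>\<^bsub>free_group d\<^esub> inv\<^bsub>free_group d\<^esub> (g \<otimes>\<^bsub>free_group d\<^esub> h) = g \<otimes>\<^bsub>free_group d\<^esub> (h \<otimes>\<^bsub>free_group d\<^esub> x \<otimes>\<^bsub>free_group d\<^esub> inv\<^bsub>free_group d\<^esub> h) \<otimes>\<^bsub>free_group d\<^esub> inv\<^bsub>free_group d\<^esub> g" if "x \<in> K" for x
    using assms that by (auto simp: m_assoc inv_mult_group subset_iff)
  then show ?thesis unfolding conj_set_def image_image by (rule image_cong[OF refl])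
qed

lemma conj_set_one: "K \<subseteq> carrier (free_group d) \<Longrightarrow> conj_set d [] K = K"
proof -
  interpret group "free_group d" by (rule group_free_group)
  assume K: "K \<subseteq> carrier (free_group d)"
  have "\<one>\<^bsub>free_group d\<^esub> \<otimes>\<^bsub>free_group d\<^esub> x \<otimes>\<^bsub>free_group d\<^esub> inv\<^bsub>free_group d\<^esub> \<one>\<^bsub>free_group d\<^esub> = x" if "x \<in> K" for x using K that by auto
  then show ?thesis unfolding conj_set_def free_group_simps(3)[of d, symmetric] by simp
qed

text \<open>For a single letter, conjugation of subsets is \<open>conj_shift\<close> on codes.\<close>

lemma conj_letter:
  assumes "l \<in> letters d" "w \<in> carrier (free_group d)"
  shows "inv\<^bsub>free_group d\<^esub> [l] \<otimes>\<^bsub>free_group d\<^esub> w \<otimes>\<^bsub>free_group d\<^esub> [l] = reduce (linv l # w @ [l])"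
proof -
  interpret group "free_group d" by (rule group_free_group)
  have l: "[l] \<in> carrier (free_group d)" using assms(1) by (simp add: free_group_simps reduced_Cons)
  have "inv\<^bsub>free_group d\<^esub> [l] \<otimes>\<^bsub>free_group d\<^esub> w \<otimes>\<^bsub>free_group d\<^esub> [l] = inv\<^bsub>free_group d\<^esub> [l] \<otimes>\<^bsub>free_group d\<^esub> (w \<otimes>\<^bsub>free_group d\<^esub> [l])" using l assms(2) by (simp add: m_assoc)
  then show ?thesis using inv_free_group[OF l] by (simp add: free_group_simps)
qed

lemma subgroup_iff:
  assumes "K \<subseteq> carrier (free_group d)"
  shows "subgroup K (free_group d) \<longleftrightarrow> [] \<in> K \<and>
    (\<forall>u\<in>carrier (free_group d). \<forall>v\<in>carrier (free_group d). u \<in> K \<longrightarrow> v \<in> K \<longrightarrow> u \<otimes>\<^bsub>free_group d\<^esub> v \<in> K) \<and>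
    (\<forall>u\<in>carrier (free_group d). u \<in> K \<longrightarrow> inv\<^bsub>free_group d\<^esub> u \<in> K)"
  using assms unfolding subgroup_def free_group_simps(3) by blast

context limit_set
begin

abbreviation "carr \<equiv> carrier (free_group d)"

text \<open>Almost surely \<open>S \<omega>\<close> contains the code of a word iff it contains the code of its
  reduction, so nothing is lost by keeping the reduced words.\<close>

definition random_subgroup :: "real \<Rightarrow> word set" where
  "random_subgroup \<omega> = {w \<in> carr. code d w \<in> S \<omega>}"

definition subsets :: "word set measure" where
  "subsets = sigma (Pow carr) (member_sets carr)"

definition irs :: "word set measure" where
  "irs = distr unit_measure subsets random_subgroup"

lemma member_sets_Pow: "member_sets carr \<subseteq> Pow (Pow carr)"
  by (auto simp: member_sets_def)

lemma space_subsets: "space subsets = Pow carr" and sets_subsets: "sets subsets = sigma_sets (Pow carr) (member_sets carr)"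
  unfolding subsets_def using member_sets_Pow by auto

lemma space_irs: "space irs = Pow carr" and sets_irs: "sets irs = sets subsets"
  by (simp_all add: irs_def space_subsets)

lemma member_event: "w \<in> carr \<Longrightarrow> {K \<in> Pow carr. w \<in> K} \<in> sets subsets"
  unfolding sets_subsets by (rule sigma_sets.Basic) (auto simp: member_sets_def)

lemma measurable_subsetsI:
  assumes "\<And>x. x \<in> space M \<Longrightarrow> f x \<subseteq> carr" "\<And>w. w \<in> carr \<Longrightarrow> {x \<in> space M. w \<in> f x} \<in> sets M"
  shows "f \<in> measurable M subsets"
  unfolding subsets_def
proof (rule measurable_measure_of[OF member_sets_Pow])
  fix A assume "A \<in> member_sets carr"
  then obtain w where w: "w \<in> carr" "A = {K \<in> Pow carr. w \<in> K}" by (auto simp: member_sets_def)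
  then have "f -` A \<inter> space M = {x \<in> space M. w \<in> f x}" using assms(1) by auto
  then show "f -` A \<inter> space M \<in> sets M" using assms(2)[OF w(1)] by simp
qed (use assms(1) in auto)

lemma random_subgroup_event: "{\<omega> \<in> space unit_measure. c \<in> S \<omega>} \<in> sets unit_measure"
proof -
  have "local_event (\<lambda>A. c \<in> A)" by (rule local_eventI[of "{c}"]) auto
  then show ?thesis by (rule event)
qed

lemma random_subgroup_measurable: "random_subgroup \<in> measurable unit_measure subsets"
proof (rule measurable_subsetsI)
  fix w assume "w \<in> carr"
  then show "{\<omega> \<in> space unit_measure. w \<in> random_subgroup \<omega>} \<in> sets unit_measure"
    using random_subgroup_event[of "code d w"] by (simp add: random_subgroup_def)
qed (auto simp: random_subgroup_def)

sublocale irs: prob_space irs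
  unfolding irs_def by (rule unit.prob_space_distr[OF random_subgroup_measurable])

lemma subgroup_event: "{K \<in> space subsets. subgroup K (free_group d)} \<in> sets subsets"
proof -
  interpret group "free_group d" by (rule group_free_group)
  have c: "countable carr" by (rule countable_carrier[OF d])
  have e: "{K \<in> space subsets. subgroup K (free_group d)} = {K \<in> space subsets. [] \<in> K \<and>
    (\<forall>u\<in>carr. \<forall>v\<in>carr. u \<in> K \<longrightarrow> v \<in> K \<longrightarrow> u \<otimes>\<^bsub>free_group d\<^esub> v \<in> K) \<and>
    (\<forall>u\<in>carr. u \<in> K \<longrightarrow> inv\<^bsub>free_group d\<^esub> u \<in> K)}"
    using subgroup_iff by (auto simp: space_subsets)
  have mem: "{K \<in> space subsets. w \<in> K} \<in> sets subsets" if "w \<in> carr" for w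
    using member_event[OF that] by (simp add: space_subsets)
  have one: "[] \<in> carr" by (simp add: free_group_simps)
  have "{K \<in> space subsets. u \<in> K \<longrightarrow> v \<in> K \<longrightarrow> u \<otimes>\<^bsub>free_group d\<^esub> v \<in> K} \<in> sets subsets"
    if "u \<in> carr" "v \<in> carr" for u v
    by (intro sets.sets_Collect_imp mem that m_closed)
  then have "{K \<in> space subsets. \<forall>u\<in>carr. \<forall>v\<in>carr. u \<in> K \<longrightarrow> v \<in> K \<longrightarrow> u \<otimes>\<^bsub>free_group d\<^esub> v \<in> K} \<in> sets subsets"
    by (intro sets.sets_Collect_countable_All' c)
  moreover have "{K \<in> space subsets. u \<in> K \<longrightarrow> inv\<^bsub>free_group d\<^esub> u \<in> K} \<in> sets subsets"
    if "u \<in> carr" for u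
    by (intro sets.sets_Collect_imp mem that inv_closed)
  then have "{K \<in> space subsets. \<forall>u\<in>carr. u \<in> K \<longrightarrow> inv\<^bsub>free_group d\<^esub> u \<in> K} \<in> sets subsets"
    by (intro sets.sets_Collect_countable_All' c)
  ultimately show ?thesis unfolding e by (intro sets.sets_Collect_conj mem one)
qed

text \<open>There are countably many closure conditions, each of which holds almost surely because it
  holds in the kernels of all local actions of sufficiently large level.\<close>

lemma AE_random_subgroup: "AE \<omega> in unit_measure. subgroup (random_subgroup \<omega>) (free_group d)"
proof -
  interpret group "free_group d" by (rule group_free_group)
  have c: "countable carr" by (rule countable_carrier[OF d])
  have m: "AE \<omega> in unit_measure. \<forall>u\<in>carr. \<forall>v\<in>carr. u \<in> random_subgroup \<omega> \<longrightarrow> v \<in> random_subgroup \<omega> \<longrightarrow>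
      u \<otimes>\<^bsub>free_group d\<^esub> v \<in> random_subgroup \<omega>"
    unfolding AE_ball_countable[OF c]
  proof (intro ballI)
    fix u v assume uv: "u \<in> carr" "v \<in> carr"
    then have s: "set u \<subseteq> letters d" "set v \<subseteq> letters d" "set (u @ v) \<subseteq> letters d"
      by (auto simp: free_group_simps)
    show "AE \<omega> in unit_measure. u \<in> random_subgroup \<omega> \<longrightarrow> v \<in> random_subgroup \<omega> \<longrightarrow>
      u \<otimes>\<^bsub>free_group d\<^esub> v \<in> random_subgroup \<omega>"
      using AE_append[OF s(1,2)] AE_reduce[OF s(3)]
    proof eventually_elim
      case (elim \<omega>)
      have "reduce (u @ v) \<in> carr" using m_closed[OF uv] mult_eq_reduce[OF uv(2), of u] by simp
      then show ?case using elim unfolding random_subgroup_def mult_eq_reduce[OF uv(2)] by auto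
    qed
  qed
  have i: "AE \<omega> in unit_measure. \<forall>u\<in>carr. u \<in> random_subgroup \<omega> \<longrightarrow> inv\<^bsub>free_group d\<^esub> u \<in> random_subgroup \<omega>"
    unfolding AE_ball_countable[OF c]
  proof (intro ballI)
    fix u assume u: "u \<in> carr"
    then have s: "set u \<subseteq> letters d" "reduced u" by (auto simp: free_group_simps)
    show "AE \<omega> in unit_measure. u \<in> random_subgroup \<omega> \<longrightarrow> inv\<^bsub>free_group d\<^esub> u \<in> random_subgroup \<omega>"
      using AE_inv_word[OF s]
    proof eventually_elim
      case (elim \<omega>)
      have "inv_word u \<in> carr" using inv_closed[OF u] inv_free_group[OF u] by simp
      then show ?case using elim unfolding random_subgroup_def inv_free_group[OF u] by auto
    qed
  qed
  show ?thesis using m i AE_empty_word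
  proof eventually_elim
    case (elim \<omega>)
    have "[] \<in> random_subgroup \<omega>" using elim(3) by (simp add: random_subgroup_def free_group_simps)
    moreover have "random_subgroup \<omega> \<subseteq> carr" by (auto simp: random_subgroup_def)
    ultimately show ?case using elim(1,2) by (simp add: subgroup_iff)
  qed
qed

lemma AE_irs_subgroup: "AE K in irs. subgroup K (free_group d)"
  unfolding irs_def
  by (subst AE_distr_iff[OF random_subgroup_measurable subgroup_event]) (rule AE_random_subgroup)

lemma conj_set_measurable:
  assumes g: "g \<in> carr"
  shows "conj_set d g \<in> measurable irs irs"
proof -
  interpret group "free_group d" by (rule group_free_group)
  have "conj_set d g \<in> measurable irs subsets"
  proof (rule measurable_subsetsI)
    fix w assume w: "w \<in> carr"
    have "{K \<in> space irs. w \<in> conj_set d g K} =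
        {K \<in> Pow carr. inv\<^bsub>free_group d\<^esub> g \<otimes>\<^bsub>free_group d\<^esub> w \<otimes>\<^bsub>free_group d\<^esub> g \<in> K}"
      using mem_conj_set[OF g w] by (auto simp: space_irs)
    moreover have "inv\<^bsub>free_group d\<^esub> g \<otimes>\<^bsub>free_group d\<^esub> w \<otimes>\<^bsub>free_group d\<^esub> g \<in> carr"
      using g w by simp
    ultimately show "{K \<in> space irs. w \<in> conj_set d g K} \<in> sets irs"
      using member_event sets_irs by simp
  qed (use conj_set_subset[OF g] in \<open>auto simp: space_irs\<close>)
  then show ?thesis using measurable_cong_sets[OF refl sets_irs] by blast
qed

text \<open>The sets of subgroups that contain a given finite set form a generator stable under
  intersection, and they are local events, for which invariance is known.\<close>

lemma irs_letter_invariant: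
  assumes l: "l \<in> letters d"
  shows "distr irs irs (conj_set d [l]) = irs"
proof -
  have lc: "[l] \<in> carr" using l by (simp add: free_group_simps reduced_Cons)
  define \<E> where "\<E> = (\<lambda>F. {K \<in> Pow carr. F \<subseteq> K}) ` {F. finite F \<and> F \<subseteq> carr}"
  have in_sets: "{K \<in> Pow carr. F \<subseteq> K} \<in> sets subsets" if "finite F" "F \<subseteq> carr" for F
    using that
  proof (induction F rule: finite_induct)
    case empty
    then show ?case using sets.top[of subsets] by (simp add: space_subsets Pow_def)
  next
    case (insert w F)
    have "{K \<in> Pow carr. insert w F \<subseteq> K} = {K \<in> Pow carr. w \<in> K} \<inter> {K \<in> Pow carr. F \<subseteq> K}" by auto
    then show ?case using insert member_event[of w] by auto
  qed
  have gen: "sigma_sets (Pow carr) \<E> = sets subsets"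
  proof
    show "sigma_sets (Pow carr) \<E> \<subseteq> sets subsets"
      using in_sets sets.sigma_sets_subset[of \<E> subsets] by (auto simp: \<E>_def space_subsets)
    show "sets subsets \<subseteq> sigma_sets (Pow carr) \<E>"
      unfolding sets_subsets
    proof (rule sigma_sets_mono')
      show "member_sets carr \<subseteq> \<E>"
      proof
        fix A assume "A \<in> member_sets carr"
        then obtain w where "w \<in> carr" "A = {K \<in> Pow carr. w \<in> K}" by (auto simp: member_sets_def)
        then show "A \<in> \<E>" unfolding \<E>_def by (intro image_eqI[of _ _ "{w}"]) auto
      qed
    qed
  qed
  show ?thesis
  proof (rule measure_eqI_generator_eq[of \<E> "Pow carr" _ _ "\<lambda>_. Pow carr"])
    show "Int_stable \<E>"
    proof (rule Int_stableI)
      fix A B assume "A \<in> \<E>" "B \<in> \<E>"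
      then obtain F F' where F: "finite F" "F \<subseteq> carr" "A = {K \<in> Pow carr. F \<subseteq> K}"
        and F': "finite F'" "F' \<subseteq> carr" "B = {K \<in> Pow carr. F' \<subseteq> K}" by (auto simp: \<E>_def)
      have "A \<inter> B = {K \<in> Pow carr. F \<union> F' \<subseteq> K}" using F F' by auto
      then show "A \<inter> B \<in> \<E>" unfolding \<E>_def using F F' by (intro image_eqI[of _ _ "F \<union> F'"]) auto
    qed
    show "\<E> \<subseteq> Pow (Pow carr)" by (auto simp: \<E>_def)
    show "sets (distr irs irs (conj_set d [l])) = sigma_sets (Pow carr) \<E>" "sets irs = sigma_sets (Pow carr) \<E>"
      by (simp_all add: sets_irs gen)
    show "range (\<lambda>_. Pow carr) \<subseteq> \<E>" unfolding \<E>_def by (auto intro!: image_eqI[of _ _ "{}"])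
    show "emeasure (distr irs irs (conj_set d [l])) (Pow carr) \<noteq> \<infinity>" for i :: nat
      using emeasure_distr[OF conj_set_measurable[OF lc], of "Pow carr"] sets.top[of irs]
      by (simp add: space_irs)
    fix A assume "A \<in> \<E>"
    then obtain F where F: "finite F" "F \<subseteq> carr" "A = {K \<in> Pow carr. F \<subseteq> K}" by (auto simp: \<E>_def)
    have A: "A \<in> sets subsets" unfolding F(3) by (rule in_sets[OF F(1,2)])
    define \<Phi> where "\<Phi> B \<longleftrightarrow> (\<forall>w\<in>F. code d w \<in> B)" for B
    have q: "local_event \<Phi>"
      by (rule local_eventI[of "code d ` F"]) (use F(1) in \<open>auto simp: \<Phi>_def\<close>)
    have e1: "random_subgroup -` A \<inter> space unit_measure = {\<omega> \<in> space unit_measure. \<Phi> (S \<omega>)}"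
      using F(2) by (auto simp: F(3) random_subgroup_def \<Phi>_def)
    have wc: "word_of d (code d w) = w" if "w \<in> carr" for w
      using that by (intro word_of_code) (auto simp: free_group_simps)
    have mem: "F \<subseteq> conj_set d [l] (random_subgroup \<omega>) \<longleftrightarrow> \<Phi> (conj_shift l (S \<omega>))" for \<omega>
    proof -
      interpret group "free_group d" by (rule group_free_group)
      have "w \<in> conj_set d [l] (random_subgroup \<omega>) \<longleftrightarrow> code d w \<in> conj_shift l (S \<omega>)" if w: "w \<in> carr" for w
      proof -
        have "w \<in> conj_set d [l] (random_subgroup \<omega>) \<longleftrightarrow> reduce (linv l # w @ [l]) \<in> random_subgroup \<omega>"
          using mem_conj_set[OF lc w, of "random_subgroup \<omega>"] unfolding conj_letter[OF l w]
          by (auto simp: random_subgroup_def)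
        moreover have "reduce (linv l # w @ [l]) \<in> carr"
          unfolding conj_letter[OF l w, symmetric] using lc w by simp
        ultimately show ?thesis using wc[OF w] by (simp add: random_subgroup_def conj_shift_def)
      qed
      then show ?thesis using F(2) unfolding \<Phi>_def by blast
    qed
    have conj_sub: "conj_set d [l] (random_subgroup \<omega>) \<subseteq> carr" for \<omega>
      by (rule conj_set_subset[OF lc]) (auto simp: random_subgroup_def)
    have pre: "conj_set d [l] -` A \<inter> space irs \<in> sets subsets"
      using measurable_sets[OF conj_set_measurable[OF lc], of A] A by (simp add: sets_irs)
    have e2: "random_subgroup -` (conj_set d [l] -` A \<inter> space irs) \<inter> space unit_measure =
        {\<omega> \<in> space unit_measure. \<Phi> (conj_shift l (S \<omega>))}"
      using mem conj_sub by (auto simp: F(3) space_irs random_subgroup_def)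
    have "emeasure (distr irs irs (conj_set d [l])) A = emeasure irs (conj_set d [l] -` A \<inter> space irs)"
      using A by (intro emeasure_distr conj_set_measurable[OF lc]) (simp add: sets_irs)
    also have "\<dots> = emeasure unit_measure {\<omega> \<in> space unit_measure. \<Phi> (conj_shift l (S \<omega>))}"
      unfolding irs_def[THEN arg_cong, of emeasure]
      by (subst emeasure_distr[OF random_subgroup_measurable pre]) (simp only: e2)
    also have "\<dots> = emeasure unit_measure {\<omega> \<in> space unit_measure. \<Phi> (S \<omega>)}"
      unfolding unit.emeasure_eq_measure using event_invariant[OF l q] by simp
    also have "\<dots> = emeasure irs A"
      unfolding irs_def by (subst emeasure_distr[OF random_subgroup_measurable A]) (simp only: e1)
    finally show "emeasure (distr irs irs (conj_set d [l])) A = emeasure irs A" .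
  qed auto
qed

lemma irs_conj_invariant: "g \<in> carr \<Longrightarrow> distr irs irs (conj_set d g) = irs"
proof (induction g)
  case Nil
  have "distr irs irs (conj_set d []) = distr irs irs (\<lambda>K. K)"
    by (rule distr_cong) (auto simp: space_irs conj_set_one)
  then show ?case by (simp add: distr_id2)
next
  case (Cons l g)
  have g: "g \<in> carr" and l: "l \<in> letters d" "[l] \<in> carr"
    using Cons.prems by (auto simp: free_group_simps reduced_Cons)
  have lg: "l # g = [l] \<otimes>\<^bsub>free_group d\<^esub> g"
    using Cons.prems foldr_reduced[of "l # g"] foldr_reduced[of g] by (simp add: free_group_simps reduced_Cons)
  have "distr irs irs (conj_set d (l # g)) = distr irs irs (conj_set d [l] \<circ> conj_set d g)"
    unfolding lg by (rule distr_cong) (auto simp: space_irs conj_set_mult[OF l(2) g])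
  also have "\<dots> = distr (distr irs irs (conj_set d g)) irs (conj_set d [l])"
    by (rule distr_distr[symmetric]) (rule conj_set_measurable[OF l(2)], rule conj_set_measurable[OF g])
  also have "\<dots> = irs" using Cons.IH[OF g] irs_letter_invariant[OF l(1)] by simp
  finally show ?case .
qed

lemma irs_in_IRS: "irs \<in> IRS d"
  unfolding IRS_def mem_Collect_eq
proof (intro conjI ballI)
  show "sets irs = sigma_sets (Pow carr) {U. openin (powerset_topology carr) U}"
    unfolding sigma_sets_powerset_topology[OF countable_carrier[OF d]] sets_irs sets_subsets ..
qed (use irs.prob_space_axioms space_irs AE_irs_subgroup irs_conj_invariant in auto)

definition pattern_prob :: "nat \<Rightarrow> nat \<Rightarrow> real" where
  "pattern_prob W \<sigma> = Pr (\<lambda>A. \<forall>c<W. digit 2 \<sigma> c = 1 \<longleftrightarrow> c \<in> A)"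

lemma pattern_local_event: "local_event (\<lambda>A. \<forall>c<W. digit 2 \<sigma> c = 1 \<longleftrightarrow> c \<in> A)"
  by (rule local_eventI[of "{..<W}"]) auto

lemma AE_pattern:
  "AE \<omega> in unit_measure. subgroup (random_subgroup \<omega>) (free_group d) \<and>
     ((\<forall>c<W. digit 2 \<sigma> c = 1 \<longleftrightarrow> reduce (word_of d c) \<in> random_subgroup \<omega>) \<longleftrightarrow>
      (\<forall>c<W. digit 2 \<sigma> c = 1 \<longleftrightarrow> c \<in> S \<omega>))"
proof -
  have "AE \<omega> in unit_measure. \<forall>c. code d (reduce (word_of d c)) \<in> S \<omega> \<longleftrightarrow> code d (word_of d c) \<in> S \<omega>"
    unfolding AE_all_countable using AE_reduce[OF word_of_set[OF d]] by blast
  with AE_random_subgroup show ?thesis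
  proof eventually_elim
    case (elim \<omega>)
    have "reduce (word_of d c) \<in> random_subgroup \<omega> \<longleftrightarrow> c \<in> S \<omega>" for c
      using elim(2) reduce_carrier[OF word_of_set[OF d]] word_of(2)[OF d] by (simp add: random_subgroup_def)
    then show ?case using elim(1) by simp
  qed
qed

text \<open>The limit is almost surely a subgroup, so it cannot show a pattern that no subgroup has.\<close>

lemma pattern_prob_eq_0:
  assumes "\<And>K. subgroup K (free_group d) \<Longrightarrow> \<not> (\<forall>c<W. digit 2 \<sigma> c = 1 \<longleftrightarrow> reduce (word_of d c) \<in> K)"
  shows "pattern_prob W \<sigma> = 0"
proof -
  have "AE \<omega> in unit_measure. \<not> (\<forall>c<W. digit 2 \<sigma> c = 1 \<longleftrightarrow> c \<in> S \<omega>)"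
    using AE_pattern[of W \<sigma>]
  proof eventually_elim
    case (elim \<omega>)
    then show ?case using assms[of "random_subgroup \<omega>"] by blast
  qed
  moreover note unit.prob_Collect_eq_0[OF event[OF pattern_local_event]]
  ultimately show ?thesis unfolding pattern_prob_def by (rule iffD2[rotated])
qed

lemma U_irs_eq_pattern_prob:
  assumes G: "schreier_graph d G" "v \<in> verts G" and C: "C \<in> ball_classes d r" "has_type (rball G r v) C"
    and \<sigma>: "\<And>c. c < words_below d (2 * r + 2) \<Longrightarrow> digit 2 \<sigma> c = 1 \<longleftrightarrow> walk G (word_of d c) v = v"
  shows "U_irs d r irs C = pattern_prob (words_below d (2 * r + 2)) \<sigma>"
proof -
  let ?W = "words_below d (2 * r + 2)"
  let ?Q = "\<lambda>K. \<forall>c<?W. digit 2 \<sigma> c = 1 \<longleftrightarrow> reduce (word_of d c) \<in> K"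
  let ?A = "{K \<in> space subsets. subgroup K (free_group d) \<and> ?Q K}"
  have "has_type (rball (coset_graph d K) r K) C \<longleftrightarrow> ?Q K" if K: "subgroup K (free_group d)" for K
  proof -
    have "has_type (rball (coset_graph d K) r K) C \<longleftrightarrow>
        (\<forall>c<?W. walk (coset_graph d K) (word_of d c) K = K \<longleftrightarrow> walk G (word_of d c) v = v)"
      using has_type_iff_fixing_words[OF G schreier_coset_graph[OF K] root_coset[OF K] C]
        all_short_words[OF d, of "2 * r + 1"] by simp
    then show ?thesis using \<sigma> walk_coset_graph_fixes[OF K word_of_set[OF d]] by auto
  qed
  then have "{K. subgroup K (free_group d) \<and> has_type (rball (coset_graph d K) r K) C} = ?A"
    by (auto simp: space_subsets dest: subgroup.subset)
  then have U: "U_irs d r irs C = measure irs ?A" unfolding U_irs_def using C(1) by simp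
  have mem: "{K \<in> space subsets. reduce (word_of d c) \<in> K} \<in> sets subsets" for c
    using member_event[OF reduce_carrier[OF word_of_set[OF d]]] by (simp add: space_subsets)
  have Qc: "{K \<in> space subsets. digit 2 \<sigma> c = 1 \<longleftrightarrow> reduce (word_of d c) \<in> K} \<in> sets subsets" for c
  proof (cases "digit 2 \<sigma> c = 1")
    case False
    then show ?thesis using sets.sets_Collect_neg[OF mem[of c]] by simp
  qed (use mem[of c] in simp)
  have "{K \<in> space subsets. \<forall>c\<in>{..<?W}. digit 2 \<sigma> c = 1 \<longleftrightarrow> reduce (word_of d c) \<in> K} \<in> sets subsets"
    by (rule sets.sets_Collect_countable_All'[OF Qc]) simp
  from sets.sets_Collect_conj[OF this subgroup_event] have A: "?A \<in> sets subsets"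
    by (simp only: Ball_def lessThan_iff)
  have "measure irs ?A = measure unit_measure (random_subgroup -` ?A \<inter> space unit_measure)"
    unfolding irs_def by (rule measure_distr[OF random_subgroup_measurable A])
  also have "\<dots> = pattern_prob ?W \<sigma>"
    unfolding pattern_prob_def
  proof (rule measure_eq_AE)
    show "random_subgroup -` ?A \<inter> space unit_measure \<in> sets unit_measure"
      by (rule measurable_sets[OF random_subgroup_measurable A])
    show "{\<omega> \<in> space unit_measure. \<forall>c<?W. digit 2 \<sigma> c = 1 \<longleftrightarrow> c \<in> S \<omega>} \<in> sets unit_measure"
      by (rule event[OF pattern_local_event])
    have sp: "random_subgroup \<omega> \<in> space subsets" for \<omega> by (auto simp: random_subgroup_def space_subsets)
    show "AE \<omega> in unit_measure. (\<omega> \<in> random_subgroup -` ?A \<inter> space unit_measure) =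
        (\<omega> \<in> {\<omega> \<in> space unit_measure. \<forall>c<?W. digit 2 \<sigma> c = 1 \<longleftrightarrow> c \<in> S \<omega>})"
      using AE_pattern[of ?W \<sigma>]
    proof eventually_elim
      case (elim \<omega>)
      then show ?case
        unfolding vimage_def Int_iff mem_Collect_eq using sp[of \<omega>] by blast
    qed
  qed
  finally show ?thesis unfolding U .
qed

lemma pattern_weight_limit:
  "(\<lambda>k. real (pattern_weight d (table_size d (lv k)) (type_count d (lv k)) (resolution d (lv k)) (P k) W \<sigma>)
      / real (resolution d (lv k))) \<longlonglongrightarrow> pattern_prob W \<sigma>"
proof -
  let ?\<Phi> = "\<lambda>A. \<forall>c<W. digit 2 \<sigma> c = 1 \<longleftrightarrow> c \<in> A"
  have "(\<lambda>k. E k ?\<Phi>) \<longlonglongrightarrow> pattern_prob W \<sigma>"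
    unfolding pattern_prob_def by (rule limit[OF pattern_local_event])
  moreover have "eventually (\<lambda>k. W \<le> lv k) sequentially" using lv by (simp add: filterlim_at_top)
  then have "eventually (\<lambda>k. E k ?\<Phi> = real (pattern_weight d (table_size d (lv k)) (type_count d (lv k))
      (resolution d (lv k)) (P k) W \<sigma>) / real (resolution d (lv k))) sequentially"
  proof eventually_elim
    case (elim k)
    show ?case unfolding pattern_weight_def weighted_sum_of_bool
    proof (intro sum.cong refl, goal_cases)
      case (1 j)
      have "pattern W \<sigma> (digit (table_size d (lv k)) j) \<longleftrightarrow> ?\<Phi> (fixed_codes d (lv k) j)"
        unfolding pattern_def ker_def using elim table_size_ge[OF d, of "lv k"] by auto
      then show ?case by simp
    qed
  qed
  ultimately show ?thesis by (rule Lim_transform_eventually)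
qed

end

section \<open>The test succeeds eventually\<close>

lemma d_inf_bound:
  assumes "C \<in> ball_classes d r" "\<And>C. C \<in> ball_classes d r \<Longrightarrow> 0 \<le> x C \<and> x C \<le> 1 \<and> 0 \<le> y C \<and> y C \<le> 1"
  shows "\<bar>x C - y C\<bar> \<le> d_inf d r x y"
  unfolding d_inf_def
proof (rule cSUP_upper[OF assms(1)])
  have "\<bar>x C - y C\<bar> \<le> 1" if "C \<in> ball_classes d r" for C
    using assms(2)[OF that] by linarith
  then show "bdd_above ((\<lambda>C. \<bar>x C - y C\<bar>) ` ball_classes d r)" by (auto intro!: bdd_aboveI2)
qed

lemma u_stat_bounds:
  assumes "finite (verts G)"
  shows "0 \<le> u_stat r C G \<and> u_stat r C G \<le> 1"
proof -
  have "card {v \<in> verts G. has_type (rball G r v) C} \<le> card (verts G)"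
    using assms by (intro card_mono) auto
  then show ?thesis unfolding u_stat_def by (cases "card (verts G) = 0") (auto simp: divide_le_eq_1)
qed

context limit_set
begin

text \<open>The distance \<open>d_inf\<close> controls the patterns that belong to some ball class, that is, those
  realized by a vertex of a Schreier graph. All other patterns have frequency zero on both sides.\<close>

lemma pattern_prob_near_finite_graph:
  assumes GF: "G \<in> finite_schreier_graphs d"
    and near: "d_inf d r (U_graph d r G) (U_irs d r irs) < \<delta>" and \<sigma>: "\<sigma> < 2 ^ W"
    and W: "W = words_below d (2 * r + 2)" and \<delta>: "0 < \<delta>"
  shows "\<bar>real (pattern_count d G W \<sigma>) / real (card (verts G)) - pattern_prob W \<sigma>\<bar> < \<delta>"
proof -
  have G: "schreier_graph d G" and fin: "finite (verts G)" using GF by (auto simp: finite_schreier_graphs_def)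
  have 0: "0 < W" using words_below_2[of d] words_below_mono[of 2 "2 * r + 2" d] W by simp
  have realized: ?thesis if G0: "schreier_graph d G0" "v \<in> verts G0"
    and bits: "\<And>c. c < W \<Longrightarrow> digit 2 \<sigma> c = 1 \<longleftrightarrow> walk G0 (word_of d c) v = v" for G0 :: "'v lgraph" and v
  proof -
    obtain C where C: "C \<in> ball_classes d r" "has_type (rball G0 r v) C"
      using rball_class_exists[OF G0] by blast
    have "\<bar>U_graph d r G C - U_irs d r irs C\<bar> \<le> d_inf d r (U_graph d r G) (U_irs d r irs)"
      by (rule d_inf_bound[OF C(1)])
        (use u_stat_bounds[OF fin] irs.prob_le_1 in \<open>auto simp: U_graph_def U_irs_def\<close>)
    moreover have "U_graph d r G C = real (pattern_count d G W \<sigma>) / real (card (verts G))"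
      using u_stat_eq_pattern[OF d G0 G C, of \<sigma>] bits C(1) by (simp add: U_graph_def W)
    moreover have "U_irs d r irs C = pattern_prob W \<sigma>"
      using U_irs_eq_pattern_prob[OF G0 C, of \<sigma>] bits by (simp add: W)
    ultimately show ?thesis using near by linarith
  qed
  show ?thesis
  proof (cases "\<exists>v\<in>verts G. pattern W \<sigma> (\<lambda>c. walk G (word_of d c) v)")
    case True
    then obtain v where "v \<in> verts G" "pattern W \<sigma> (\<lambda>c. walk G (word_of d c) v)" by blast
    then show ?thesis using realized[OF G, of v] by (auto simp: pattern_def word_of_0)
  next
    case no_vertex: False
    show ?thesis
    proof (cases "\<exists>K. subgroup K (free_group d) \<and> (\<forall>c<W. digit 2 \<sigma> c = 1 \<longleftrightarrow> reduce (word_of d c) \<in> K)")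
      case True
      then obtain K where K: "subgroup K (free_group d)" "\<forall>c<W. digit 2 \<sigma> c = 1 \<longleftrightarrow> reduce (word_of d c) \<in> K"
        by blast
      show ?thesis
        by (rule realized[OF schreier_coset_graph[OF K(1)] root_coset[OF K(1)]])
          (use K(2) walk_coset_graph_fixes[OF K(1) word_of_set[OF d]] in auto)
    next
      case False
      then have "pattern_prob W \<sigma> = 0" by (intro pattern_prob_eq_0) blast
      moreover have none: "{v \<in> verts G. pattern W \<sigma> (\<lambda>c. walk G (word_of d c) v)} = {}" using no_vertex by blast
      have "pattern_count d G W \<sigma> = 0" unfolding pattern_count_def none by simp
      ultimately show ?thesis using \<delta> by simp
    qed
  qed
qed

end

lemma close_counts:
  fixes a n S K num den :: nat
  assumes "\<bar>real a / real n - real S / real K\<bar> < real num / (2 * real den)" "0 < n" "0 < K" "0 < den"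
  shows "2 * den * K * a \<le> 2 * den * n * S + num * n * K \<and> 2 * den * n * S \<le> 2 * den * K * a + num * n * K"
proof -
  let ?c = "2 * real den * real n * real K"
  have c: "0 < ?c" using assms by simp
  have "real a / real n - real S / real K \<le> real num / (2 * real den)"
    "real S / real K - real a / real n \<le> real num / (2 * real den)"
    using assms(1) by linarith+
  note le = this[THEN mult_left_mono[OF _ less_imp_le[OF c]]]
  have eq: "?c * (real a / real n - real S / real K) = 2 * real den * real K * real a - 2 * real den * real n * real S"
    "?c * (real S / real K - real a / real n) = 2 * real den * real n * real S - 2 * real den * real K * real a"
    "?c * (real num / (2 * real den)) = real num * real n * real K"
    using assms by (simp_all add: field_simps)
  have "real (2 * den * K * a) \<le> real (2 * den * n * S + num * n * K)"
    using le(1) unfolding eq diff_le_eq by (simp only: of_nat_mult of_nat_add of_nat_numeral add.commute)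
  moreover have "real (2 * den * n * S) \<le> real (2 * den * K * a + num * n * K)"
    using le(2) unfolding eq diff_le_eq by (simp only: of_nat_mult of_nat_add of_nat_numeral add.commute)
  ultimately show ?thesis unfolding of_nat_le_iff by blast
qed

text \<open>If the test failed at every level, the counterexamples would accumulate at an invariant random
  subgroup. A finite graph close to it exists by density, and at large levels it approximates the
  counterexample that is supposed to have no approximation of at most that size.\<close>

lemma certified_exists:
  assumes d: "d \<ge> 1" and pos: "0 < num" "0 < den"
    and dense: "dense_wrt (d_inf d r) (U_graph d r ` finite_schreier_graphs d) (U_irs d r ` IRS d)"
  shows "\<exists>m. certified d m num den r"
proof (rule ccontr)
  assume no: "\<nexists>m. certified d m num den r"
  define W where "W = words_below d (2 * r + 2)"
  \<comment> \<open>From this level on, the conditions in the test that do not concern weights are satisfied.\<close>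
  define N where "N = W + 2 * den + 1"
  have "\<exists>P. almost_invariant d (k + N) (table_size d (k + N)) (type_count d (k + N)) (resolution d (k + N)) P \<and>
      \<not> approximated d (k + N) num den (table_size d (k + N)) (type_count d (k + N)) (resolution d (k + N)) W P" for k
  proof -
    have "\<not> certified d (k + N) num den r" using no by blast
    moreover have "2 * den < num * (k + N)"
    proof -
      have "2 * den < 1 * (k + N)" by (simp add: N_def)
      also have "\<dots> \<le> num * (k + N)" using pos by (intro mult_le_mono1) simp
      finally show ?thesis .
    qed
    moreover have "W \<le> k + N" by (simp add: N_def)
    ultimately show ?thesis
      unfolding certified_def certified_with_def type_count_def[symmetric] resolution_def[symmetric] W_def[symmetric]
      by blast
  qed
  then obtain P where
    inv: "\<And>k. almost_invariant d (k + N) (table_size d (k + N)) (type_count d (k + N)) (resolution d (k + N)) (P k)"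
    and napprox: "\<And>k. \<not> approximated d (k + N) num den (table_size d (k + N)) (type_count d (k + N)) (resolution d (k + N)) W (P k)"
    by metis
  have N: "0 < k + N" for k by (simp add: N_def)
  note bounds = total_weight_bounds[OF inv d N]
  have inv_lim: "(\<lambda>k. 1 / real (k + N)) \<longlonglongrightarrow> 0"
    using LIMSEQ_ignore_initial_segment[OF lim_const_over_n[of "1 :: real"], of N] by simp
  have total: "(\<lambda>k. sum (weight d (k + N) (P k)) (local_actions d (k + N))) \<longlonglongrightarrow> 1"
  proof (rule tendsto_sandwich)
    show "(\<lambda>k. 1 - 1 / real (k + N)) \<longlonglongrightarrow> 1" using tendsto_diff[OF tendsto_const inv_lim, of 1] by simp
  qed (use bounds in auto)
  have "0 \<le> weight d m p j" for m p j by (simp add: weight_def)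
  note random_set_limit[of "\<lambda>k. local_actions d (k + N)" "\<lambda>k. weight d (k + N) (P k)"
      "\<lambda>k. fixed_codes d (k + N)", OF finite_local_actions this bounds(1) total]
  then obtain s S where s: "strict_mono (s :: nat \<Rightarrow> nat)" and
    lim: "\<forall>\<Phi>. local_event \<Phi> \<longrightarrow>
     {\<omega> \<in> space unit_measure. \<Phi> (S \<omega>)} \<in> sets unit_measure \<and>
     (\<lambda>k. \<Sum>j\<in>local_actions d (s k + N). weight d (s k + N) (P (s k)) j * of_bool (\<Phi> (fixed_codes d (s k + N) j)))
        \<longlonglongrightarrow> measure unit_measure {\<omega> \<in> space unit_measure. \<Phi> (S \<omega>)}"
    by (elim exE conjE)
  interpret limit_set d "\<lambda>k. s k + N" "\<lambda>k. P (s k)" S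
  proof
    have "s k \<le> s k + N" for k by simp
    then show "filterlim (\<lambda>k. s k + N) at_top sequentially"
      using filterlim_at_top_mono[OF filterlim_subseq[OF s]] by (auto intro: always_eventually)
  qed (rule d N inv lim[rule_format], assumption?)+
  \<comment> \<open>One quarter of \<open>num / den\<close> for the distance of the finite graph to the limit and one quarter
    for the distance of the weights to the limit add up to the half that \<open>approximated\<close> allows.\<close>
  define \<delta> where "\<delta> = real num / (4 * real den)"
  have \<delta>: "0 < \<delta>" using pos by (simp add: \<delta>_def)
  obtain G where G: "G \<in> finite_schreier_graphs d" "d_inf d r (U_graph d r G) (U_irs d r irs) < \<delta>"
    using dense irs_in_IRS \<delta> unfolding dense_wrt_def by blast
  define n where "n = card (verts G)"
  have "words_below d 2 \<le> W" unfolding W_def by (rule words_below_mono) simp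
  from table_exists[OF G(1) d this] obtain H where n: "0 < n" and H: "H < n ^ (W * n)"
    "action_table d n W (\<lambda>c x. digit n H (c * n + x))"
    "\<And>\<sigma>. table_count n W (\<lambda>c x. digit n H (c * n + x)) \<sigma> = pattern_count d G W \<sigma>"
    unfolding n_def by blast
  let ?S = "\<lambda>k \<sigma>. pattern_weight d (table_size d (s k + N)) (type_count d (s k + N)) (resolution d (s k + N)) (P (s k)) W \<sigma>"
  let ?K = "\<lambda>k. resolution d (s k + N)"
  have "eventually (\<lambda>k. \<bar>real (?S k \<sigma>) / real (?K k) - pattern_prob W \<sigma>\<bar> < \<delta>) sequentially" for \<sigma>
    using pattern_weight_limit[of W \<sigma>] \<delta> by (auto simp: tendsto_iff dist_real_def)
  then have "eventually (\<lambda>k. \<forall>\<sigma>\<in>{..<2 ^ W}. \<bar>real (?S k \<sigma>) / real (?K k) - pattern_prob W \<sigma>\<bar> < \<delta>) sequentially"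
    by (intro eventually_ball_finite) auto
  moreover have "eventually (\<lambda>k. n \<le> s k + N) sequentially" using lv by (simp add: filterlim_at_top)
  ultimately have "eventually (\<lambda>k. (\<forall>\<sigma>\<in>{..<2 ^ W}. \<bar>real (?S k \<sigma>) / real (?K k) - pattern_prob W \<sigma>\<bar> < \<delta>) \<and> n \<le> s k + N) sequentially"
    by (rule eventually_conj)
  then obtain k where k: "\<And>\<sigma>. \<sigma> < 2 ^ W \<Longrightarrow> \<bar>real (?S k \<sigma>) / real (?K k) - pattern_prob W \<sigma>\<bar> < \<delta>" "n \<le> s k + N"
    unfolding eventually_sequentially by blast
  have "0 < type_count d (s k + N)" using table_size_ge[OF d, of "s k + N"] by (simp add: type_count_def)
  then have K: "0 < ?K k" using N by (simp add: resolution_def)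
  have close: "2 * den * ?K k * pattern_count d G W \<sigma> \<le> 2 * den * n * ?S k \<sigma> + num * n * ?K k \<and>
      2 * den * n * ?S k \<sigma> \<le> 2 * den * ?K k * pattern_count d G W \<sigma> + num * n * ?K k" if \<sigma>: "\<sigma> < 2 ^ W" for \<sigma>
  proof (rule close_counts[OF _ n K pos(2)])
    have "\<bar>real (pattern_count d G W \<sigma>) / real n - pattern_prob W \<sigma>\<bar> < \<delta>"
      unfolding n_def by (rule pattern_prob_near_finite_graph[OF G \<sigma> W_def \<delta>])
    moreover have "2 * \<delta> = real num / (2 * real den)" by (simp add: \<delta>_def)
    ultimately show "\<bar>real (pattern_count d G W \<sigma>) / real n - real (?S k \<sigma>) / real (?K k)\<bar> < real num / (2 * real den)"
      using k(1)[OF \<sigma>] by linarith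
  qed
  have "approximated d (s k + N) num den (table_size d (s k + N)) (type_count d (s k + N)) (resolution d (s k + N)) W (P (s k))"
    unfolding approximated_def
    by (intro exI[of _ n] exI[of _ H] conjI) (use k(2) n H close in auto)
  with napprox show False by blast
qed

theorem mainTheorem2:
  assumes "\<forall>d\<ge>1. \<forall>r. dense_wrt (d_inf d r)
             (U_graph d r ` finite_schreier_graphs d) (U_irs d r ` IRS d)"
  shows "\<forall>d\<ge>1. \<exists>N. schreier_regularity_bound d N \<and> turing_computable N"
proof (intro allI impI)
  fix d :: nat assume d: "1 \<le> d"
  let ?num = "\<lambda>\<epsilon>. nat (fst (quotient_of \<epsilon>))" and ?den = "\<lambda>\<epsilon>. nat (snd (quotient_of \<epsilon>))"
  define N where "N = (\<lambda>\<epsilon> r. LEAST m. certified d m (?num \<epsilon>) (?den \<epsilon>) r)"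
  have ex: "\<exists>m. certified d m num den r" if "0 < num" "0 < den" for num den r
    using certified_exists[OF d that] assms d by blast
  have "turing_computable N"
    unfolding N_def by (rule turing_computable_Least[OF cpred_certified ex])
  moreover have "schreier_regularity_bound d N"
    unfolding schreier_regularity_bound_def
  proof (intro allI impI ballI)
    fix \<epsilon> :: rat and r G assume \<epsilon>: "0 < \<epsilon>" and G: "G \<in> finite_schreier_graphs d"
    have den: "0 < snd (quotient_of \<epsilon>)" by (rule quotient_of_denom_pos')
    have q: "\<epsilon> = rat_of_int (fst (quotient_of \<epsilon>)) / rat_of_int (snd (quotient_of \<epsilon>))"
      by (rule quotient_of_div) simp
    then have num: "0 < fst (quotient_of \<epsilon>)"
      using \<epsilon> den by (metis of_int_0_less_iff zero_less_divide_iff not_less_iff_gr_or_eq)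
    have "real_of_rat \<epsilon> = real_of_int (fst (quotient_of \<epsilon>)) / real_of_int (snd (quotient_of \<epsilon>))"
      by (subst q) (simp add: of_rat_divide)
    then have e: "real_of_rat \<epsilon> = real (?num \<epsilon>) / real (?den \<epsilon>)" using num den by simp
    have "certified d (N \<epsilon> r) (?num \<epsilon>) (?den \<epsilon>) r"
      unfolding N_def using ex[of "?num \<epsilon>" "?den \<epsilon>" r] num den by (auto intro: LeastI_ex)
    from certified_sound[OF d this _ G] den
    show "\<exists>G'\<in>finite_schreier_graphs d. card (verts G') \<le> N \<epsilon> r \<and>
        (\<forall>C\<in>ball_classes d r. \<bar>u_stat r C G - u_stat r C G'\<bar> < real_of_rat \<epsilon>)"
      unfolding e by simp
  qed
  ultimately show "\<exists>N. schreier_regularity_bound d N \<and> turing_computable N" by blast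
qed

end
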